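(* Let $M$ be a symmetric space over $\mathbb{K}$ with base point $o$. (i) The Lie triple bracket of the Lie triple system $\mathfrak m=T_oM$ associated to $(M,o)$ is $C^0$ (i.e. the map $\mathfrak m\times\mathfrak m\times\mathfrak m\to\mathfrak m$ is continuous). (ii) If $\phi:M\to M'$ is a homomorphism of symmetric spaces such that $\phi(o)=o'$, then $\dot\phi:=T_o\phi:\mathfrak m\to\mathfrak m'$ is a homomorphism of Lie triple systems, where $\mathfrak m'=T_{o'}M'$ is the Lie triple system associated to $(M',o')$.
   Context: $\mathbb{K}$ is a commutative topological ring with unit $1$ (ring operations continuous, unit group $\mathbb{K}^\times$ open, inversion on $\mathbb{K}^\times$ continuous) such that $\mathbb{K}^\times$ is dense in $\mathbb{K}$ and $2$ is invertible. Topological $\mathbb{K}$-modules are assumed Hausdorff; $C^0$ means continuous. Calculus: for topological $\mathbb{K}$-modules $V,W$ and $U\subset V$ open, $f:U\to W$ is $C^1$ if there is a continuous map $f^{[1]}:\{(x,v,t)\in U\times V\times\mathbb{K}: x+tv\in U\}\to W$ with $f(x+tv)-f(x)=t\,f^{[1]}(x,v,t)$; then $df(x)v:=f^{[1]}(x,v,0)$. $f$ is $C^{k+1}$ if it is $C^1$ and $f^{[1]}$ is $C^k$; smooth means $C^k$ for all $k$. A smooth manifold modeled on a topological $\mathbb{K}$-module $E$ is a topological space with an atlas of charts onto open subsets of $E$ with smooth transition functions; smooth maps, the tangent bundle $TM$ (itself a smooth manifold), and tangent maps $Tf$ are defined as usual. The Lie bracket of vector fields is given in a chart by $[X,Y](x)=dY(x)X(x)-dX(x)Y(x)$.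 A symmetric space over $\mathbb K$ is a smooth manifold $M$ with a smooth map $m:M\times M\to M$ such that, with $\sigma_x:=m(x,\cdot)$, for all $x,y,z\in M$: $m(x,x)=x$; $m(x,m(x,y))=y$; $m(x,m(y,z))=m(m(x,y),m(x,z))$; $T_x(\sigma_x)=-\mathrm{id}_{T_xM}$. Homomorphisms of symmetric spaces are smooth maps compatible with the multiplication maps. Fix a base point $o\in M$. A derivation of $M$ is a vector field $X:M\to TM$ that is a homomorphism from $(M,m)$ to $(TM,Tm)$. For $v\in T_oM$ there is a unique derivation $\tilde v$ with $T\sigma_o\circ\tilde v\circ\sigma_o=-\tilde v$ and $\tilde v(o)=v$, namely $\tilde v(p)=\frac12Tm(v,Tm(0_o,0_p))$, where $0_p$ is the zero vector of $T_pM$. The Lie triple system associated to $(M,o)$ is $\mathfrak m:=T_oM$ with the triple bracket $[u,v,w]:=[[\tilde u,\tilde v],\tilde w](o)$. *)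

theory Defs
  imports "HOL-Analysis.Analysis"
begin

text \<open>Since the group of units is open, continuity of inversion on it may be stated at each unit with the
  full neighbourhood filter.\<close>

class base_ring = comm_ring_1 + topological_ab_group_add + topological_monoid_mult +
  assumes open_units: "open {a. a dvd 1}"
    and tendsto_unit_inverse: "a * b = 1 \<Longrightarrow> filterlim (\<lambda>x. THE y. x * y = 1) (nhds b) (nhds a)"
    and dense_units: "open U \<Longrightarrow> U \<noteq> {} \<Longrightarrow> \<exists>a\<in>U. a dvd 1"
    and two_unit: "2 dvd 1"

text \<open>The module structure is an explicit scalar multiplication, since the library has type classes
  for topological abelian groups but not for modules over an arbitrary ring.\<close>

locale topological_module = module scale
  for scale :: "'k::base_ring \<Rightarrow> 'e::{topological_ab_group_add,t2_space} \<Rightarrow> 'e" +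
  assumes continuous_on_scale: "continuous_on UNIV (\<lambda>(r, x). scale r x)"

instance prod :: (topological_monoid_add, topological_monoid_add) topological_monoid_add
proof
  fix a b :: "'a \<times> 'b"
  have "((\<lambda>x. (fst (fst x) + fst (snd x), snd (fst x) + snd (snd x))) \<longlongrightarrow> (fst a + fst b, snd a + snd b))
      (nhds a \<times>\<^sub>F nhds b)"
    by (intro tendsto_intros filterlim_fst filterlim_snd)
  then show "((\<lambda>x. fst x + snd x) \<longlongrightarrow> a + b) (nhds a \<times>\<^sub>F nhds b)"
    by (simp add: plus_prod_def)
qed

instance prod :: (topological_group_add, topological_group_add) topological_group_add
proof
  fix a :: "'a \<times> 'b"
  have "((\<lambda>x. (- fst x, - snd x)) \<longlongrightarrow> (- fst a, - snd a)) (nhds a)"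
    by (intro tendsto_intros filterlim_ident)
  then show "(uminus \<longlongrightarrow> - a) (nhds a)"
    by (simp add: uminus_prod_def [abs_def])
qed

instance prod :: (topological_ab_group_add, topological_ab_group_add) topological_ab_group_add ..

definition prod_scale :: "('k \<Rightarrow> 'e \<Rightarrow> 'e) \<Rightarrow> ('k \<Rightarrow> 'f \<Rightarrow> 'f) \<Rightarrow> 'k \<Rightarrow> 'e \<times> 'f \<Rightarrow> 'e \<times> 'f"
  where "prod_scale s s' r x = (s r (fst x), s' r (snd x))"

text \<open>The map \<open>f\<^sup>[\<^sup>1\<^sup>]\<close> has its domain in \<open>V \<times> V \<times> K\<close>, so the domain of the iterated map lies in a
  module whose type changes at each step.  Points of all the iterated modules
  \<open>V\<^sub>0 = V\<close>, \<open>V\<^sub>n\<^sub>+\<^sub>1 = V\<^sub>n \<times> V\<^sub>n \<times> K\<close> are therefore collected in one type; \<open>Ext x v t\<close> is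
  the triple \<open>(x, v, t)\<close>, and \<open>iter_space n\<close> is the set \<open>V\<^sub>n\<close>.\<close>

datatype ('v, 'k) iter =
    Pt (unPt: 'v)
  | Ext (ipoint: "('v, 'k) iter") (idir: "('v, 'k) iter") (ipar: 'k)

primrec iter_space :: "nat \<Rightarrow> ('v, 'k) iter set" where
  "iter_space 0 = range Pt"
| "iter_space (Suc n) = {Ext x v t | x v t. x \<in> iter_space n \<and> v \<in> iter_space n}"

primrec iter_top :: "nat \<Rightarrow> ('v::topological_space, 'k::topological_space) iter topology" where
  "iter_top 0 = pullback_topology (iter_space 0) unPt euclidean"
| "iter_top (Suc n) = pullback_topology (iter_space (Suc n)) (\<lambda>z. (ipoint z, idir z, ipar z))
     (prod_topology (iter_top n) (prod_topology (iter_top n) euclidean))"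

fun iter_add :: "('v::plus, 'k::plus) iter \<Rightarrow> ('v, 'k) iter \<Rightarrow> ('v, 'k) iter" where
  "iter_add (Pt x) (Pt y) = Pt (x + y)"
| "iter_add (Ext x v s) (Ext y w t) = Ext (iter_add x y) (iter_add v w) (s + t)"
| "iter_add _ _ = undefined"

primrec iter_scale :: "('k::times \<Rightarrow> 'v \<Rightarrow> 'v) \<Rightarrow> 'k \<Rightarrow> ('v, 'k) iter \<Rightarrow> ('v, 'k) iter" where
  "iter_scale s r (Pt x) = Pt (s r x)"
| "iter_scale s r (Ext x v t) = Ext (iter_scale s r x) (iter_scale s r v) (r * t)"

definition ext_dom ::
    "('k::base_ring \<Rightarrow> 'v::topological_ab_group_add \<Rightarrow> 'v) \<Rightarrow> nat \<Rightarrow> ('v, 'k) iter set \<Rightarrow> ('v, 'k) iter set"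
  where "ext_dom s n U =
    {Ext x v t | x v t. x \<in> U \<and> v \<in> iter_space n \<and> iter_add x (iter_scale s t v) \<in> U}"

text \<open>\<open>g\<close> is a map \<open>f\<^sup>[\<^sup>1\<^sup>]\<close> for \<open>f\<close> on \<open>U \<subseteq> V\<^sub>n\<close>; it is unique on its domain, the units being dense
  and the target being Hausdorff.\<close>

definition is_diff_quot ::
    "('k::base_ring \<Rightarrow> 'v::topological_ab_group_add \<Rightarrow> 'v) \<Rightarrow>
     ('k \<Rightarrow> 'w::{topological_ab_group_add,t2_space} \<Rightarrow> 'w) \<Rightarrow> nat \<Rightarrow> ('v, 'k) iter set \<Rightarrow>
     (('v, 'k) iter \<Rightarrow> 'w) \<Rightarrow> (('v, 'k) iter \<Rightarrow> 'w) \<Rightarrow> bool"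
  where "is_diff_quot s s' n U f g \<longleftrightarrow>
    continuous_map (subtopology (iter_top (Suc n)) (ext_dom s n U)) euclidean g \<and>
    (\<forall>x v t. Ext x v t \<in> ext_dom s n U \<longrightarrow>
      f (iter_add x (iter_scale s t v)) - f x = s' t (g (Ext x v t)))"

primrec Ck_iter ::
    "('k::base_ring \<Rightarrow> 'v::topological_ab_group_add \<Rightarrow> 'v) \<Rightarrow>
     ('k \<Rightarrow> 'w::{topological_ab_group_add,t2_space} \<Rightarrow> 'w) \<Rightarrow>
     nat \<Rightarrow> nat \<Rightarrow> ('v, 'k) iter set \<Rightarrow> (('v, 'k) iter \<Rightarrow> 'w) \<Rightarrow> bool"
  where
    "Ck_iter s s' 0 n U f \<longleftrightarrow> continuous_map (subtopology (iter_top n) U) euclidean f"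
  | "Ck_iter s s' (Suc k) n U f \<longleftrightarrow>
      (\<exists>g. is_diff_quot s s' n U f g \<and> Ck_iter s s' k (Suc n) (ext_dom s n U) g)"

definition smooth_on ::
    "('k::base_ring \<Rightarrow> 'v::topological_ab_group_add \<Rightarrow> 'v) \<Rightarrow>
     ('k \<Rightarrow> 'w::{topological_ab_group_add,t2_space} \<Rightarrow> 'w) \<Rightarrow> 'v set \<Rightarrow> ('v \<Rightarrow> 'w) \<Rightarrow> bool"
  where "smooth_on s s' U f \<longleftrightarrow> open U \<and> (\<forall>k. Ck_iter s s' k 0 (Pt ` U) (f \<circ> unPt))"

text \<open>\<open>df(x)v\<close> for a map that is \<open>C\<^sup>1\<close> on some open neighbourhood of \<open>x\<close>; the value does not
  depend on the neighbourhood.\<close>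

definition differential ::
    "('k::base_ring \<Rightarrow> 'v::topological_ab_group_add \<Rightarrow> 'v) \<Rightarrow>
     ('k \<Rightarrow> 'w::{topological_ab_group_add,t2_space} \<Rightarrow> 'w) \<Rightarrow> ('v \<Rightarrow> 'w) \<Rightarrow> 'v \<Rightarrow> 'v \<Rightarrow> 'w"
  where "differential s s' f x v = (THE w. \<exists>U g. open U \<and> x \<in> U \<and>
    is_diff_quot s s' 0 (Pt ` U) (f \<circ> unPt) g \<and> w = g (Ext (Pt x) (Pt v) 0))"

text \<open>A manifold is carried by the set \<open>topspace (mtop M)\<close>; a chart is its domain together with the
  coordinate map, whose values outside the domain are irrelevant.\<close>

type_synonym ('m, 'e) chart = "'m set \<times> ('m \<Rightarrow> 'e)"

record ('m, 'e, 'k) manifold =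
  mtop :: "'m topology"
  atlas :: "('m, 'e) chart set"
  mscale :: "'k \<Rightarrow> 'e \<Rightarrow> 'e"

abbreviation points :: "('m, 'e, 'k) manifold \<Rightarrow> 'm set"
  where "points M \<equiv> topspace (mtop M)"

abbreviation chart_inv :: "('m, 'e) chart \<Rightarrow> 'e \<Rightarrow> 'm"
  where "chart_inv c \<equiv> inv_into (fst c) (snd c)"

definition smooth_manifold ::
    "('m, 'e::{topological_ab_group_add,t2_space}, 'k::base_ring) manifold \<Rightarrow> bool"
  where "smooth_manifold M \<longleftrightarrow>
    topological_module (mscale M) \<and>
    (\<Union>c\<in>atlas M. fst c) = points M \<and>
    (\<forall>c\<in>atlas M. openin (mtop M) (fst c) \<and> open (snd c ` fst c) \<and>
      homeomorphic_map (subtopology (mtop M) (fst c)) (top_of_set (snd c ` fst c)) (snd c)) \<and>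
    (\<forall>c\<in>atlas M. \<forall>d\<in>atlas M.
      smooth_on (mscale M) (mscale M) (snd c ` (fst c \<inter> fst d)) (snd d \<circ> chart_inv c))"

text \<open>Smoothness of a map is required near each point.  Over a ring that is not a field,
  the \<open>C\<^sup>k\<close> property need not be local (consider \<open>K = \<real> \<times> \<real>\<close>), so this can be weaker than smoothness
  of the coordinate expressions on their entire domains; only the version near each point is
  evidently stable under composition.\<close>

definition smooth_map ::
    "('m, 'e::{topological_ab_group_add,t2_space}, 'k::base_ring) manifold \<Rightarrow>
     ('n, 'f::{topological_ab_group_add,t2_space}, 'k) manifold \<Rightarrow> ('m \<Rightarrow> 'n) \<Rightarrow> bool"
  where "smooth_map M N f \<longleftrightarrow>
    f ` points M \<subseteq> points N \<and>
    (\<forall>p\<in>points M. \<forall>c\<in>atlas M. \<forall>d\<in>atlas N. p \<in> fst c \<and> f p \<in> fst d \<longrightarrow>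
      (\<exists>W. openin (mtop M) W \<and> p \<in> W \<and> W \<subseteq> fst c \<and> f ` W \<subseteq> fst d \<and>
        smooth_on (mscale M) (mscale N) (snd c ` W) (snd d \<circ> f \<circ> chart_inv c)))"

definition prod_manifold ::
    "('m, 'e, 'k) manifold \<Rightarrow> ('n, 'f, 'k) manifold \<Rightarrow> ('m \<times> 'n, 'e \<times> 'f, 'k) manifold"
  where "prod_manifold M N =
    \<lparr>mtop = prod_topology (mtop M) (mtop N),
     atlas = {(fst c \<times> fst d, map_prod (snd c) (snd d)) | c d. c \<in> atlas M \<and> d \<in> atlas N},
     mscale = prod_scale (mscale M) (mscale N)\<rparr>"

text \<open>A tangent vector at \<open>p\<close> is \<open>p\<close> together with a class of pairs \<open>(c, v)\<close>, where \<open>c\<close> is a chart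
  at \<open>p\<close> and \<open>v\<close> a vector of the model space, modulo the differentials of the transition
  functions.\<close>

type_synonym ('m, 'e) tvec = "'m \<times> (('m, 'e) chart \<times> 'e) set"

definition tangent_vector ::
    "('m, 'e::{topological_ab_group_add,t2_space}, 'k::base_ring) manifold \<Rightarrow>
     ('m, 'e) chart \<Rightarrow> 'm \<Rightarrow> 'e \<Rightarrow> ('m, 'e) tvec"
  where "tangent_vector M c p v = (p, {(d, w). d \<in> atlas M \<and> p \<in> fst d \<and>
    w = differential (mscale M) (mscale M) (snd d \<circ> chart_inv c) (snd c p) v})"

definition tangent_space ::
    "('m, 'e::{topological_ab_group_add,t2_space}, 'k::base_ring) manifold \<Rightarrow> 'm \<Rightarrow> ('m, 'e) tvec set"
  where "tangent_space M p = {tangent_vector M c p v | c v. c \<in> atlas M \<and> p \<in> fst c}"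

definition tcoord :: "('m, 'e) chart \<Rightarrow> ('m, 'e) tvec \<Rightarrow> 'e"
  where "tcoord c \<xi> = (THE v. (c, v) \<in> snd \<xi>)"

definition tangent_chart ::
    "('m, 'e::{topological_ab_group_add,t2_space}, 'k::base_ring) manifold \<Rightarrow>
     ('m, 'e) chart \<Rightarrow> (('m, 'e) tvec, 'e \<times> 'e) chart"
  where "tangent_chart M c =
    (\<Union>p\<in>fst c. tangent_space M p, \<lambda>\<xi>. (snd c (fst \<xi>), tcoord c \<xi>))"

definition tangent_bundle ::
    "('m, 'e::{topological_ab_group_add,t2_space}, 'k::base_ring) manifold \<Rightarrow>
     (('m, 'e) tvec, 'e \<times> 'e, 'k) manifold"
  where "tangent_bundle M =
    \<lparr>mtop = topology_generated_by
       {{\<xi> \<in> fst (tangent_chart M c). snd (tangent_chart M c) \<xi> \<in> S} | c S. c \<in> atlas M \<and> open S},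
     atlas = tangent_chart M ` atlas M,
     mscale = prod_scale (mscale M) (mscale M)\<rparr>"

definition chart_at :: "('m, 'e, 'k) manifold \<Rightarrow> 'm \<Rightarrow> ('m, 'e) chart"
  where "chart_at M p = (SOME c. c \<in> atlas M \<and> p \<in> fst c)"

text \<open>The following operations are written in an arbitrarily chosen chart at the base point; they do
  not depend on the choice.\<close>

definition tzero ::
    "('m, 'e::{topological_ab_group_add,t2_space}, 'k::base_ring) manifold \<Rightarrow> 'm \<Rightarrow> ('m, 'e) tvec"
  where "tzero M p = tangent_vector M (chart_at M p) p 0"

definition tadd ::
    "('m, 'e::{topological_ab_group_add,t2_space}, 'k::base_ring) manifold \<Rightarrow>
     ('m, 'e) tvec \<Rightarrow> ('m, 'e) tvec \<Rightarrow> ('m, 'e) tvec"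
  where "tadd M \<xi> \<eta> = (let c = chart_at M (fst \<xi>) in
    tangent_vector M c (fst \<xi>) (tcoord c \<xi> + tcoord c \<eta>))"

definition tscale ::
    "('m, 'e::{topological_ab_group_add,t2_space}, 'k::base_ring) manifold \<Rightarrow>
     'k \<Rightarrow> ('m, 'e) tvec \<Rightarrow> ('m, 'e) tvec"
  where "tscale M r \<xi> = (let c = chart_at M (fst \<xi>) in
    tangent_vector M c (fst \<xi>) (mscale M r (tcoord c \<xi>)))"

definition tminus ::
    "('m, 'e::{topological_ab_group_add,t2_space}, 'k::base_ring) manifold \<Rightarrow>
     ('m, 'e) tvec \<Rightarrow> ('m, 'e) tvec"
  where "tminus M \<xi> = (let c = chart_at M (fst \<xi>) in
    tangent_vector M c (fst \<xi>) (- tcoord c \<xi>))"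

definition tangent_map ::
    "('m, 'e::{topological_ab_group_add,t2_space}, 'k::base_ring) manifold \<Rightarrow>
     ('n, 'f::{topological_ab_group_add,t2_space}, 'k) manifold \<Rightarrow> ('m \<Rightarrow> 'n) \<Rightarrow>
     ('m, 'e) tvec \<Rightarrow> ('n, 'f) tvec"
  where "tangent_map M N f \<xi> =
    (let p = fst \<xi>; c = chart_at M p; d = chart_at N (f p) in
      tangent_vector N d (f p)
        (differential (mscale M) (mscale N) (snd d \<circ> f \<circ> chart_inv c) (snd c p) (tcoord c \<xi>)))"

text \<open>The identification of \<open>TM \<times> TN\<close> with \<open>T(M \<times> N)\<close>.\<close>

definition tpair ::
    "('m, 'e::{topological_ab_group_add,t2_space}, 'k::base_ring) manifold \<Rightarrow>
     ('n, 'f::{topological_ab_group_add,t2_space}, 'k) manifold \<Rightarrow>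
     ('m, 'e) tvec \<times> ('n, 'f) tvec \<Rightarrow> ('m \<times> 'n, 'e \<times> 'f) tvec"
  where "tpair M N = (\<lambda>(\<xi>, \<eta>).
    let c = chart_at M (fst \<xi>); d = chart_at N (fst \<eta>) in
      tangent_vector (prod_manifold M N) (fst c \<times> fst d, map_prod (snd c) (snd d))
        (fst \<xi>, fst \<eta>) (tcoord c \<xi>, tcoord d \<eta>))"

definition lie_bracket ::
    "('m, 'e::{topological_ab_group_add,t2_space}, 'k::base_ring) manifold \<Rightarrow>
     ('m \<Rightarrow> ('m, 'e) tvec) \<Rightarrow> ('m \<Rightarrow> ('m, 'e) tvec) \<Rightarrow> 'm \<Rightarrow> ('m, 'e) tvec"
  where "lie_bracket M X Y p =
    (let c = chart_at M p; x = snd c p; D = differential (mscale M) (mscale M);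
         X' = (\<lambda>y. tcoord c (X (chart_inv c y)));
         Y' = (\<lambda>y. tcoord c (Y (chart_inv c y)))
     in tangent_vector M c p (D Y' x (X' x) - D X' x (Y' x)))"

definition symmetric_space ::
    "('m, 'e::{topological_ab_group_add,t2_space}, 'k::base_ring) manifold \<Rightarrow> ('m \<times> 'm \<Rightarrow> 'm) \<Rightarrow> bool"
  where "symmetric_space M m \<longleftrightarrow>
    smooth_manifold M \<and>
    smooth_map (prod_manifold M M) M m \<and>
    (\<forall>x\<in>points M. m (x, x) = x) \<and>
    (\<forall>x\<in>points M. \<forall>y\<in>points M. m (x, m (x, y)) = y) \<and>
    (\<forall>x\<in>points M. \<forall>y\<in>points M. \<forall>z\<in>points M. m (x, m (y, z)) = m (m (x, y), m (x, z))) \<and>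
    (\<forall>x\<in>points M. \<forall>\<xi>\<in>tangent_space M x. tangent_map M M (\<lambda>y. m (x, y)) \<xi> = tminus M \<xi>)"

definition symmetric_hom ::
    "('m, 'e::{topological_ab_group_add,t2_space}, 'k::base_ring) manifold \<Rightarrow> ('m \<times> 'm \<Rightarrow> 'm) \<Rightarrow>
     ('n, 'f::{topological_ab_group_add,t2_space}, 'k) manifold \<Rightarrow> ('n \<times> 'n \<Rightarrow> 'n) \<Rightarrow>
     ('m \<Rightarrow> 'n) \<Rightarrow> bool"
  where "symmetric_hom M m N n f \<longleftrightarrow>
    smooth_map M N f \<and> (\<forall>x\<in>points M. \<forall>y\<in>points M. f (m (x, y)) = n (f x, f y))"

definition tangent_mult ::
    "('m, 'e::{topological_ab_group_add,t2_space}, 'k::base_ring) manifold \<Rightarrow> ('m \<times> 'm \<Rightarrow> 'm) \<Rightarrow>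
     ('m, 'e) tvec \<times> ('m, 'e) tvec \<Rightarrow> ('m, 'e) tvec"
  where "tangent_mult M m = tangent_map (prod_manifold M M) M m \<circ> tpair M M"

definition derivation ::
    "('m, 'e::{topological_ab_group_add,t2_space}, 'k::base_ring) manifold \<Rightarrow> ('m \<times> 'm \<Rightarrow> 'm) \<Rightarrow>
     ('m \<Rightarrow> ('m, 'e) tvec) \<Rightarrow> bool"
  where "derivation M m X \<longleftrightarrow>
    (\<forall>p\<in>points M. X p \<in> tangent_space M p) \<and>
    symmetric_hom M m (tangent_bundle M) (tangent_mult M m) X"

definition tilde ::
    "('m, 'e::{topological_ab_group_add,t2_space}, 'k::base_ring) manifold \<Rightarrow> ('m \<times> 'm \<Rightarrow> 'm) \<Rightarrow>
     'm \<Rightarrow> ('m, 'e) tvec \<Rightarrow> 'm \<Rightarrow> ('m, 'e) tvec"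
  where "tilde M m b v = (THE X.
    X \<in> extensional (points M) \<and> derivation M m X \<and>
    (\<forall>p\<in>points M. tangent_map M M (\<lambda>y. m (b, y)) (X (m (b, p))) = tminus M (X p)) \<and>
    X b = v)"

record ('t, 'k) lts =
  lcarrier :: "'t set"
  ladd :: "'t \<Rightarrow> 't \<Rightarrow> 't"
  lscale :: "'k \<Rightarrow> 't \<Rightarrow> 't"
  lbracket :: "'t \<Rightarrow> 't \<Rightarrow> 't \<Rightarrow> 't"

definition assoc_lts ::
    "('m, 'e::{topological_ab_group_add,t2_space}, 'k::base_ring) manifold \<Rightarrow> ('m \<times> 'm \<Rightarrow> 'm) \<Rightarrow>
     'm \<Rightarrow> (('m, 'e) tvec, 'k) lts"
  where "assoc_lts M m b =
    \<lparr>lcarrier = tangent_space M b, ladd = tadd M, lscale = tscale M,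
     lbracket = (\<lambda>u v w.
       lie_bracket M (lie_bracket M (tilde M m b u) (tilde M m b v)) (tilde M m b w) b)\<rparr>"

definition lts_hom :: "('t, 'k) lts \<Rightarrow> ('s, 'k) lts \<Rightarrow> ('t \<Rightarrow> 's) \<Rightarrow> bool"
  where "lts_hom A B f \<longleftrightarrow>
    f ` lcarrier A \<subseteq> lcarrier B \<and>
    (\<forall>u\<in>lcarrier A. \<forall>v\<in>lcarrier A. f (ladd A u v) = ladd B (f u) (f v)) \<and>
    (\<forall>r. \<forall>u\<in>lcarrier A. f (lscale A r u) = lscale B r (f u)) \<and>
    (\<forall>u\<in>lcarrier A. \<forall>v\<in>lcarrier A. \<forall>w\<in>lcarrier A.
      f (lbracket A u v w) = lbracket B (f u) (f v) (f w))"

end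

theory Submission
  imports Defs
begin

text \<open>
  Everything follows from an explicit description of the derivations. Write \<open>R\<close> and \<open>L\<close> for the partial
  derivatives of the multiplication \<open>m\<close>, so that \<open>Tm(v, w) = R v + L w\<close>. Differentiating the axioms of a
  symmetric space gives linear identities between \<open>R\<close> and \<open>L\<close>: at the diagonal \<open>L = -1\<close> and \<open>R = 2\<close>,
  and self-distributivity, differentiated in its first and in its second argument, gives
  \<open>R_mult\<close> and \<open>L_R\<close>. They show that \<open>p \<mapsto> 1/2 R v\<close>, where \<open>R\<close> is the derivative at \<open>b\<close> of
  \<open>x \<mapsto> m(x, m(b, p))\<close>, is a derivation with value \<open>v\<close> at \<open>b\<close> that is reversed by the symmetry at \<open>b\<close>,
  and that there is no other (\<open>tilde_eq_tfield\<close>).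

  The formula has two consequences. First, the coordinates of the derivation depend smoothly on the
  point and on \<open>v\<close> together (\<open>smooth_at_tfield\<close>). The triple bracket is a differential expression in
  this smooth map, and therefore continuous. Secondly, a homomorphism \<open>\<phi>\<close> intertwines the partial
  derivatives of the two multiplications, because \<open>\<phi>(m(x, y)) = m'(\<phi> x, \<phi> y)\<close>; so the derivation with
  value \<open>v\<close> is \<open>\<phi>\<close>-related to the derivation with value \<open>T\<phi> v\<close> (\<open>tfield_related\<close>). Lie brackets of
  \<open>\<phi>\<close>-related fields are \<open>\<phi>\<close>-related (\<open>field_related_lie_bracket\<close>), and evaluation at \<open>b\<close> shows that
  \<open>T\<phi>\<close> preserves the triple bracket.

  The calculus behind this rests on three facts. Compositions of smooth maps are smooth
  (\<open>Ck_compose\<close>). The difference quotient of a smooth map is smooth, hence so is its differential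
  (\<open>smooth_on_difference_quotient\<close>, \<open>smooth_at_differential\<close>). Second differentials are symmetric
  (\<open>second_differential_symmetric\<close>); this is what makes the bracket of vector fields independent of
  charts and natural. Limits are taken along the units of the base ring: for a unit \<open>t\<close> the quotient
  \<open>(f (x + tv) - f x) / t\<close> is determined by \<open>f\<close>, and the units are dense.
\<close>

section \<open>Topology of the iterated modules\<close>

lemma topspace_iter_top [simp]: "topspace (iter_top n) = iter_space n"
  by (induction n) (auto simp: topspace_pullback_topology)

lemma continuous_map_unPt: "continuous_map (iter_top 0) euclidean unPt"
  using continuous_map_pullback[OF continuous_map_id, of "iter_space 0" unPt] by simp

lemma continuous_map_Pt:
  assumes "continuous_map X euclidean f"
  shows "continuous_map X (iter_top 0) (\<lambda>z. Pt (f z))"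
  unfolding iter_top.simps
  by (rule continuous_map_pullback') (use assms in \<open>auto simp: o_def\<close>)

lemma continuous_map_Ext:
  assumes "continuous_map X (iter_top n) a" "continuous_map X (iter_top n) b"
    and "continuous_map X euclidean c"
  shows "continuous_map X (iter_top (Suc n)) (\<lambda>z. Ext (a z) (b z) (c z))"
proof -
  have "a z \<in> iter_space n" "b z \<in> iter_space n" if "z \<in> topspace X" for z
    using assms(1,2) that by (auto simp: continuous_map_def)
  then show ?thesis
    unfolding iter_top.simps
    by (intro continuous_map_pullback')
      (use assms in \<open>auto simp: o_def intro!: continuous_map_pairedI\<close>)
qed

lemma continuous_map_ipoint: "continuous_map (iter_top (Suc n)) (iter_top n) ipoint"
  and continuous_map_idir: "continuous_map (iter_top (Suc n)) (iter_top n) idir"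
  and continuous_map_ipar: "continuous_map (iter_top (Suc n)) euclidean ipar"
proof -
  have "continuous_map (iter_top (Suc n)) (iter_top n) (fst \<circ> (\<lambda>z. (ipoint z, idir z, ipar z)))"
    unfolding iter_top.simps by (intro continuous_map_pullback continuous_intros)
  then show "continuous_map (iter_top (Suc n)) (iter_top n) ipoint"
    by (simp add: o_def)
  have "continuous_map (iter_top (Suc n)) (iter_top n)
      ((fst \<circ> snd) \<circ> (\<lambda>z. (ipoint z, idir z, ipar z)))"
    unfolding iter_top.simps
    by (intro continuous_map_pullback continuous_map_compose[OF continuous_map_snd]
        continuous_map_fst)
  then show "continuous_map (iter_top (Suc n)) (iter_top n) idir"
    by (simp add: o_def)
  have "continuous_map (iter_top (Suc n)) euclidean
      ((snd \<circ> snd) \<circ> (\<lambda>z. (ipoint z, idir z, ipar z)))"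
    unfolding iter_top.simps
    by (intro continuous_map_pullback continuous_map_compose[OF continuous_map_snd]
        continuous_map_snd)
  then show "continuous_map (iter_top (Suc n)) euclidean ipar"
    by (simp add: o_def)
qed

section \<open>Modules with a continuous scalar multiplication\<close>

text \<open>The base ring is a module over itself in this sense although it may fail to be Hausdorff; it
  is a factor of the domain of every difference quotient.\<close>

locale continuous_module = module scale
  for scale :: "'k::base_ring \<Rightarrow> 'e::topological_ab_group_add \<Rightarrow> 'e" +
  assumes continuous_scale: "continuous_on UNIV (\<lambda>(r, x). scale r x)"
begin

lemma tendsto_scale:
  assumes "(r \<longlongrightarrow> a) F" "(x \<longlongrightarrow> y) F"
  shows "((\<lambda>z. scale (r z) (x z)) \<longlongrightarrow> scale a y) F"
proof -
  have "((\<lambda>(r, x). scale r x) \<longlongrightarrow> (case (a, y) of (r, x) \<Rightarrow> scale r x)) (nhds (a, y))"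
    using continuous_scale unfolding continuous_on_def
    by (subst tendsto_at_iff_tendsto_nhds [symmetric]) blast
  from filterlim_compose[OF this tendsto_Pair[OF assms]] show ?thesis
    by simp
qed

lemma continuous_on_scaleI:
  "continuous_on A r \<Longrightarrow> continuous_on A x \<Longrightarrow> continuous_on A (\<lambda>z. scale (r z) (x z))"
  unfolding continuous_on_def by (auto intro: tendsto_scale)

lemma unit_cancel:
  assumes "t dvd 1" "scale t x = scale t y"
  shows "x = y"
proof -
  from assms(1) obtain u where u: "1 = t * u" ..
  have "x = scale u (scale t x)" "y = scale u (scale t y)"
    using u by (simp_all add: mult.commute)
  with assms(2) show ?thesis by simp
qed

end

lemma topological_module_iff: "topological_module s \<longleftrightarrow> continuous_module s"
  by (simp add: topological_module_def continuous_module_def topological_module_axioms_def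
      continuous_module_axioms_def)

lemma continuous_module_mult: "continuous_module ((*) :: 'k::base_ring \<Rightarrow> 'k \<Rightarrow> 'k)"
  by standard (auto simp: algebra_simps split_def intro!: continuous_intros)

lemma module_prod_scale:
  assumes "module s" "module s'"
  shows "module (prod_scale s s')"
proof -
  interpret s: module s by fact
  interpret s': module s' by fact
  show ?thesis
    by standard (auto simp: prod_scale_def s.scale_right_distrib s'.scale_right_distrib
        s.scale_left_distrib s'.scale_left_distrib)
qed

lemma continuous_module_prod_scale:
  assumes "continuous_module s" "continuous_module s'"
  shows "continuous_module (prod_scale s s')"
proof -
  interpret s: continuous_module s by fact
  interpret s': continuous_module s' by fact
  interpret module "prod_scale s s'"
    by (intro module_prod_scale s.module_axioms s'.module_axioms)
  show ?thesis
    by standard (auto simp: prod_scale_def split_def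
        intro!: continuous_intros s.continuous_on_scaleI s'.continuous_on_scaleI)
qed

section \<open>Maps of class \<open>C\<^sup>k\<close> between iterated modules\<close>

text \<open>The chain rule for difference quotients reads
  \<open>(g \<circ> f)\<^sup>[\<^sup>1\<^sup>](x, v, t) = g\<^sup>[\<^sup>1\<^sup>](f x, f\<^sup>[\<^sup>1\<^sup>](x, v, t), t)\<close>: the inner map of this composition has values in the
  first iterated module of the target.  An induction on the order therefore needs the class
  \<open>C\<^sup>k\<close> for targets of the form \<open>iter_top j\<close>, which are not instances of a class of topological groups.
  For this reason the topology, the addition and the scalar multiplication of the target
  are parameters here.\<close>

primrec Ck ::
    "('k::base_ring \<Rightarrow> 'v::topological_ab_group_add \<Rightarrow> 'v) \<Rightarrow>
     'w topology \<Rightarrow> ('w \<Rightarrow> 'w \<Rightarrow> 'w) \<Rightarrow> ('k \<Rightarrow> 'w \<Rightarrow> 'w) \<Rightarrow>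
     nat \<Rightarrow> nat \<Rightarrow> ('v, 'k) iter set \<Rightarrow> (('v, 'k) iter \<Rightarrow> 'w) \<Rightarrow> bool"
  where
    "Ck s T ad sc 0 n U f \<longleftrightarrow> continuous_map (subtopology (iter_top n) U) T f"
  | "Ck s T ad sc (Suc k) n U f \<longleftrightarrow> continuous_map (subtopology (iter_top n) U) T f \<and>
      (\<exists>g. (\<forall>x v t. Ext x v t \<in> ext_dom s n U \<longrightarrow>
          f (iter_add x (iter_scale s t v)) = ad (f x) (sc t (g (Ext x v t)))) \<and>
        Ck s T ad sc k (Suc n) (ext_dom s n U) g)"

lemma Ck_SucI:
  assumes "continuous_map (subtopology (iter_top n) U) T f"
    and "\<And>x v t. Ext x v t \<in> ext_dom s n U \<Longrightarrow>
      f (iter_add x (iter_scale s t v)) = ad (f x) (sc t (g (Ext x v t)))"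
    and "Ck s T ad sc k (Suc n) (ext_dom s n U) g"
  shows "Ck s T ad sc (Suc k) n U f"
  using assms unfolding Ck.simps by blast

lemma Ck_SucE:
  assumes "Ck s T ad sc (Suc k) n U f"
  obtains g where "\<And>x v t. Ext x v t \<in> ext_dom s n U \<Longrightarrow>
      f (iter_add x (iter_scale s t v)) = ad (f x) (sc t (g (Ext x v t)))"
    "Ck s T ad sc k (Suc n) (ext_dom s n U) g"
  using assms unfolding Ck.simps by blast

lemma Ck_continuous: "Ck s T ad sc k n U f \<Longrightarrow> continuous_map (subtopology (iter_top n) U) T f"
  by (cases k) auto

lemma Ck_Suc_imp: "Ck s T ad sc (Suc k) n U f \<Longrightarrow> Ck s T ad sc k n U f"
proof (induction k arbitrary: n U f)
  case (Suc k)
  from Suc.prems show ?case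
    by (rule Ck_SucE) (rule Ck_SucI[OF Ck_continuous[OF Suc.prems] _ Suc.IH])
qed simp

lemma ext_dom_subset: "U \<subseteq> iter_space n \<Longrightarrow> ext_dom s n U \<subseteq> iter_space (Suc n)"
  by (auto simp: ext_dom_def)

lemma Ck_subset:
  "Ck s T ad sc k n U f \<Longrightarrow> U' \<subseteq> U \<Longrightarrow> Ck s T ad sc k n U' f"
proof (induction k arbitrary: n U U' f)
  case 0
  then show ?case by (auto intro: continuous_map_from_subtopology_mono)
next
  case (Suc k)
  have sub: "ext_dom s n U' \<subseteq> ext_dom s n U"
    using Suc.prems(2) by (auto simp: ext_dom_def)
  from Suc.prems(1) show ?case
  proof (rule Ck_SucE)
    fix g
    assume g: "\<And>x v t. Ext x v t \<in> ext_dom s n U \<Longrightarrow>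
        f (iter_add x (iter_scale s t v)) = ad (f x) (sc t (g (Ext x v t)))"
      "Ck s T ad sc k (Suc n) (ext_dom s n U) g"
    show ?case
      by (rule Ck_SucI[OF _ g(1) Suc.IH[OF g(2) sub]])
        (use sub Ck_continuous[OF Suc.prems(1)] Suc.prems(2) in
          \<open>auto intro: continuous_map_from_subtopology_mono\<close>)
  qed
qed

lemma Ck_cong:
  assumes "Ck s T ad sc k n U f" "\<And>x. x \<in> U \<Longrightarrow> f x = f' x"
  shows "Ck s T ad sc k n U f'"
proof (cases k)
  case 0
  with assms show ?thesis by (auto elim!: continuous_map_eq)
next
  case (Suc j)
  have cont: "continuous_map (subtopology (iter_top n) U) T f'"
    using Ck_continuous[OF assms(1)] assms(2) by (auto elim!: continuous_map_eq)
  from assms(1)[unfolded Suc] show ?thesis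
  proof (rule Ck_SucE)
    fix g
    assume g: "\<And>x v t. Ext x v t \<in> ext_dom s n U \<Longrightarrow>
        f (iter_add x (iter_scale s t v)) = ad (f x) (sc t (g (Ext x v t)))"
      "Ck s T ad sc j (Suc n) (ext_dom s n U) g"
    have "f' (iter_add x (iter_scale s t v)) = ad (f' x) (sc t (g (Ext x v t)))"
      if "Ext x v t \<in> ext_dom s n U" for x v t
      using g(1)[OF that] that assms(2) by (auto simp: ext_dom_def)
    then show ?thesis unfolding Suc by (rule Ck_SucI[OF cont _ g(2)])
  qed
qed

text \<open>The difference quotient of \<open>f \<circ> L\<close>, with \<open>L\<close> continuous and linear, is
  \<open>f\<^sup>[\<^sup>1\<^sup>] \<circ> (L \<times> L \<times> id)\<close>, and \<open>L \<times> L \<times> id\<close> is again continuous and linear.\<close>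

lemma Ck_comp_linear:
  fixes L :: "('v::topological_ab_group_add, 'k::base_ring) iter \<Rightarrow>
    ('u::topological_ab_group_add, 'k) iter"
  assumes "Ck s T ad sc k j U f"
    and "continuous_map (iter_top n) (iter_top j) L"
    and "\<And>x v t. x \<in> iter_space n \<Longrightarrow> v \<in> iter_space n \<Longrightarrow>
      L (iter_add x (iter_scale s' t v)) = iter_add (L x) (iter_scale s t (L v))"
    and "U' \<subseteq> iter_space n" "L ` U' \<subseteq> U"
  shows "Ck s' T ad sc k n U' (f \<circ> L)"
  using assms
proof (induction k arbitrary: n j U U' f L)
  case 0
  have "continuous_map (subtopology (iter_top n) U') (subtopology (iter_top j) U) L"
    using 0 by (auto simp: continuous_map_in_subtopology continuous_map_from_subtopology)
  then show ?case
    using continuous_map_compose 0(1) unfolding Ck.simps by blast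
next
  case (Suc k)
  from Suc.prems(1) obtain g where g: "\<And>x v t. Ext x v t \<in> ext_dom s j U \<Longrightarrow>
      f (iter_add x (iter_scale s t v)) = ad (f x) (sc t (g (Ext x v t)))"
    "Ck s T ad sc k (Suc j) (ext_dom s j U) g"
    by (rule Ck_SucE) blast
  define L' where "L' z = Ext (L (ipoint z)) (L (idir z)) (ipar z)" for z
  have Lsp: "L x \<in> iter_space j" if "x \<in> iter_space n" for x
    using Suc.prems(2) that by (auto simp: continuous_map_def)
  have contL': "continuous_map (iter_top (Suc n)) (iter_top (Suc j)) L'"
    unfolding L'_def
    by (intro continuous_map_Ext continuous_map_ipar
        continuous_map_compose[OF continuous_map_ipoint Suc.prems(2), unfolded o_def]
        continuous_map_compose[OF continuous_map_idir Suc.prems(2), unfolded o_def])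
  have linL': "L' (iter_add x (iter_scale s' t v)) = iter_add (L' x) (iter_scale s t (L' v))"
    if "x \<in> iter_space (Suc n)" "v \<in> iter_space (Suc n)" for x v t
    using that by (auto simp: L'_def Suc.prems(3))
  have dom: "Ext (L x) (L v) t \<in> ext_dom s j U" if "Ext x v t \<in> ext_dom s' n U'" for x v t
    using that Suc.prems(4,5) Lsp Suc.prems(3)[of x v t, symmetric] by (auto simp: ext_dom_def)
  have img: "L' ` ext_dom s' n U' \<subseteq> ext_dom s j U"
  proof
    fix z assume "z \<in> L' ` ext_dom s' n U'"
    then obtain x v t where "Ext x v t \<in> ext_dom s' n U'" "z = L' (Ext x v t)"
      by (auto simp: ext_dom_def)
    then show "z \<in> ext_dom s j U" using dom by (simp add: L'_def)
  qed
  have "continuous_map (subtopology (iter_top n) U') (subtopology (iter_top j) U) L"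
    using Suc.prems(2,5) by (auto simp: continuous_map_in_subtopology continuous_map_from_subtopology)
  then have "continuous_map (subtopology (iter_top n) U') T (f \<circ> L)"
    using continuous_map_compose Ck_continuous[OF Suc.prems(1)] by blast
  then show ?case
  proof (rule Ck_SucI)
    show "Ck s' T ad sc k (Suc n) (ext_dom s' n U') (g \<circ> L')"
      by (rule Suc.IH[OF g(2) contL' linL' ext_dom_subset[OF Suc.prems(4)] img])
  next
    fix x v t assume xvt: "Ext x v t \<in> ext_dom s' n U'"
    then have "x \<in> iter_space n" "v \<in> iter_space n"
      using Suc.prems(4) by (auto simp: ext_dom_def)
    then show "(f \<circ> L) (iter_add x (iter_scale s' t v)) =
        ad ((f \<circ> L) x) (sc t ((g \<circ> L') (Ext x v t)))"
      using g(1)[OF dom[OF xvt]] by (simp add: L'_def Suc.prems(3))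
  qed
qed

text \<open>The difference quotient of a continuous linear map \<open>f\<close> is \<open>f\<close> applied to the direction, which is
  again continuous and linear.\<close>

lemma Ck_linear:
  assumes "continuous_map (iter_top n) T f"
    and "\<And>x v t. x \<in> iter_space n \<Longrightarrow> v \<in> iter_space n \<Longrightarrow>
      f (iter_add x (iter_scale s t v)) = ad (f x) (sc t (f v))"
    and "U \<subseteq> iter_space n"
  shows "Ck s T ad sc k n U f"
  using assms
proof (induction k arbitrary: n U f)
  case 0
  then show ?case by (auto intro: continuous_map_from_subtopology)
next
  case (Suc k)
  show ?case
  proof (rule Ck_SucI)
    show "Ck s T ad sc k (Suc n) (ext_dom s n U) (f \<circ> idir)"
    proof (rule Suc.IH)
      show "continuous_map (iter_top (Suc n)) T (f \<circ> idir)"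
        by (rule continuous_map_compose[OF continuous_map_idir Suc.prems(1)])
      show "ext_dom s n U \<subseteq> iter_space (Suc n)"
        by (rule ext_dom_subset[OF Suc.prems(3)])
    qed (auto simp: Suc.prems(2))
    show "continuous_map (subtopology (iter_top n) U) T f"
      using Suc.prems(1) by (rule continuous_map_from_subtopology)
  qed (use Suc.prems(2,3) in \<open>auto simp: ext_dom_def\<close>)
qed

text \<open>Here \<open>z\<close> is the zero of the target, the difference quotient of every constant.\<close>

lemma Ck_const:
  assumes "c \<in> topspace T" "z \<in> topspace T" "\<And>t. ad c (sc t z) = c" "\<And>t. ad z (sc t z) = z"
  shows "Ck s T ad sc k n U (\<lambda>_. c)"
  using assms(1,3)
proof (induction k arbitrary: n U c)
  case (Suc k)
  show ?case
    by (rule Ck_SucI[where g = "\<lambda>_. z"])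
      (use Suc.prems Suc.IH[of z] assms(2,4) in simp_all)
qed simp

lemma Ck_ipar:
  "Ck s euclidean (+) (*) k (Suc n) U ipar" if "U \<subseteq> iter_space (Suc n)"
  by (rule Ck_linear[OF continuous_map_ipar _ that]) auto

lemma Ck_Ext:
  assumes "Ck s (iter_top j) iter_add (iter_scale s') k n U a"
    and "Ck s (iter_top j) iter_add (iter_scale s') k n U b"
    and "Ck s euclidean (+) (*) k n U c"
  shows "Ck s (iter_top (Suc j)) iter_add (iter_scale s') k n U (\<lambda>z. Ext (a z) (b z) (c z))"
  using assms
proof (induction k arbitrary: n U a b c)
  case 0
  then show ?case unfolding Ck.simps by (intro continuous_map_Ext)
next
  case (Suc k)
  from Suc.prems(1) obtain a1 where a1: "\<And>x v t. Ext x v t \<in> ext_dom s n U \<Longrightarrow>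
      a (iter_add x (iter_scale s t v)) = iter_add (a x) (iter_scale s' t (a1 (Ext x v t)))"
    "Ck s (iter_top j) iter_add (iter_scale s') k (Suc n) (ext_dom s n U) a1"
    by (rule Ck_SucE) blast
  from Suc.prems(2) obtain b1 where b1: "\<And>x v t. Ext x v t \<in> ext_dom s n U \<Longrightarrow>
      b (iter_add x (iter_scale s t v)) = iter_add (b x) (iter_scale s' t (b1 (Ext x v t)))"
    "Ck s (iter_top j) iter_add (iter_scale s') k (Suc n) (ext_dom s n U) b1"
    by (rule Ck_SucE) blast
  from Suc.prems(3) obtain c1 where c1: "\<And>x v t. Ext x v t \<in> ext_dom s n U \<Longrightarrow>
      c (iter_add x (iter_scale s t v)) = c x + t * c1 (Ext x v t)"
    "Ck s euclidean (+) (*) k (Suc n) (ext_dom s n U) c1"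
    by (rule Ck_SucE) blast
  show ?case
  proof (rule Ck_SucI)
    show "Ck s (iter_top (Suc j)) iter_add (iter_scale s') k (Suc n) (ext_dom s n U)
        (\<lambda>z. Ext (a1 z) (b1 z) (c1 z))"
      by (rule Suc.IH[OF a1(2) b1(2) c1(2)])
  next
    show "continuous_map (subtopology (iter_top n) U) (iter_top (Suc j)) (\<lambda>z. Ext (a z) (b z) (c z))"
      by (intro continuous_map_Ext Suc.prems[THEN Ck_continuous])
  qed (simp add: a1(1) b1(1) c1(1))
qed

lemma Ck_Pt:
  assumes "Ck s euclidean (+) s' k n U f"
  shows "Ck s (iter_top 0) iter_add (iter_scale s') k n U (\<lambda>z. Pt (f z))"
  using assms
proof (induction k arbitrary: n U f)
  case 0
  then show ?case unfolding Ck.simps by (intro continuous_map_Pt)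
next
  case (Suc k)
  from Suc.prems obtain f1 where f1: "\<And>x v t. Ext x v t \<in> ext_dom s n U \<Longrightarrow>
      f (iter_add x (iter_scale s t v)) = f x + s' t (f1 (Ext x v t))"
    "Ck s euclidean (+) s' k (Suc n) (ext_dom s n U) f1"
    by (rule Ck_SucE) blast
  show ?case
  proof (rule Ck_SucI)
    show "Ck s (iter_top 0) iter_add (iter_scale s') k (Suc n) (ext_dom s n U) (\<lambda>z. Pt (f1 z))"
      by (rule Suc.IH[OF f1(2)])
    show "continuous_map (subtopology (iter_top n) U) (iter_top 0) (\<lambda>z. Pt (f z))"
      by (intro continuous_map_Pt Suc.prems[THEN Ck_continuous])
  qed (simp add: f1(1))
qed

lemma Ck_Pair:
  assumes "Ck s euclidean (+) s1 k n U f" "Ck s euclidean (+) s2 k n U g"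
  shows "Ck s euclidean (+) (prod_scale s1 s2) k n U (\<lambda>z. (f z, g z))"
  using assms
proof (induction k arbitrary: n U f g)
  case 0
  then show ?case
    unfolding Ck.simps using continuous_map_pairedI[of "subtopology (iter_top n) U" euclidean f euclidean g]
    by simp
next
  case (Suc k)
  from Suc.prems(1) obtain f1 where f1: "\<And>x v t. Ext x v t \<in> ext_dom s n U \<Longrightarrow>
      f (iter_add x (iter_scale s t v)) = f x + s1 t (f1 (Ext x v t))"
    "Ck s euclidean (+) s1 k (Suc n) (ext_dom s n U) f1"
    by (rule Ck_SucE) blast
  from Suc.prems(2) obtain g1 where g1: "\<And>x v t. Ext x v t \<in> ext_dom s n U \<Longrightarrow>
      g (iter_add x (iter_scale s t v)) = g x + s2 t (g1 (Ext x v t))"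
    "Ck s euclidean (+) s2 k (Suc n) (ext_dom s n U) g1"
    by (rule Ck_SucE) blast
  show ?case
  proof (rule Ck_SucI)
    show "Ck s euclidean (+) (prod_scale s1 s2) k (Suc n) (ext_dom s n U) (\<lambda>z. (f1 z, g1 z))"
      by (rule Suc.IH[OF f1(2) g1(2)])
    show "continuous_map (subtopology (iter_top n) U) euclidean (\<lambda>z. (f z, g z))"
      using continuous_map_pairedI[OF Suc.prems[THEN Ck_continuous]] by simp
  qed (simp add: f1(1) g1(1) prod_scale_def)
qed

text \<open>The difference quotient of \<open>g \<circ> F\<close> is \<open>g\<^sup>[\<^sup>1\<^sup>]\<close> after \<open>(x, v, t) \<mapsto> (F x, F\<^sup>[\<^sup>1\<^sup>](x, v, t), t)\<close>. The
  induction hypothesis of order \<open>k\<close> applies to it once the inner map is known to be \<open>C\<^sup>k\<close>, which holds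
  component by component.\<close>

lemma Ck_compose:
  assumes "Ck s' T ad sc k j U g"
    and "Ck s (iter_top j) iter_add (iter_scale s') k n U' F"
    and "U' \<subseteq> iter_space n" "F ` U' \<subseteq> U"
  shows "Ck s T ad sc k n U' (g \<circ> F)"
  using assms
proof (induction k arbitrary: n j U U' g F)
  case 0
  have "continuous_map (subtopology (iter_top n) U') (subtopology (iter_top j) U) F"
    using 0 by (auto simp: continuous_map_in_subtopology)
  then show ?case
    using continuous_map_compose 0(1) unfolding Ck.simps by blast
next
  case (Suc k)
  from Suc.prems(1) obtain g1 where g1: "\<And>x v t. Ext x v t \<in> ext_dom s' j U \<Longrightarrow>
      g (iter_add x (iter_scale s' t v)) = ad (g x) (sc t (g1 (Ext x v t)))"
    "Ck s' T ad sc k (Suc j) (ext_dom s' j U) g1"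
    by (rule Ck_SucE) blast
  from Suc.prems(2) obtain F1 where F1: "\<And>x v t. Ext x v t \<in> ext_dom s n U' \<Longrightarrow>
      F (iter_add x (iter_scale s t v)) = iter_add (F x) (iter_scale s' t (F1 (Ext x v t)))"
    "Ck s (iter_top j) iter_add (iter_scale s') k (Suc n) (ext_dom s n U') F1"
    by (rule Ck_SucE) blast
  let ?F' = "\<lambda>z. Ext ((F \<circ> ipoint) z) (F1 z) (ipar z)"
  have sub: "ext_dom s n U' \<subseteq> iter_space (Suc n)"
    by (rule ext_dom_subset[OF Suc.prems(3)])
  have "Ck s (iter_top j) iter_add (iter_scale s') k (Suc n) (ext_dom s n U') (F \<circ> ipoint)"
    by (rule Ck_comp_linear[OF Ck_Suc_imp[OF Suc.prems(2)] continuous_map_ipoint _ sub])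
      (auto simp: ext_dom_def)
  then have F': "Ck s (iter_top (Suc j)) iter_add (iter_scale s') k (Suc n) (ext_dom s n U') ?F'"
    by (intro Ck_Ext F1(2) Ck_ipar sub)
  have F1sp: "F1 z \<in> iter_space j" if "z \<in> ext_dom s n U'" for z
    using Ck_continuous[OF F1(2)] that sub
    by (auto simp: continuous_map_def simp del: iter_space.simps iter_top.simps)
  have dom: "Ext (F x) (F1 (Ext x v t)) t \<in> ext_dom s' j U" if "Ext x v t \<in> ext_dom s n U'" for x v t
    using F1sp[OF that] F1(1)[OF that] that Suc.prems(4) by (fastforce simp: ext_dom_def)
  have img: "?F' ` ext_dom s n U' \<subseteq> ext_dom s' j U"
  proof
    fix z assume "z \<in> ?F' ` ext_dom s n U'"
    then obtain x v t where "Ext x v t \<in> ext_dom s n U'" "z = ?F' (Ext x v t)"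
      by (auto simp: ext_dom_def)
    then show "z \<in> ext_dom s' j U" using dom by simp
  qed
  show ?case
  proof (rule Ck_SucI)
    show "Ck s T ad sc k (Suc n) (ext_dom s n U') (g1 \<circ> ?F')"
      by (rule Suc.IH[OF g1(2) F' sub img])
    show "continuous_map (subtopology (iter_top n) U') T (g \<circ> F)"
    proof (rule continuous_map_compose)
      show "continuous_map (subtopology (iter_top n) U') (subtopology (iter_top j) U) F"
        using Ck_continuous[OF Suc.prems(2)] Suc.prems(4) by (auto simp: continuous_map_in_subtopology)
      show "continuous_map (subtopology (iter_top j) U) T g"
        by (rule Ck_continuous[OF Suc.prems(1)])
    qed
  qed (use g1(1)[OF dom] F1(1) in auto)
qed

text \<open>A difference quotient at step \<open>1\<close> gives \<open>f y = f x\<^sub>0 + f\<^sup>[\<^sup>1\<^sup>](x\<^sub>0, y - x\<^sub>0, 1)\<close>, so a \<open>C\<^sup>1\<close> map is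
  continuous.\<close>

lemma continuous_map_iter_translate:
  fixes a :: "('v::topological_ab_group_add, 'k::base_ring) iter"
  assumes "a \<in> iter_space n"
  shows "continuous_map (iter_top n) (iter_top n) (\<lambda>y. iter_add y a)"
  using assms
proof (induction n arbitrary: a)
  case 0
  then obtain c where c: "a = Pt c" by auto
  have "continuous_map (iter_top 0) (iter_top 0) (\<lambda>y. Pt (unPt y + c))"
  proof (intro continuous_map_Pt)
    have "continuous_map euclidean euclidean (\<lambda>x. x + c)"
      by (auto intro!: continuous_intros)
    from continuous_map_compose[OF continuous_map_unPt this]
    show "continuous_map (iter_top 0) euclidean (\<lambda>y. unPt y + c)"
      by (simp add: o_def)
  qed
  then show ?case
    by (rule continuous_map_eq) (auto simp: c topspace_pullback_topology)
next
  case (Suc n)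
  then obtain x v t where a: "a = Ext x v t" and xv: "x \<in> iter_space n" "v \<in> iter_space n" by auto
  have par: "continuous_map euclidean euclidean (\<lambda>x. x + t)"
    by (auto intro!: continuous_intros)
  have "continuous_map (iter_top (Suc n)) (iter_top (Suc n))
      (\<lambda>y. Ext (iter_add (ipoint y) x) (iter_add (idir y) v) (ipar y + t))"
    using continuous_map_compose[OF continuous_map_ipoint Suc.IH[OF xv(1)]]
      continuous_map_compose[OF continuous_map_idir Suc.IH[OF xv(2)]]
      continuous_map_compose[OF continuous_map_ipar par]
    by (intro continuous_map_Ext) (auto simp: o_def)
  then show ?case
    by (rule continuous_map_eq) (auto simp: a simp del: iter_top.simps)
qed

lemma (in module) iter_scale_in_space:
  "x \<in> iter_space n \<Longrightarrow> iter_scale scale t x \<in> iter_space n"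
  by (induction n arbitrary: x) auto

lemma iter_add_in_space:
  "x \<in> iter_space n \<Longrightarrow> y \<in> iter_space n \<Longrightarrow> iter_add x y \<in> iter_space n"
proof (induction n arbitrary: x y)
  case (Suc n)
  then show ?case by (auto simp: Suc.IH)
qed auto

lemma (in module) iter_add_diff:
  "x \<in> iter_space n \<Longrightarrow> y \<in> iter_space n \<Longrightarrow>
    iter_add x (iter_scale scale 1 (iter_add y (iter_scale scale (- 1) x))) = y"
proof (induction n arbitrary: x y)
  case (Suc n)
  then show ?case by (auto simp: Suc.IH)
qed auto

lemma is_diff_quot_imp_continuous:
  assumes s: "continuous_module s" and s': "continuous_module s'"
    and U: "U \<subseteq> iter_space n" and g: "is_diff_quot s s' n U f g"
  shows "continuous_map (subtopology (iter_top n) U) euclidean f"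
proof (cases "U = {}")
  case False
  interpret s: continuous_module s by fact
  interpret s': continuous_module s' by fact
  from False obtain a where a: "a \<in> U" by auto
  let ?h = "\<lambda>y. Ext a (iter_add y (iter_scale s (- 1) a)) 1"
  have aS: "a \<in> iter_space n" using a U by auto
  have "continuous_map (iter_top n) (iter_top (Suc n)) ?h"
    using aS by (intro continuous_map_Ext continuous_map_iter_translate s.iter_scale_in_space) auto
  then have "continuous_map (subtopology (iter_top n) U) (iter_top (Suc n)) ?h"
    by (rule continuous_map_from_subtopology)
  moreover have dom: "?h y \<in> ext_dom s n U" if "y \<in> U" for y
    using that U aS a s.iter_add_diff[of a n y]
    by (auto simp: ext_dom_def intro!: iter_add_in_space s.iter_scale_in_space)
  ultimately have "continuous_map (subtopology (iter_top n) U)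
      (subtopology (iter_top (Suc n)) (ext_dom s n U)) ?h"
    by (auto simp: continuous_map_in_subtopology simp del: iter_top.simps)
  moreover have "continuous_map (subtopology (iter_top (Suc n)) (ext_dom s n U)) euclidean g"
    using g by (simp add: is_diff_quot_def)
  ultimately have "continuous_map (subtopology (iter_top n) U) euclidean (g \<circ> ?h)"
    by (rule continuous_map_compose)
  moreover have "continuous_map euclidean euclidean (\<lambda>z. f a + z)"
    by (auto intro!: continuous_intros)
  ultimately have "continuous_map (subtopology (iter_top n) U) euclidean ((\<lambda>z. f a + z) \<circ> (g \<circ> ?h))"
    by (rule continuous_map_compose)
  then show ?thesis
  proof (rule continuous_map_eq)
    fix y assume "y \<in> topspace (subtopology (iter_top n) U)"
    then have y: "y \<in> U" "y \<in> iter_space n" by auto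
    have "f (iter_add a (iter_scale s 1 (iter_add y (iter_scale s (- 1) a)))) - f a = s' 1 (g (?h y))"
      using g dom[OF y(1)] unfolding is_diff_quot_def by blast
    then show "((\<lambda>z. f a + z) \<circ> (g \<circ> ?h)) y = f y"
      using s.iter_add_diff[OF aS y(2)] by (auto simp: algebra_simps)
  qed
qed simp

text \<open>The only difference between the two notions is that \<open>Ck\<close> asks for continuity at every order,
  which a \<open>C\<^sup>1\<close> map has by itself.\<close>

lemma Ck_iter_iff_Ck:
  assumes s: "continuous_module s" and s': "continuous_module s'" and U: "U \<subseteq> iter_space n"
  shows "Ck_iter s s' k n U f \<longleftrightarrow> Ck s euclidean (+) s' k n U f"
  using U
proof (induction k arbitrary: n U f)
  case (Suc k)
  have IH: "Ck_iter s s' k (Suc n) (ext_dom s n U) g \<longleftrightarrow>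
      Ck s euclidean (+) s' k (Suc n) (ext_dom s n U) g" for g
    by (rule Suc.IH[OF ext_dom_subset[OF Suc.prems]])
  have eq: "f (iter_add x (iter_scale s t v)) - f x = s' t (g (Ext x v t)) \<longleftrightarrow>
      f (iter_add x (iter_scale s t v)) = f x + s' t (g (Ext x v t))" for x v t g
    by (auto simp: algebra_simps)
  show ?case
  proof
    assume "Ck_iter s s' (Suc k) n U f"
    then obtain g where g: "is_diff_quot s s' n U f g" "Ck_iter s s' k (Suc n) (ext_dom s n U) g"
      by auto
    show "Ck s euclidean (+) s' (Suc k) n U f"
      by (rule Ck_SucI[OF is_diff_quot_imp_continuous[OF s s' Suc.prems g(1)] _ g(2)[unfolded IH]])
        (use g(1) in \<open>simp add: is_diff_quot_def eq\<close>)
  next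
    assume "Ck s euclidean (+) s' (Suc k) n U f"
    then obtain g where g: "\<And>x v t. Ext x v t \<in> ext_dom s n U \<Longrightarrow>
        f (iter_add x (iter_scale s t v)) = f x + s' t (g (Ext x v t))"
      "Ck s euclidean (+) s' k (Suc n) (ext_dom s n U) g"
      by (rule Ck_SucE) blast
    then have "is_diff_quot s s' n U f g"
      using Ck_continuous[OF g(2)] unfolding is_diff_quot_def eq by blast
    then show "Ck_iter s s' (Suc k) n U f"
      using g(2) IH by auto
  qed
qed simp

section \<open>Smooth maps between topological modules\<close>

lemma smooth_on_iff_Ck:
  assumes "continuous_module s" "continuous_module s'"
  shows "smooth_on s s' U f \<longleftrightarrow> open U \<and> (\<forall>k. Ck s euclidean (+) s' k 0 (Pt ` U) (f \<circ> unPt))"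
  unfolding smooth_on_def using Ck_iter_iff_Ck[OF assms, of "Pt ` U" 0] by auto

lemma smooth_on_open: "smooth_on s s' U f \<Longrightarrow> open U"
  by (simp add: smooth_on_def)

lemma smooth_on_imp_continuous_on:
  assumes "continuous_module s" "continuous_module s'" "smooth_on s s' U f"
  shows "continuous_on U f"
proof -
  have "Ck s euclidean (+) s' 0 0 (Pt ` U) (f \<circ> unPt)"
    using assms(3) smooth_on_iff_Ck[OF assms(1,2)] by blast
  note f = Ck_continuous[OF this]
  have "continuous_map (top_of_set U) (subtopology (iter_top 0) (Pt ` U)) Pt"
    using continuous_map_Pt[of "top_of_set U" "\<lambda>x. x"]
    by (simp add: continuous_map_in_subtopology image_subset_iff_funcset[symmetric] del: iter_top.simps)
  from continuous_map_compose[OF this f] show ?thesis by (simp add: o_def)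
qed

lemma smooth_on_subset:
  assumes "continuous_module s" "continuous_module s'" "smooth_on s s' U f" "open U'" "U' \<subseteq> U"
  shows "smooth_on s s' U' f"
  using assms Ck_subset[of s euclidean "(+)" s' _ 0 "Pt ` U" "f \<circ> unPt" "Pt ` U'"]
  by (auto simp: smooth_on_iff_Ck image_mono)

lemma smooth_on_cong:
  assumes "continuous_module s" "continuous_module s'" "smooth_on s s' U f"
    and "\<And>x. x \<in> U \<Longrightarrow> f x = f' x"
  shows "smooth_on s s' U f'"
  using assms(3) unfolding smooth_on_iff_Ck[OF assms(1,2)]
  by (auto intro!: Ck_cong[of s euclidean "(+)" s' _ 0 "Pt ` U" "f \<circ> unPt" "f' \<circ> unPt"]
      simp: assms(4))

lemma smooth_on_compose:
  assumes "continuous_module s" "continuous_module s'" "continuous_module s''"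
    and "smooth_on s s' U f" "smooth_on s' s'' U' g" "f ` U \<subseteq> U'"
  shows "smooth_on s s'' U (\<lambda>x. g (f x))"
proof -
  have f: "Ck s euclidean (+) s' k 0 (Pt ` U) (f \<circ> unPt)" for k
    using assms(4) smooth_on_iff_Ck[OF assms(1,2)] by blast
  have g: "Ck s' euclidean (+) s'' k 0 (Pt ` U') (g \<circ> unPt)" for k
    using assms(5) smooth_on_iff_Ck[OF assms(2,3)] by blast
  have "(\<lambda>z. Pt ((f \<circ> unPt) z)) ` Pt ` U \<subseteq> Pt ` U'"
    using assms(6) by auto
  from Ck_compose[OF g Ck_Pt[OF f] _ this] show ?thesis
    using smooth_on_open[OF assms(4)] by (simp add: smooth_on_iff_Ck[OF assms(1,3)] o_def image_mono)
qed

lemma smooth_on_Pair: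
  assumes "continuous_module s" "continuous_module s1" "continuous_module s2"
    and "smooth_on s s1 U f" "smooth_on s s2 U g"
  shows "smooth_on s (prod_scale s1 s2) U (\<lambda>x. (f x, g x))"
proof -
  have f: "Ck s euclidean (+) s1 k 0 (Pt ` U) (f \<circ> unPt)" for k
    using assms(4) smooth_on_iff_Ck[OF assms(1,2)] by blast
  have g: "Ck s euclidean (+) s2 k 0 (Pt ` U) (g \<circ> unPt)" for k
    using assms(5) smooth_on_iff_Ck[OF assms(1,3)] by blast
  from Ck_Pair[OF f g] show ?thesis
    using smooth_on_open[OF assms(4)]
    by (simp add: smooth_on_iff_Ck[OF assms(1) continuous_module_prod_scale[OF assms(2,3)]] o_def)
qed

lemma smooth_on_linear:
  assumes "continuous_module s" "continuous_module s'" "open U" "continuous_on UNIV f"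
    and "\<And>x v t. f (x + s t v) = f x + s' t (f v)"
  shows "smooth_on s s' U f"
proof -
  have "continuous_map (iter_top 0) euclidean (f \<circ> unPt)"
    using continuous_map_compose[OF continuous_map_unPt, of euclidean f] assms(4) by simp
  then have "Ck s euclidean (+) s' k 0 (Pt ` U) (f \<circ> unPt)" for k
    by (rule Ck_linear) (auto simp: assms(5))
  then show ?thesis
    using assms(3) by (simp add: smooth_on_iff_Ck[OF assms(1,2)])
qed

lemma smooth_on_const:
  assumes "continuous_module s" "continuous_module s'" "open U"
  shows "smooth_on s s' U (\<lambda>_. c)"
proof -
  interpret s': continuous_module s' by fact
  have "Ck s euclidean (+) s' k 0 (Pt ` U) (\<lambda>_. c)" for k
    by (rule Ck_const[where z = 0]) auto
  then show ?thesis
    using assms by (simp add: smooth_on_iff_Ck o_def)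
qed

text \<open>Limits along the units detect derivatives: for a unit \<open>t\<close> the difference quotient at \<open>t\<close> is
  determined by the map, and \<open>0\<close> is a limit of units.\<close>

definition units_near :: "'k::base_ring \<Rightarrow> 'k filter"
  where "units_near t = inf (nhds t) (principal {a. a dvd 1})"

lemma units_near_nontrivial: "units_near t \<noteq> bot"
  unfolding units_near_def trivial_limit_def eventually_inf_principal eventually_nhds
  using dense_units by fastforce

lemma units_near_le: "units_near t \<le> nhds t"
  by (simp add: units_near_def)

lemma eventually_units_near: "\<forall>\<^sub>F a in units_near t. a dvd 1"
  by (simp add: units_near_def eventually_inf_principal)

lemma continuous_on_tendsto_nhds:
  assumes "continuous_on U f" "open U" "x \<in> U"
  shows "(f \<longlongrightarrow> f x) (nhds x)"
proof -
  have "(f \<longlongrightarrow> f x) (at x)"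
    using assms by (metis at_within_open continuous_on_def)
  then show ?thesis by (simp add: tendsto_at_iff_tendsto_nhds)
qed

lemma eq_of_eq_on_units:
  fixes f g :: "'k::base_ring \<Rightarrow> 'w::t2_space"
  assumes "continuous_on T f" "continuous_on T g" "open T" "t \<in> T"
    and "\<And>a. a \<in> T \<Longrightarrow> a dvd 1 \<Longrightarrow> f a = g a"
  shows "f t = g t"
proof -
  have "\<forall>\<^sub>F a in units_near t. a \<in> T"
    by (rule filter_leD[OF units_near_le eventually_nhds_in_open[OF assms(3,4)]])
  then have eq: "\<forall>\<^sub>F a in units_near t. f a = g a"
    using eventually_units_near by eventually_elim (rule assms(5))
  have f: "(f \<longlongrightarrow> f t) (units_near t)" and g: "(g \<longlongrightarrow> g t) (units_near t)"
    by (rule tendsto_mono[OF units_near_le], rule continuous_on_tendsto_nhds, fact+)+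
  from tendsto_cong[THEN iffD1, OF eq f] have "(g \<longlongrightarrow> f t) (units_near t)" .
  from tendsto_unique[OF units_near_nontrivial this g] show ?thesis .
qed

text \<open>Points of the first iterated module are now replaced by triples \<open>(x, v, t)\<close> in \<open>V \<times> V \<times> K\<close>, so that
  difference quotients become maps on ordinary product types.\<close>

lemma ext_dom_Pt:
  "Ext (Pt x) (Pt v) t \<in> ext_dom s 0 (Pt ` U) \<longleftrightarrow> x \<in> U \<and> x + s t v \<in> U"
  by (auto simp: ext_dom_def)

lemma open_step_domain:
  assumes "continuous_module s" "open U"
  shows "open {(x, v, t). x \<in> U \<and> x + s t v \<in> U}"
proof -
  interpret s: continuous_module s by fact
  have "open ((U \<times> UNIV) \<inter> (\<lambda>(x, v, t). x + s t v) -` U)"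
    using assms(2)
    by (intro open_Int open_Times open_UNIV open_vimage)
      (auto simp: split_def intro!: continuous_intros s.continuous_on_scaleI)
  also have "(U \<times> UNIV) \<inter> (\<lambda>(x, v, t). x + s t v) -` U = {(x, v, t). x \<in> U \<and> x + s t v \<in> U}"
    by auto
  finally show ?thesis .
qed

lemma continuous_map_step:
  "continuous_map euclidean (iter_top (Suc 0)) (\<lambda>(x, v, t). Ext (Pt x) (Pt v) t)"
  unfolding split_def
  by (intro continuous_map_Ext continuous_map_Pt) (auto intro!: continuous_intros)

lemma continuous_on_step:
  assumes "continuous_map (subtopology (iter_top (Suc 0)) (ext_dom s 0 (Pt ` U))) euclidean g"
  shows "continuous_on {(x, v, t). x \<in> U \<and> x + s t v \<in> U} (\<lambda>(x, v, t). g (Ext (Pt x) (Pt v) t))"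
proof -
  let ?D = "{(x, v, t). x \<in> U \<and> x + s t v \<in> U}"
  have "continuous_map (top_of_set ?D) (subtopology (iter_top (Suc 0)) (ext_dom s 0 (Pt ` U)))
      (\<lambda>(x, v, t). Ext (Pt x) (Pt v) t)"
    using continuous_map_from_subtopology[OF continuous_map_step, of ?D]
    by (auto simp: continuous_map_in_subtopology ext_dom_Pt simp del: iter_top.simps)
  from continuous_map_compose[OF this assms] show ?thesis
    by (simp add: o_def split_def)
qed

text \<open>The difference quotient of a smooth map is smooth. In the definition the quotients of order
  \<open>k\<close> may depend on \<open>k\<close>; by density of the units they all agree.\<close>

lemma smooth_on_difference_quotient:
  fixes s :: "'k::base_ring \<Rightarrow> 'v::topological_ab_group_add \<Rightarrow> 'v"
    and s' :: "'k \<Rightarrow> 'w::{topological_ab_group_add,t2_space} \<Rightarrow> 'w"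
  assumes s: "continuous_module s" and s': "continuous_module s'" and f: "smooth_on s s' U f"
  obtains q where
    "smooth_on (prod_scale s (prod_scale s (*))) s' {(x, v, t). x \<in> U \<and> x + s t v \<in> U} q"
    "\<And>x v t. x \<in> U \<Longrightarrow> x + s t v \<in> U \<Longrightarrow> f (x + s t v) = f x + s' t (q (x, v, t))"
proof -
  interpret s: continuous_module s by fact
  interpret s': continuous_module s' by fact
  let ?D = "{(x, v, t). x \<in> U \<and> x + s t v \<in> U}"
  let ?E = "ext_dom s 0 (Pt ` U)"
  define step where "step = (\<lambda>(x :: 'v, v :: 'v, t :: 'k). Ext (Pt x) (Pt v) t)"
  have ex: "\<forall>k. \<exists>g. (\<forall>x v t. x \<in> U \<longrightarrow> x + s t v \<in> U \<longrightarrow> f (x + s t v) = f x + s' t (g (Ext (Pt x) (Pt v) t))) \<and>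
      Ck s euclidean (+) s' k (Suc 0) ?E g"
  proof
    fix k
    have "Ck s euclidean (+) s' (Suc k) 0 (Pt ` U) (f \<circ> unPt)"
      using f smooth_on_iff_Ck[OF s s'] by blast
    then obtain g where g: "\<And>x v t. Ext x v t \<in> ?E \<Longrightarrow>
        (f \<circ> unPt) (iter_add x (iter_scale s t v)) = (f \<circ> unPt) x + s' t (g (Ext x v t))"
      "Ck s euclidean (+) s' k (Suc 0) ?E g"
      by (rule Ck_SucE) blast
    have "f (x + s t v) = f x + s' t (g (Ext (Pt x) (Pt v) t))" if "x \<in> U" "x + s t v \<in> U" for x v t
      using g(1)[of "Pt x" "Pt v" t] that by (simp add: ext_dom_Pt)
    with g(2) show "\<exists>g. (\<forall>x v t. x \<in> U \<longrightarrow> x + s t v \<in> U \<longrightarrow>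
        f (x + s t v) = f x + s' t (g (Ext (Pt x) (Pt v) t))) \<and> Ck s euclidean (+) s' k (Suc 0) ?E g"
      by blast
  qed
  from choice[OF ex] obtain g where g: "\<And>k x v t. x \<in> U \<Longrightarrow> x + s t v \<in> U \<Longrightarrow>
      f (x + s t v) = f x + s' t (g k (Ext (Pt x) (Pt v) t))"
    "\<And>k. Ck s euclidean (+) s' k (Suc 0) ?E (g k)"
    by blast
  \<comment> \<open>For fixed \<open>x\<close> and \<open>v\<close> both quotients are continuous in \<open>t\<close> and coincide at the units.\<close>
  have agree: "g k (Ext (Pt x) (Pt v) t) = g 0 (Ext (Pt x) (Pt v) t)"
    if xv: "x \<in> U" "x + s t v \<in> U" for k x v t
  proof -
    let ?T = "{a. x + s a v \<in> U}"
    have "open ((\<lambda>a. x + s a v) -` U)"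
      using smooth_on_open[OF f]
      by (rule open_vimage) (auto intro!: continuous_intros s.continuous_on_scaleI)
    then have "open ?T" by (simp add: vimage_def)
    moreover have "continuous_on ?T (\<lambda>a. g j (Ext (Pt x) (Pt v) a))" for j
    proof -
      have "continuous_on ?T ((\<lambda>(x, v, t). g j (Ext (Pt x) (Pt v) t)) \<circ> (\<lambda>a. (x, v, a)))"
      proof (rule continuous_on_compose)
        show "continuous_on ?T (\<lambda>a. (x, v, a))" by (intro continuous_intros)
        show "continuous_on ((\<lambda>a. (x, v, a)) ` ?T) (\<lambda>(x, v, t). g j (Ext (Pt x) (Pt v) t))"
          by (rule continuous_on_subset[OF continuous_on_step[OF Ck_continuous[OF g(2)]]])
            (use xv in auto)
      qed
      then show ?thesis by (simp add: o_def)
    qed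
    moreover have "g k (Ext (Pt x) (Pt v) a) = g 0 (Ext (Pt x) (Pt v) a)"
      if "a \<in> ?T" "a dvd 1" for a
    proof (rule s'.unit_cancel[OF that(2)])
      have "f x + s' a (g k (Ext (Pt x) (Pt v) a)) = f x + s' a (g 0 (Ext (Pt x) (Pt v) a))"
        using g(1)[OF xv(1), of a v k] g(1)[OF xv(1), of a v 0] that(1) by simp
      then show "s' a (g k (Ext (Pt x) (Pt v) a)) = s' a (g 0 (Ext (Pt x) (Pt v) a))" by simp
    qed
    ultimately show ?thesis
      using eq_of_eq_on_units[of ?T "\<lambda>a. g k (Ext (Pt x) (Pt v) a)"
            "\<lambda>a. g 0 (Ext (Pt x) (Pt v) a)" t] xv(2) by blast
  qed
  have ck: "Ck s euclidean (+) s' k (Suc 0) ?E (g 0)" for k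
    using g(2)[of k]
  proof (rule Ck_cong)
    fix z assume "z \<in> ?E"
    then obtain x v t where z: "z = Ext (Pt x) (Pt v) t" and "x \<in> U" "x + s t v \<in> U"
      by (auto simp: ext_dom_def)
    then show "g k z = g 0 z" unfolding z by (intro agree)
  qed
  let ?s = "prod_scale s (prod_scale s (*))"
  have ms: "continuous_module ?s"
    by (intro continuous_module_prod_scale s continuous_module_mult)
  have "Ck ?s euclidean (+) s' k 0 (Pt ` ?D) (g 0 \<circ> (\<lambda>z. step (unPt z)))" for k
  proof (rule Ck_comp_linear[OF ck])
    show "continuous_map (iter_top 0) (iter_top (Suc 0)) (\<lambda>z. step (unPt z))"
      using continuous_map_compose[OF continuous_map_unPt continuous_map_step]
      unfolding step_def o_def .
    show "(\<lambda>z. step (unPt z)) ` Pt ` ?D \<subseteq> ?E"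
      by (auto simp: step_def ext_dom_Pt)
  qed (auto simp: step_def prod_scale_def split_def)
  then have "smooth_on ?s s' ?D (g 0 \<circ> step)"
    using open_step_domain[OF s smooth_on_open[OF f]]
    by (simp add: smooth_on_iff_Ck[OF ms s'] o_def)
  then show thesis
    by (rule that) (use g(1)[where k = 0] in \<open>auto simp: step_def\<close>)
qed

text \<open>Units can be cancelled, so every continuous difference quotient of \<open>f\<close> near \<open>x\<close> agrees with \<open>h\<close> at the
  units near \<open>0\<close>. Its value at \<open>t = 0\<close> is therefore the limit of \<open>h\<close>, whatever neighbourhood of \<open>x\<close> it
  is defined on. Derivatives below are computed by exhibiting a suitable \<open>h\<close>.\<close>

lemma differential_eqI:
  assumes s: "continuous_module s" and s': "continuous_module s'" and f: "smooth_on s s' U f"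
    and x: "x \<in> U" and lim: "(h \<longlongrightarrow> w) (units_near 0)"
    and eq: "\<forall>\<^sub>F t in units_near 0. f (x + s t v) = f x + s' t (h t)"
  shows "differential s s' f x v = w"
proof -
  interpret s: continuous_module s by fact
  interpret s': continuous_module s' by fact
  have *: "g (Ext (Pt x) (Pt v) 0) = w"
    if V: "open V" "x \<in> V" and g: "is_diff_quot s s' 0 (Pt ` V) (f \<circ> unPt) g" for V g
  proof -
    let ?T = "(\<lambda>t. x + s t v) -` V"
    have T: "open ?T"
      using V(1) by (rule open_vimage) (auto intro!: continuous_intros s.continuous_on_scaleI)
    have T0: "0 \<in> ?T" using V by simp
    have "continuous_on ?T ((\<lambda>(x, v, t). g (Ext (Pt x) (Pt v) t)) \<circ> (\<lambda>a. (x, v, a)))"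
    proof (rule continuous_on_compose)
      show "continuous_on ?T (\<lambda>a. (x, v, a))" by (intro continuous_intros)
      have "continuous_map (subtopology (iter_top (Suc 0)) (ext_dom s 0 (Pt ` V))) euclidean g"
        using g unfolding is_diff_quot_def by blast
      from continuous_on_step[OF this]
      show "continuous_on ((\<lambda>a. (x, v, a)) ` ?T) (\<lambda>(x, v, t). g (Ext (Pt x) (Pt v) t))"
        by (rule continuous_on_subset) (use V in auto)
    qed
    from continuous_on_tendsto_nhds[OF this T T0]
    have "((\<lambda>t. g (Ext (Pt x) (Pt v) t)) \<longlongrightarrow> g (Ext (Pt x) (Pt v) 0)) (units_near 0)"
      using tendsto_mono[OF units_near_le] by (simp add: o_def)
    moreover have "\<forall>\<^sub>F t in units_near 0. t \<in> ?T"
      by (rule filter_leD[OF units_near_le eventually_nhds_in_open[OF T T0]])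
    then have "\<forall>\<^sub>F t in units_near 0. h t = g (Ext (Pt x) (Pt v) t)"
      using eq eventually_units_near
    proof eventually_elim
      case (elim t)
      have "Ext (Pt x) (Pt v) t \<in> ext_dom s 0 (Pt ` V)"
        using elim(1) V by (simp add: ext_dom_Pt)
      then have "f (x + s t v) - f x = s' t (g (Ext (Pt x) (Pt v) t))"
        using g[unfolded is_diff_quot_def, THEN conjunct2, rule_format, of "Pt x" "Pt v" t] by simp
      moreover have "f (x + s t v) - f x = s' t (h t)"
        using elim(2) by simp
      ultimately have "s' t (h t) = s' t (g (Ext (Pt x) (Pt v) t))" by simp
      then show ?case by (rule s'.unit_cancel[OF elim(3)])
    qed
    from tendsto_cong[THEN iffD1, OF this lim] have "((\<lambda>t. g (Ext (Pt x) (Pt v) t)) \<longlongrightarrow> w) (units_near 0)" .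
    ultimately show ?thesis
      by (rule tendsto_unique[OF units_near_nontrivial])
  qed
  have "Ck_iter s s' (Suc 0) 0 (Pt ` U) (f \<circ> unPt)"
    using f smooth_on_def by blast
  then obtain g where g: "is_diff_quot s s' 0 (Pt ` U) (f \<circ> unPt) g" by auto
  then show ?thesis
    unfolding differential_def
  proof (intro the_equality)
    show "\<exists>U g. open U \<and> x \<in> U \<and> is_diff_quot s s' 0 (Pt ` U) (f \<circ> unPt) g \<and>
        w = g (Ext (Pt x) (Pt v) 0)"
      using *[OF smooth_on_open[OF f] x] x smooth_on_open[OF f] g by metis
  qed (use * in blast)
qed

text \<open>Composition with a linear inner map is treated separately because its target, a domain of
  difference quotients, involves the base ring and need not be Hausdorff.\<close>

lemma smooth_on_comp_linear:
  fixes s0 :: "'k::base_ring \<Rightarrow> 'u::topological_ab_group_add \<Rightarrow> 'u"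
    and s :: "'k \<Rightarrow> 'v::topological_ab_group_add \<Rightarrow> 'v"
  assumes "continuous_module s0" "continuous_module s" "continuous_module s'" "smooth_on s s' U f"
    and "open U'" "L ` U' \<subseteq> U" "continuous_on UNIV L"
    and "\<And>x v t. L (x + s0 t v) = L x + s t (L v)"
  shows "smooth_on s0 s' U' (\<lambda>x. f (L x))"
proof -
  have f: "Ck s euclidean (+) s' k 0 (Pt ` U) (f \<circ> unPt)" for k
    using assms(4) smooth_on_iff_Ck[OF assms(2,3)] by blast
  have "continuous_map euclidean euclidean L"
    using assms(7) by simp
  note L = continuous_map_Pt[OF continuous_map_compose[OF continuous_map_unPt this]]
  have "Ck s0 euclidean (+) s' k 0 (Pt ` U') ((f \<circ> unPt) \<circ> (\<lambda>z :: ('u, 'k) iter. Pt ((L \<circ> unPt) z) :: ('v, 'k) iter))" for k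
    by (rule Ck_comp_linear[OF f L]) (use assms(6) in \<open>auto simp: assms(8)\<close>)
  then show ?thesis
    using assms(5) by (simp add: smooth_on_iff_Ck[OF assms(1,3)] o_def)
qed

section \<open>Germs of smooth maps and their differentials\<close>

text \<open>The property \<open>C\<^sup>k\<close> need not be local, so one open set has to serve all orders. With this
  convention smoothness near a point passes to compositions and depends on the germ only.\<close>

definition smooth_at ::
    "('k::base_ring \<Rightarrow> 'v::topological_ab_group_add \<Rightarrow> 'v) \<Rightarrow>
     ('k \<Rightarrow> 'w::{topological_ab_group_add,t2_space} \<Rightarrow> 'w) \<Rightarrow> ('v \<Rightarrow> 'w) \<Rightarrow> 'v \<Rightarrow> bool"
  where "smooth_at s s' f x \<longleftrightarrow> (\<exists>U. x \<in> U \<and> smooth_on s s' U f)"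

lemma smooth_atI: "smooth_on s s' U f \<Longrightarrow> x \<in> U \<Longrightarrow> smooth_at s s' f x"
  by (auto simp: smooth_at_def)

lemma smooth_atE:
  assumes "smooth_at s s' f x"
  obtains U where "open U" "x \<in> U" "smooth_on s s' U f"
  using assms smooth_on_open unfolding smooth_at_def by blast

lemma tendsto_units_near: "((\<lambda>t. t) \<longlongrightarrow> a) (units_near a)"
  using tendsto_mono[OF units_near_le filterlim_ident] .

lemma (in continuous_module) tendsto_step:
  "((\<lambda>t. x + scale t v) \<longlongrightarrow> x) (units_near 0)"
proof -
  have "((\<lambda>t. x + scale t v) \<longlongrightarrow> x + scale 0 v) (units_near 0)"
    by (intro tendsto_add tendsto_const tendsto_scale tendsto_units_near)
  then show ?thesis by simp
qed

lemma (in continuous_module) eventually_step: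
  assumes "open U" "x \<in> U"
  shows "\<forall>\<^sub>F t in units_near 0. x + scale t v \<in> U"
  using topological_tendstoD[OF tendsto_step assms] .

lemma smooth_at_quotient:
  fixes s :: "'k::base_ring \<Rightarrow> 'v::topological_ab_group_add \<Rightarrow> 'v"
    and s' :: "'k \<Rightarrow> 'w::{topological_ab_group_add,t2_space} \<Rightarrow> 'w"
  assumes s: "continuous_module s" and s': "continuous_module s'" and f: "smooth_at s s' f x"
  obtains U q where "open U" "x \<in> U" "smooth_on s s' U f"
    "smooth_on (prod_scale s (prod_scale s (*))) s' {(x, v, t). x \<in> U \<and> x + s t v \<in> U} q"
    "\<And>x v t. x \<in> U \<Longrightarrow> x + s t v \<in> U \<Longrightarrow> f (x + s t v) = f x + s' t (q (x, v, t))"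
    "\<And>y v. y \<in> U \<Longrightarrow> (q \<longlongrightarrow> q (y, v, 0)) (nhds (y, v, 0))"
    "\<And>y v. y \<in> U \<Longrightarrow> differential s s' f y v = q (y, v, 0)"
proof -
  interpret s: continuous_module s by fact
  from f obtain U where U: "open U" "x \<in> U" "smooth_on s s' U f" by (rule smooth_atE)
  from smooth_on_difference_quotient[OF s s' U(3)] obtain q where
    q: "smooth_on (prod_scale s (prod_scale s (*))) s' {(x, v, t). x \<in> U \<and> x + s t v \<in> U} q"
    and eq: "\<And>x v t. x \<in> U \<Longrightarrow> x + s t v \<in> U \<Longrightarrow> f (x + s t v) = f x + s' t (q (x, v, t))"
    by blast
  have "continuous_on {(x, v, t). x \<in> U \<and> x + s t v \<in> U} q"
    by (rule smooth_on_imp_continuous_on[OF _ s' q])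
      (intro continuous_module_prod_scale s continuous_module_mult)
  from continuous_on_tendsto_nhds[OF this open_step_domain[OF s U(1)]]
  have lim: "(q \<longlongrightarrow> q (y, v, 0)) (nhds (y, v, 0))" if "y \<in> U" for y v
    using that by simp
  have "differential s s' f y v = q (y, v, 0)" if "y \<in> U" for y v
  proof (rule differential_eqI[OF s s' U(3) that])
    have "((\<lambda>t. (y, v, t)) \<longlongrightarrow> (y, v, 0)) (units_near 0)"
      by (intro tendsto_Pair tendsto_const tendsto_units_near)
    from filterlim_compose[OF lim[OF that] this]
    show "((\<lambda>t. q (y, v, t)) \<longlongrightarrow> q (y, v, 0)) (units_near 0)" .
    show "\<forall>\<^sub>F t in units_near 0. f (y + s t v) = f y + s' t (q (y, v, t))"
      using s.eventually_step[OF U(1) that] by eventually_elim (rule eq[OF that])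
  qed
  with U q eq lim show thesis by (rule that)
qed

lemma smooth_at_quotientE:
  fixes s :: "'k::base_ring \<Rightarrow> 'v::topological_ab_group_add \<Rightarrow> 'v"
    and s' :: "'k \<Rightarrow> 'w::{topological_ab_group_add,t2_space} \<Rightarrow> 'w"
  assumes s: "continuous_module s" and s': "continuous_module s'" and f: "smooth_at s s' f x"
  obtains U q where "open U" "x \<in> U"
    "\<And>x v t. x \<in> U \<Longrightarrow> x + s t v \<in> U \<Longrightarrow> f (x + s t v) = f x + s' t (q (x, v, t))"
    "\<And>y v. y \<in> U \<Longrightarrow> (q \<longlongrightarrow> q (y, v, 0)) (nhds (y, v, 0))"
    "\<And>y v. y \<in> U \<Longrightarrow> differential s s' f y v = q (y, v, 0)"
  by (rule smooth_at_quotient[OF s s' f]) (rule that)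

lemma smooth_at_differential_eqI:
  assumes "continuous_module s" "continuous_module s'" "smooth_at s s' f x"
    and "(h \<longlongrightarrow> w) (units_near 0)"
    and "\<forall>\<^sub>F t in units_near 0. f (x + s t v) = f x + s' t (h t)"
  shows "differential s s' f x v = w"
  using assms(3) by (rule smooth_atE) (rule differential_eqI[OF assms(1,2) _ _ assms(4,5)])

lemma smooth_at_tendsto:
  assumes "continuous_module s" "continuous_module s'" "smooth_at s s' f x"
  shows "(f \<longlongrightarrow> f x) (nhds x)"
  using assms(3)
  by (rule smooth_atE) (rule continuous_on_tendsto_nhds[OF smooth_on_imp_continuous_on[OF assms(1,2)]])

lemma continuous_on_UNIV_if_smooth_at:
  assumes "continuous_module s" "continuous_module s'" "\<And>x. smooth_at s s' f x"
  shows "continuous_on UNIV f"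
proof -
  have "(f \<longlongrightarrow> f x) (at x)" for x
    using smooth_at_tendsto[OF assms] by (simp add: tendsto_at_iff_tendsto_nhds)
  then show ?thesis by (simp add: continuous_on_def)
qed

lemma smooth_at_transform:
  assumes "continuous_module s" "continuous_module s'" "smooth_at s s' f x"
    and "open V" "x \<in> V" "\<And>y. y \<in> V \<Longrightarrow> f y = g y"
  shows "smooth_at s s' g x"
proof -
  from assms(3) obtain U where U: "open U" "x \<in> U" "smooth_on s s' U f" by (rule smooth_atE)
  have "smooth_on s s' (U \<inter> V) f"
    by (rule smooth_on_subset[OF assms(1,2) U(3)]) (use U assms in auto)
  then have "smooth_on s s' (U \<inter> V) g"
    by (rule smooth_on_cong[OF assms(1,2)]) (use assms in auto)
  then show ?thesis by (rule smooth_atI) (use U assms in auto)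
qed

text \<open>In spite of the choice of a neighbourhood in its definition, the differential depends on the
  germ only.\<close>

lemma differential_transform:
  assumes s: "continuous_module s" and s': "continuous_module s'" and f: "smooth_at s s' f x"
    and V: "open V" "x \<in> V" "\<And>y. y \<in> V \<Longrightarrow> f y = g y"
  shows "differential s s' g x v = differential s s' f x v"
proof -
  interpret s: continuous_module s by fact
  obtain U q where U: "open U" "x \<in> U"
    and q: "\<And>x v t. x \<in> U \<Longrightarrow> x + s t v \<in> U \<Longrightarrow> f (x + s t v) = f x + s' t (q (x, v, t))"
      "\<And>y v. y \<in> U \<Longrightarrow> (q \<longlongrightarrow> q (y, v, 0)) (nhds (y, v, 0))"
      "\<And>y v. y \<in> U \<Longrightarrow> differential s s' f y v = q (y, v, 0)"
    by (rule smooth_at_quotientE[OF s s' f]) (rule that)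
  show ?thesis
  proof (rule smooth_at_differential_eqI[OF s s' smooth_at_transform[OF s s' f V]])
    have "((\<lambda>t. (x, v, t)) \<longlongrightarrow> (x, v, 0)) (units_near 0)"
      by (intro tendsto_Pair tendsto_const tendsto_units_near)
    from filterlim_compose[OF q(2)[OF U(2)] this]
    show "((\<lambda>t. q (x, v, t)) \<longlongrightarrow> differential s s' f x v) (units_near 0)"
      by (simp add: q(3)[OF U(2)])
    show "\<forall>\<^sub>F t in units_near 0. g (x + s t v) = g x + s' t (q (x, v, t))"
      using s.eventually_step[OF U, of v] s.eventually_step[OF V(1,2), of v]
      by eventually_elim (simp add: V(2) q(1)[OF U(2)] flip: V(3))
  qed
qed

lemma smooth_at_compose:
  assumes "continuous_module s" "continuous_module s'" "continuous_module s''"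
    and "smooth_at s s' f x" "smooth_at s' s'' g (f x)"
  shows "smooth_at s s'' (\<lambda>x. g (f x)) x"
proof -
  from assms(4) obtain U where U: "open U" "x \<in> U" "smooth_on s s' U f" by (rule smooth_atE)
  from assms(5) obtain V where V: "open V" "f x \<in> V" "smooth_on s' s'' V g" by (rule smooth_atE)
  have "open (f -` V \<inter> U)"
    using smooth_on_imp_continuous_on[OF assms(1,2) U(3)] U(1) V(1)
    by (simp add: continuous_on_open_vimage)
  then have "smooth_on s s' (f -` V \<inter> U) f"
    by (intro smooth_on_subset[OF assms(1,2) U(3)]) auto
  then have "smooth_on s s'' (f -` V \<inter> U) (\<lambda>x. g (f x))"
    by (rule smooth_on_compose[OF assms(1-3) _ V(3)]) auto
  then show ?thesis by (rule smooth_atI) (use U V in auto)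
qed

lemma differential_compose:
  assumes s: "continuous_module s" and s': "continuous_module s'" and s'': "continuous_module s''"
    and f: "smooth_at s s' f x" and g: "smooth_at s' s'' g (f x)"
  shows "differential s s'' (\<lambda>x. g (f x)) x v = differential s' s'' g (f x) (differential s s' f x v)"
proof -
  interpret s: continuous_module s by fact
  obtain U p where U: "open U" "x \<in> U"
    and p: "\<And>x v t. x \<in> U \<Longrightarrow> x + s t v \<in> U \<Longrightarrow> f (x + s t v) = f x + s' t (p (x, v, t))"
      "\<And>y v. y \<in> U \<Longrightarrow> (p \<longlongrightarrow> p (y, v, 0)) (nhds (y, v, 0))"
      "\<And>y v. y \<in> U \<Longrightarrow> differential s s' f y v = p (y, v, 0)"
    by (rule smooth_at_quotientE[OF s s' f]) (rule that)
  obtain V q where V: "open V" "f x \<in> V"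
    and q: "\<And>x v t. x \<in> V \<Longrightarrow> x + s' t v \<in> V \<Longrightarrow> g (x + s' t v) = g x + s'' t (q (x, v, t))"
      "\<And>y v. y \<in> V \<Longrightarrow> (q \<longlongrightarrow> q (y, v, 0)) (nhds (y, v, 0))"
      "\<And>y v. y \<in> V \<Longrightarrow> differential s' s'' g y v = q (y, v, 0)"
    by (rule smooth_at_quotientE[OF s' s'' g]) (rule that)
  show ?thesis
  proof (rule smooth_at_differential_eqI[OF s s'' smooth_at_compose[OF s s' s'' f g]])
    have "((\<lambda>t. (x, v, t)) \<longlongrightarrow> (x, v, 0)) (units_near 0)"
      by (intro tendsto_Pair tendsto_const tendsto_units_near)
    from filterlim_compose[OF p(2)[OF U(2)] this]
    have "((\<lambda>t. (f x, p (x, v, t), t)) \<longlongrightarrow> (f x, p (x, v, 0), 0)) (units_near 0)"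
      by (intro tendsto_Pair tendsto_const tendsto_units_near)
    from filterlim_compose[OF q(2)[OF V(2)] this]
    show "((\<lambda>t. q (f x, p (x, v, t), t)) \<longlongrightarrow>
        differential s' s'' g (f x) (differential s s' f x v)) (units_near 0)"
      by (simp add: p(3)[OF U(2)] q(3)[OF V(2)])
    have "\<forall>\<^sub>F t in units_near 0. f (x + s t v) \<in> V"
      using topological_tendstoD[OF filterlim_compose[OF smooth_at_tendsto[OF s s' f] s.tendsto_step] V] .
    with s.eventually_step[OF U, of v]
    show "\<forall>\<^sub>F t in units_near 0. g (f (x + s t v)) = g (f x) + s'' t (q (f x, p (x, v, t), t))"
    proof eventually_elim
      case (elim t)
      with p(1)[OF U(2) elim(1)] show ?case
        by (simp add: q(1)[OF V(2)])
    qed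
  qed
qed

lemma smooth_at_linear:
  assumes "continuous_module s" "continuous_module s'" "continuous_on UNIV f"
    and "\<And>x v t. f (x + s t v) = f x + s' t (f v)"
  shows "smooth_at s s' f x"
  by (rule smooth_atI[OF smooth_on_linear[OF assms(1,2) open_UNIV assms(3,4)]]) simp

lemma differential_linear:
  assumes "continuous_module s" "continuous_module s'" "continuous_on UNIV f"
    and "\<And>x v t. f (x + s t v) = f x + s' t (f v)"
  shows "differential s s' f x v = f v"
  by (rule smooth_at_differential_eqI[OF assms(1,2) smooth_at_linear[OF assms]
        tendsto_const[of "f v"]]) (simp add: assms(4))

lemma smooth_at_const:
  "continuous_module s \<Longrightarrow> continuous_module s' \<Longrightarrow> smooth_at s s' (\<lambda>_. c) x"
  by (rule smooth_atI[OF smooth_on_const[OF _ _ open_UNIV]]) auto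

lemma differential_const:
  assumes "continuous_module s" "continuous_module s'"
  shows "differential s s' (\<lambda>_. c) x v = 0"
proof -
  interpret s': continuous_module s' by fact
  show ?thesis
    by (rule smooth_at_differential_eqI[OF assms smooth_at_const[OF assms] tendsto_const]) simp
qed

lemma smooth_at_ident: "continuous_module s \<Longrightarrow> smooth_at s s (\<lambda>x. x) x"
  and differential_ident: "continuous_module s \<Longrightarrow> differential s s (\<lambda>x. x) x v = v"
  by (auto intro!: smooth_at_linear differential_linear)

lemma smooth_at_fst:
  "continuous_module s \<Longrightarrow> continuous_module s' \<Longrightarrow> smooth_at (prod_scale s s') s fst x"
  and differential_fst:
  "continuous_module s \<Longrightarrow> continuous_module s' \<Longrightarrow> differential (prod_scale s s') s fst x v = fst v"
  and smooth_at_snd: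
  "continuous_module s \<Longrightarrow> continuous_module s' \<Longrightarrow> smooth_at (prod_scale s s') s' snd x"
  and differential_snd:
  "continuous_module s \<Longrightarrow> continuous_module s' \<Longrightarrow> differential (prod_scale s s') s' snd x v = snd v"
proof -
  assume s: "continuous_module s" and s': "continuous_module s'"
  have lin: "fst (x + prod_scale s s' t v) = fst x + s t (fst v)"
    "snd (x + prod_scale s s' t v) = snd x + s' t (snd v)" for x v t
    by (simp_all add: prod_scale_def)
  note * = continuous_module_prod_scale[OF s s']
  note f = continuous_on_fst[OF continuous_on_id, of UNIV] and g = continuous_on_snd[OF continuous_on_id, of UNIV]
  show "smooth_at (prod_scale s s') s fst x" "differential (prod_scale s s') s fst x v = fst v"
    by (rule smooth_at_linear[OF * s f lin(1)], rule differential_linear[OF * s f lin(1)])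
  show "smooth_at (prod_scale s s') s' snd x" "differential (prod_scale s s') s' snd x v = snd v"
    by (rule smooth_at_linear[OF * s' g lin(2)], rule differential_linear[OF * s' g lin(2)])
qed

lemma smooth_at_Pair:
  assumes "continuous_module s" "continuous_module s1" "continuous_module s2"
    and "smooth_at s s1 f x" "smooth_at s s2 g x"
  shows "smooth_at s (prod_scale s1 s2) (\<lambda>x. (f x, g x)) x"
proof -
  from assms(4) obtain U where U: "open U" "x \<in> U" "smooth_on s s1 U f" by (rule smooth_atE)
  from assms(5) obtain V where V: "open V" "x \<in> V" "smooth_on s s2 V g" by (rule smooth_atE)
  have "smooth_on s (prod_scale s1 s2) (U \<inter> V) (\<lambda>x. (f x, g x))"
    by (intro smooth_on_Pair assms smooth_on_subset[OF assms(1,2) U(3)]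
        smooth_on_subset[OF assms(1,3) V(3)]) (use U V in auto)
  then show ?thesis by (rule smooth_atI) (use U V in auto)
qed

lemma differential_Pair:
  assumes s: "continuous_module s" and s1: "continuous_module s1" and s2: "continuous_module s2"
    and "smooth_at s s1 f x" "smooth_at s s2 g x"
  shows "differential s (prod_scale s1 s2) (\<lambda>x. (f x, g x)) x v =
    (differential s s1 f x v, differential s s2 g x v)"
proof -
  note sp = continuous_module_prod_scale[OF s1 s2]
  note sm = smooth_at_Pair[OF assms]
  have "differential s s1 (\<lambda>x. fst (f x, g x)) x v =
      fst (differential s (prod_scale s1 s2) (\<lambda>x. (f x, g x)) x v)"
    by (subst differential_compose[OF s sp s1 sm smooth_at_fst[OF s1 s2]])
      (simp add: differential_fst[OF s1 s2])
  moreover have "differential s s2 (\<lambda>x. snd (f x, g x)) x v =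
      snd (differential s (prod_scale s1 s2) (\<lambda>x. (f x, g x)) x v)"
    by (subst differential_compose[OF s sp s2 sm smooth_at_snd[OF s1 s2]])
      (simp add: differential_snd[OF s1 s2])
  ultimately show ?thesis by (simp add: prod_eq_iff)
qed

lemma differential_add_right:
  assumes s: "continuous_module s" and s': "continuous_module s'" and f: "smooth_at s s' f x"
  shows "differential s s' f x (v + w) = differential s s' f x v + differential s s' f x w"
proof -
  interpret s: continuous_module s by fact
  interpret s': continuous_module s' by fact
  obtain U q where U: "open U" "x \<in> U"
    and q: "\<And>x v t. x \<in> U \<Longrightarrow> x + s t v \<in> U \<Longrightarrow> f (x + s t v) = f x + s' t (q (x, v, t))"
      "\<And>y v. y \<in> U \<Longrightarrow> (q \<longlongrightarrow> q (y, v, 0)) (nhds (y, v, 0))"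
      "\<And>y v. y \<in> U \<Longrightarrow> differential s s' f y v = q (y, v, 0)"
    by (rule smooth_at_quotientE[OF s s' f]) (rule that)
  show ?thesis
  proof (rule smooth_at_differential_eqI[OF s s' f])
    have "((\<lambda>t. (x, v, t)) \<longlongrightarrow> (x, v, 0)) (units_near 0)"
      "((\<lambda>t. (x + s t v, w, t)) \<longlongrightarrow> (x, w, 0)) (units_near 0)"
      by (intro tendsto_Pair tendsto_const tendsto_units_near s.tendsto_step)+
    from tendsto_add[OF this[THEN filterlim_compose[OF q(2)[OF U(2)]]]]
    show "((\<lambda>t. q (x, v, t) + q (x + s t v, w, t)) \<longlongrightarrow>
        differential s s' f x v + differential s s' f x w) (units_near 0)"
      by (simp add: q(3)[OF U(2)])
    show "\<forall>\<^sub>F t in units_near 0. f (x + s t (v + w)) =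
        f x + s' t (q (x, v, t) + q (x + s t v, w, t))"
      using s.eventually_step[OF U, of v] s.eventually_step[OF U, of "v + w"]
    proof eventually_elim
      case (elim t)
      then show ?case
        using q(1)[OF U(2) elim(1)] q(1)[OF elim(1), of t w]
        by (simp add: s.scale_right_distrib s'.scale_right_distrib add.assoc)
    qed
  qed
qed

lemma differential_scale_right:
  assumes s: "continuous_module s" and s': "continuous_module s'" and f: "smooth_at s s' f x"
  shows "differential s s' f x (s r v) = s' r (differential s s' f x v)"
proof -
  interpret s: continuous_module s by fact
  interpret s': continuous_module s' by fact
  obtain U q where U: "open U" "x \<in> U"
    and q: "\<And>x v t. x \<in> U \<Longrightarrow> x + s t v \<in> U \<Longrightarrow> f (x + s t v) = f x + s' t (q (x, v, t))"
      "\<And>y v. y \<in> U \<Longrightarrow> (q \<longlongrightarrow> q (y, v, 0)) (nhds (y, v, 0))"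
      "\<And>y v. y \<in> U \<Longrightarrow> differential s s' f y v = q (y, v, 0)"
    by (rule smooth_at_quotientE[OF s s' f]) (rule that)
  show ?thesis
  proof (rule smooth_at_differential_eqI[OF s s' f])
    have "((\<lambda>t. t * r) \<longlongrightarrow> 0 * r) (units_near 0)"
      by (intro tendsto_mult tendsto_const tendsto_units_near)
    then have "((\<lambda>t. (x, v, t * r)) \<longlongrightarrow> (x, v, 0)) (units_near 0)"
      by (intro tendsto_Pair tendsto_const) simp
    from filterlim_compose[OF q(2)[OF U(2)] this]
    show "((\<lambda>t. s' r (q (x, v, t * r))) \<longlongrightarrow> s' r (differential s s' f x v)) (units_near 0)"
      by (intro s'.tendsto_scale tendsto_const) (simp add: q(3)[OF U(2)])
    show "\<forall>\<^sub>F t in units_near 0. f (x + s t (s r v)) = f x + s' t (s' r (q (x, v, t * r)))"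
      using s.eventually_step[OF U, of "s r v"]
      by eventually_elim (use q(1)[OF U(2)] in simp)
  qed
qed

lemma differential_minus_right:
  assumes "continuous_module s" "continuous_module s'" "smooth_at s s' f x"
  shows "differential s s' f x (- v) = - differential s s' f x v"
proof -
  interpret s: continuous_module s by fact
  interpret s': continuous_module s' by fact
  show ?thesis using differential_scale_right[OF assms, of "- 1" v] by simp
qed

lemma differential_diff_right:
  assumes "continuous_module s" "continuous_module s'" "smooth_at s s' f x"
  shows "differential s s' f x (v - w) = differential s s' f x v - differential s s' f x w"
  using differential_add_right[OF assms, of v "- w"] differential_minus_right[OF assms, of w] by simp

lemma differential_partial_left:
  fixes s1 :: "'k::base_ring \<Rightarrow> 'u::{topological_ab_group_add,t2_space} \<Rightarrow> 'u"
    and s2 :: "'k \<Rightarrow> 'v::{topological_ab_group_add,t2_space} \<Rightarrow> 'v"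
  assumes s1: "continuous_module s1" and s2: "continuous_module s2" and s': "continuous_module s'"
    and f: "smooth_at (prod_scale s1 s2) s' f (a, b)"
  shows "differential s1 s' (\<lambda>u. f (u, b)) a v = differential (prod_scale s1 s2) s' f (a, b) (v, 0)"
proof -
  note sp = continuous_module_prod_scale[OF s1 s2]
  have "differential s1 (prod_scale s1 s2) (\<lambda>u. (u, b)) a v = (v, 0)"
    "smooth_at s1 (prod_scale s1 s2) (\<lambda>u. (u, b)) a"
    using differential_Pair[OF s1 s1 s2 smooth_at_ident[OF s1] smooth_at_const[OF s1 s2]]
      smooth_at_Pair[OF s1 s1 s2 smooth_at_ident[OF s1] smooth_at_const[OF s1 s2]]
    by (simp_all add: differential_ident[OF s1] differential_const[OF s1 s2])
  then show ?thesis
    using differential_compose[OF s1 sp s', of "\<lambda>u. (u, b)" a f v] f by simp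
qed

lemma smooth_at_add:
  assumes s: "continuous_module s" and s': "continuous_module s'"
    and "smooth_at s s' f x" "smooth_at s s' g x"
  shows "smooth_at s s' (\<lambda>x. f x + g x) x"
proof -
  interpret s': continuous_module s' by fact
  have "smooth_at (prod_scale s' s') s' (\<lambda>p. fst p + snd p) (f x, g x)"
    by (intro smooth_at_linear continuous_module_prod_scale s')
      (auto intro!: continuous_intros simp: prod_scale_def s'.scale_right_distrib)
  from smooth_at_compose[OF s continuous_module_prod_scale[OF s' s'] s'
      smooth_at_Pair[OF s s' s' assms(3,4)] this]
  show ?thesis by simp
qed

lemma smooth_at_scale:
  assumes s: "continuous_module s" and s': "continuous_module s'" and f: "smooth_at s s' f x"
  shows "smooth_at s s' (\<lambda>x. s' r (f x)) x"
proof -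
  interpret s': continuous_module s' by fact
  have "smooth_at s' s' (s' r) (f x)"
    by (intro smooth_at_linear s')
      (auto intro!: s'.continuous_on_scaleI continuous_intros
        simp: s'.scale_right_distrib mult.commute)
  from smooth_at_compose[OF s s' s' f this] show ?thesis .
qed

lemma smooth_at_diff:
  assumes s: "continuous_module s" and s': "continuous_module s'"
    and "smooth_at s s' f x" "smooth_at s s' g x"
  shows "smooth_at s s' (\<lambda>x. f x - g x) x"
proof -
  interpret s': continuous_module s' by fact
  show ?thesis
    using smooth_at_add[OF s s' assms(3) smooth_at_scale[OF s s' assms(4), of "- 1"]] by simp
qed

text \<open>The differential is the restriction of the smooth difference quotient to the parameter \<open>t = 0\<close>.\<close>

lemma smooth_at_differential:
  assumes s: "continuous_module s" and s': "continuous_module s'" and f: "smooth_at s s' f x"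
  shows "smooth_at (prod_scale s s) s' (\<lambda>p. differential s s' f (fst p) (snd p)) (x, v)"
proof -
  interpret s: continuous_module s by fact
  note ss = continuous_module_prod_scale[OF s s]
  obtain U q where U: "open U" "x \<in> U" and "smooth_on s s' U f"
    and q: "smooth_on (prod_scale s (prod_scale s (*))) s' {(x, v, t). x \<in> U \<and> x + s t v \<in> U} q"
    and "\<And>x v t. x \<in> U \<Longrightarrow> x + s t v \<in> U \<Longrightarrow> f (x + s t v) = f x + s' t (q (x, v, t))"
    and "\<And>y v. y \<in> U \<Longrightarrow> (q \<longlongrightarrow> q (y, v, 0)) (nhds (y, v, 0))"
    and dq: "\<And>y v. y \<in> U \<Longrightarrow> differential s s' f y v = q (y, v, 0)"
    by (rule smooth_at_quotient[OF s s' f]) (rule that)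
  have "smooth_on (prod_scale s s) s' (U \<times> UNIV) (\<lambda>p. q ((\<lambda>p. (fst p, snd p, 0)) p))"
    by (rule smooth_on_comp_linear[OF ss _ s' q])
      (use U(1) in \<open>auto intro!: continuous_module_prod_scale s continuous_module_mult open_Times
        continuous_intros simp: prod_scale_def\<close>)
  then have "smooth_on (prod_scale s s) s' (U \<times> UNIV) (\<lambda>p. differential s s' f (fst p) (snd p))"
    by (rule smooth_on_cong[OF ss s']) (auto simp: dq)
  then show ?thesis by (rule smooth_atI) (use U in auto)
qed

lemma continuous_on_differential:
  fixes s :: "'k::base_ring \<Rightarrow> 'v::{topological_ab_group_add,t2_space} \<Rightarrow> 'v"
  assumes s: "continuous_module s" and s': "continuous_module s'" and f: "smooth_at s s' f x"
  shows "continuous_on UNIV (differential s s' f x)"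
proof (rule continuous_on_UNIV_if_smooth_at[OF s s'])
  fix v
  note ss = continuous_module_prod_scale[OF s s]
  from smooth_at_compose[OF s ss s' smooth_at_Pair[OF s s s smooth_at_const[OF s s] smooth_at_ident[OF s]]
      smooth_at_differential[OF s s' f]]
  show "smooth_at s s' (differential s s' f x) v" by simp
qed

text \<open>For units \<open>t\<close> and \<open>r\<close> the second difference \<open>f (x + tu + rw) - f (x + tu) - f (x + rw) + f x\<close>,
  divided by \<open>tr\<close>, is symmetric in \<open>(t, u)\<close> and \<open>(r, w)\<close>. It extends continuously to \<open>t = r = 0\<close> in two
  ways, which express the two orders of differentiation.\<close>

lemma second_differential_symmetric:
  fixes s :: "'k::base_ring \<Rightarrow> 'v::topological_ab_group_add \<Rightarrow> 'v"
    and s' :: "'k \<Rightarrow> 'w::{topological_ab_group_add,t2_space} \<Rightarrow> 'w"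
  assumes s: "continuous_module s" and s': "continuous_module s'" and f: "smooth_at s s' f x"
  defines "D \<equiv> \<lambda>p. differential s s' f (fst p) (snd p)"
  shows "differential (prod_scale s s) s' D (x, u) (w, 0) = differential (prod_scale s s) s' D (x, w) (u, 0)"
proof -
  interpret s: continuous_module s by fact
  interpret s': continuous_module s' by fact
  let ?s = "prod_scale s (prod_scale s ((*) :: 'k \<Rightarrow> _))"
  have ms: "continuous_module ?s"
    by (intro continuous_module_prod_scale s continuous_module_mult)
  obtain U q where U: "open U" "x \<in> U" and "smooth_on s s' U f"
    and q: "smooth_on ?s s' {(x, v, t). x \<in> U \<and> x + s t v \<in> U} q"
      "\<And>x v t. x \<in> U \<Longrightarrow> x + s t v \<in> U \<Longrightarrow> f (x + s t v) = f x + s' t (q (x, v, t))"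
    and "\<And>y v. y \<in> U \<Longrightarrow> (q \<longlongrightarrow> q (y, v, 0)) (nhds (y, v, 0))"
    and dq: "\<And>y v. y \<in> U \<Longrightarrow> differential s s' f y v = q (y, v, 0)"
    by (rule smooth_at_quotient[OF s s' f]) (rule that)
  let ?W = "{(x, v, t). x \<in> U \<and> x + s t v \<in> U}"
  from smooth_on_difference_quotient[OF ms s' q(1)] obtain Q where
    Q: "smooth_on (prod_scale ?s (prod_scale ?s (*))) s' {(z, \<zeta>, t). z \<in> ?W \<and> z + ?s t \<zeta> \<in> ?W} Q"
    and Qeq: "\<And>z \<zeta> t. z \<in> ?W \<Longrightarrow> z + ?s t \<zeta> \<in> ?W \<Longrightarrow> q (z + ?s t \<zeta>) = q z + s' t (Q (z, \<zeta>, t))"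
    by blast
  have "continuous_on {(z, \<zeta>, t). z \<in> ?W \<and> z + ?s t \<zeta> \<in> ?W} Q"
    by (rule smooth_on_imp_continuous_on[OF _ s' Q])
      (intro continuous_module_prod_scale ms continuous_module_mult)
  from continuous_on_tendsto_nhds[OF this open_step_domain[OF ms smooth_on_open[OF q(1)]]]
  have Qlim: "(Q \<longlongrightarrow> Q ((x, a, 0), (c, 0, 0), 0)) (nhds ((x, a, 0), (c, 0, 0), 0))" for a c
    using U(2) by (simp add: prod_scale_def)
  \<comment> \<open>\<open>Q\<close> is the difference quotient of the difference quotient \<open>q\<close> of \<open>f\<close>.\<close>
  have Dx: "differential (prod_scale s s) s' D (x, a) (c, 0) = Q ((x, a, 0), (c, 0, 0), 0)" for a c
  proof (rule smooth_at_differential_eqI[OF continuous_module_prod_scale[OF s s] s'])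
    show "smooth_at (prod_scale s s) s' D (x, a)"
      unfolding D_def by (rule smooth_at_differential[OF s s' f])
    have "((\<lambda>r. ((x, a, 0), (c, 0, 0), r)) \<longlongrightarrow> ((x, a, 0), (c, 0, 0), 0 :: 'k)) (units_near 0)"
      by (intro tendsto_Pair tendsto_const tendsto_units_near)
    from filterlim_compose[OF Qlim this]
    show "((\<lambda>r. Q ((x, a, 0), (c, 0, 0), r)) \<longlongrightarrow> Q ((x, a, 0), (c, 0, 0), 0)) (units_near 0)" .
    show "\<forall>\<^sub>F r in units_near 0. D ((x, a) + prod_scale s s r (c, 0)) =
        D (x, a) + s' r (Q ((x, a, 0), (c, 0, 0), r))"
      using s.eventually_step[OF U, of c]
    proof eventually_elim
      case (elim r)
      then show ?case
        using Qeq[of "(x, a, 0)" r "(c, 0, 0)"] U(2)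
        by (simp add: D_def prod_scale_def dq)
    qed
  qed
  have second: "f (x + s t a + s r c) - f (x + s r c) - (f (x + s t a) - f x) =
      s' t (s' r (Q ((x, a, t), (c, 0, 0), r)))"
    if "x + s t a \<in> U" "x + s r c \<in> U" "x + s t a + s r c \<in> U" for t r a c
  proof -
    have eq: "x + s t a + s r c = (x + s r c) + s t a" by (simp add: add_ac)
    have "f (x + s t a + s r c) = f (x + s r c) + s' t (q (x + s r c, a, t))"
      using q(2)[OF that(2), of t a] that(3) unfolding eq .
    moreover have "f (x + s t a) = f x + s' t (q (x, a, t))"
      using q(2)[OF U(2) that(1)] .
    moreover have "q (x + s r c, a, t) = q (x, a, t) + s' r (Q ((x, a, t), (c, 0, 0), r))"
      using Qeq[of "(x, a, t)" r "(c, 0, 0)"] U(2) that by (simp add: prod_scale_def eq)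
    ultimately show ?thesis by (simp add: s'.scale_right_distrib)
  qed
  \<comment> \<open>Both expansions of the second difference are compared as \<open>(t, r) \<longlongrightarrow> (0, 0)\<close> through units.\<close>
  let ?F = "units_near (0 :: 'k) \<times>\<^sub>F units_near (0 :: 'k)"
  have F: "?F \<noteq> bot"
    using units_near_nontrivial by (simp add: prod_filter_eq_bot)
  have fst: "(fst \<longlongrightarrow> 0) ?F" and snd: "(snd \<longlongrightarrow> 0) ?F"
    using filterlim_compose[OF tendsto_units_near filterlim_fst]
      filterlim_compose[OF tendsto_units_near filterlim_snd] by blast+
  have ev: "\<forall>\<^sub>F z in ?F. fst z dvd 1 \<and> snd z dvd 1"
    using eventually_units_near eventually_units_near
    by (auto simp: eventually_prod_filter)
  have step: "((\<lambda>z. y + s (h z) a) \<longlongrightarrow> y) ?F" if "(h \<longlongrightarrow> 0) ?F" for y h a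
    using tendsto_add[OF tendsto_const[of y] s.tendsto_scale[OF that tendsto_const[of a]]] by simp
  have "((\<lambda>z. x + s (fst z) u + s (snd z) w) \<longlongrightarrow> x) ?F"
    using tendsto_add[OF step[OF fst, of x u] s.tendsto_scale[OF snd tendsto_const[of w]]] by simp
  from topological_tendstoD[OF this U] topological_tendstoD[OF step[OF fst, of x u] U]
    topological_tendstoD[OF step[OF snd, of x w] U] ev
  have "\<forall>\<^sub>F z in ?F. Q ((x, u, fst z), (w, 0, 0), snd z) = Q ((x, w, snd z), (u, 0, 0), fst z)"
  proof eventually_elim
    case (elim z)
    have eq: "x + s (fst z) u + s (snd z) w = x + s (snd z) w + s (fst z) u" by (simp add: add_ac)
    have "s' (fst z) (s' (snd z) (Q ((x, u, fst z), (w, 0, 0), snd z))) =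
        s' (snd z) (s' (fst z) (Q ((x, w, snd z), (u, 0, 0), fst z)))"
      unfolding second[OF elim(2,3,1), symmetric] second[OF elim(3,2) elim(1)[unfolded eq], symmetric]
      by (simp add: eq)
    also have "\<dots> = s' (fst z) (s' (snd z) (Q ((x, w, snd z), (u, 0, 0), fst z)))"
      by (rule s'.scale_left_commute)
    finally show ?case
      using elim(4) s'.unit_cancel by blast
  qed
  moreover have "((\<lambda>z. Q ((x, u, fst z), (w, 0, 0), snd z)) \<longlongrightarrow> Q ((x, u, 0), (w, 0, 0), 0)) ?F"
    by (rule filterlim_compose[OF Qlim]) (intro tendsto_Pair tendsto_const fst snd)
  moreover have lim2: "((\<lambda>z. Q ((x, w, snd z), (u, 0, 0), fst z)) \<longlongrightarrow> Q ((x, w, 0), (u, 0, 0), 0)) ?F"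
    by (rule filterlim_compose[OF Qlim]) (intro tendsto_Pair tendsto_const fst snd)
  ultimately have "((\<lambda>z. Q ((x, w, snd z), (u, 0, 0), fst z)) \<longlongrightarrow> Q ((x, u, 0), (w, 0, 0), 0)) ?F"
    using tendsto_cong by force
  from tendsto_unique[OF F this lim2] show ?thesis
    by (simp add: Dx)
qed

text \<open>As \<open>df(x)\<close> is linear, it is its own differential in the direction of the second argument.\<close>

lemma second_differential_vertical:
  assumes s: "continuous_module s" and s': "continuous_module s'" and f: "smooth_at s s' f x"
  defines "D \<equiv> \<lambda>p. differential s s' f (fst p) (snd p)"
  shows "differential (prod_scale s s) s' D (x, u) (w, z) =
    differential (prod_scale s s) s' D (x, u) (w, 0) + differential s s' f x z"
proof -
  note ss = continuous_module_prod_scale[OF s s]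
  have D: "smooth_at (prod_scale s s) s' D (x, u)"
    unfolding D_def by (rule smooth_at_differential[OF s s' f])
  have "differential (prod_scale s s) s' D (x, u) (0, z) = differential s s' f x z"
  proof (rule smooth_at_differential_eqI[OF ss s' D tendsto_const])
    interpret s: continuous_module s by fact
    show "\<forall>\<^sub>F t in units_near 0. D ((x, u) + prod_scale s s t (0, z)) =
        D (x, u) + s' t (differential s s' f x z)"
      by (simp add: D_def prod_scale_def differential_add_right[OF s s' f]
          differential_scale_right[OF s s' f])
  qed
  then show ?thesis
    using differential_add_right[OF ss s' D, of "(w, 0)" "(0, z)"] by simp
qed

section \<open>The Lie bracket in a chart\<close>

definition vbracket ::
    "('k::base_ring \<Rightarrow> 'v::{topological_ab_group_add,t2_space} \<Rightarrow> 'v) \<Rightarrow>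
     ('v \<Rightarrow> 'v) \<Rightarrow> ('v \<Rightarrow> 'v) \<Rightarrow> 'v \<Rightarrow> 'v"
  where "vbracket s X Y x = differential s s Y x (X x) - differential s s X x (Y x)"

text \<open>Both brackets are computed by differentiating \<open>X' (h y) = dh(y) (X y)\<close>; the second derivatives of
  \<open>h\<close> that appear cancel because they are symmetric.\<close>

lemma vbracket_related:
  fixes s :: "'k::base_ring \<Rightarrow> 'v::{topological_ab_group_add,t2_space} \<Rightarrow> 'v"
    and s' :: "'k \<Rightarrow> 'w::{topological_ab_group_add,t2_space} \<Rightarrow> 'w"
  assumes s: "continuous_module s" and s': "continuous_module s'" and h: "smooth_at s s' h x"
    and X: "smooth_at s s X x" and Y: "smooth_at s s Y x"
    and X': "smooth_at s' s' X' (h x)" and Y': "smooth_at s' s' Y' (h x)"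
    and V: "open V" "x \<in> V"
    and XX': "\<And>y. y \<in> V \<Longrightarrow> X' (h y) = differential s s' h y (X y)"
    and YY': "\<And>y. y \<in> V \<Longrightarrow> Y' (h y) = differential s s' h y (Y y)"
  shows "vbracket s' X' Y' (h x) = differential s s' h x (vbracket s X Y x)"
proof -
  let ?D = "\<lambda>p. differential s s' h (fst p) (snd p)"
  note ss = continuous_module_prod_scale[OF s s]
  have step: "differential s' s' Z' (h x) (differential s s' h x w) =
      differential (prod_scale s s) s' ?D (x, Z x) (w, 0) +
        differential s s' h x (differential s s Z x w)"
    if Z: "smooth_at s s Z x" and Z': "smooth_at s' s' Z' (h x)"
      and eq: "\<And>y. y \<in> V \<Longrightarrow> Z' (h y) = differential s s' h y (Z y)" for Z Z' w
  proof -
    have "differential s' s' Z' (h x) (differential s s' h x w) =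
        differential s s' (\<lambda>y. Z' (h y)) x w"
      by (rule differential_compose[OF s s' s' h Z', symmetric])
    also have "\<dots> = differential s s' (\<lambda>y. ?D (y, Z y)) x w"
      by (rule differential_transform[OF s s' smooth_at_compose[OF s s' s' h Z'] V, symmetric])
        (simp add: eq)
    also have "\<dots> = differential (prod_scale s s) s' ?D (x, Z x)
        (differential s (prod_scale s s) (\<lambda>y. (y, Z y)) x w)"
      by (rule differential_compose[OF s ss s', of "\<lambda>y. (y, Z y)" x ?D])
        (intro smooth_at_Pair smooth_at_ident Z s smooth_at_differential[OF s s' h])+
    also have "differential s (prod_scale s s) (\<lambda>y. (y, Z y)) x w = (w, differential s s Z x w)"
      by (simp add: differential_Pair[OF s s s smooth_at_ident[OF s] Z] differential_ident[OF s])
    also have "differential (prod_scale s s) s' ?D (x, Z x) (w, differential s s Z x w) =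
        differential (prod_scale s s) s' ?D (x, Z x) (w, 0) +
          differential s s' h x (differential s s Z x w)"
      by (rule second_differential_vertical[OF s s' h])
    finally show ?thesis .
  qed
  have "X' (h x) = differential s s' h x (X x)" "Y' (h x) = differential s s' h x (Y x)"
    using XX' YY' V by auto
  then have "vbracket s' X' Y' (h x) =
      differential s s' h x (differential s s Y x (X x)) - differential s s' h x (differential s s X x (Y x))"
    using second_differential_symmetric[OF s s' h, of "X x" "Y x"]
    by (simp add: vbracket_def step[OF X X' XX'] step[OF Y Y' YY'])
  then show ?thesis
    by (simp add: vbracket_def differential_diff_right[OF s s' h])
qed

section \<open>Charts and smooth maps of manifolds\<close>

lemma smooth_manifold_module: "smooth_manifold M \<Longrightarrow> continuous_module (mscale M)"
  by (simp add: smooth_manifold_def topological_module_iff)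

lemma smooth_manifold_chart_at:
  assumes "smooth_manifold M" "p \<in> points M"
  shows "chart_at M p \<in> atlas M" "p \<in> fst (chart_at M p)"
proof -
  have "\<exists>c. c \<in> atlas M \<and> p \<in> fst c"
    using assms unfolding smooth_manifold_def by blast
  from someI_ex[OF this] show "chart_at M p \<in> atlas M" "p \<in> fst (chart_at M p)"
    by (simp_all add: chart_at_def)
qed

lemma chart_domain:
  assumes "smooth_manifold M" "c \<in> atlas M"
  shows "openin (mtop M) (fst c)" "fst c \<subseteq> points M" "inj_on (snd c) (fst c)" "open (snd c ` fst c)"
proof -
  have o: "openin (mtop M) (fst c)" "open (snd c ` fst c)"
    and h: "homeomorphic_map (subtopology (mtop M) (fst c)) (top_of_set (snd c ` fst c)) (snd c)"
    using assms unfolding smooth_manifold_def by blast+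
  show "openin (mtop M) (fst c)" "fst c \<subseteq> points M" "open (snd c ` fst c)"
    using o openin_subset by auto
  then show "inj_on (snd c) (fst c)"
    using homeomorphic_imp_injective_map[OF h] by (simp add: inf_absorb2)
qed

lemma chart_image_open:
  assumes "smooth_manifold M" "c \<in> atlas M" "openin (mtop M) W" "W \<subseteq> fst c"
  shows "open (snd c ` W)"
proof -
  have h: "homeomorphic_map (subtopology (mtop M) (fst c)) (top_of_set (snd c ` fst c)) (snd c)"
    using assms(1,2) unfolding smooth_manifold_def by blast
  have "openin (subtopology (mtop M) (fst c)) W"
    using assms(3,4) unfolding openin_subtopology by blast
  then have "openin (top_of_set (snd c ` fst c)) (snd c ` W)"
    using homeomorphic_imp_open_map[OF h] by (simp add: open_map_def)
  then show ?thesis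
    using chart_domain(4)[OF assms(1,2)] openin_open_trans by blast
qed

lemma chart_preimage_open:
  assumes "smooth_manifold M" "c \<in> atlas M" "open S"
  shows "openin (mtop M) {p \<in> fst c. snd c p \<in> S}"
proof -
  have h: "homeomorphic_map (subtopology (mtop M) (fst c)) (top_of_set (snd c ` fst c)) (snd c)"
    using assms(1,2) unfolding smooth_manifold_def by blast
  have "continuous_map (subtopology (mtop M) (fst c)) euclidean (snd c)"
    using homeomorphic_imp_continuous_map[OF h] continuous_map_into_fulltopology by blast
  then have "openin (subtopology (mtop M) (fst c))
      {p \<in> topspace (subtopology (mtop M) (fst c)). snd c p \<in> S}"
    using assms(3) by (intro openin_continuous_map_preimage) auto
  then have "openin (mtop M) {p \<in> topspace (subtopology (mtop M) (fst c)). snd c p \<in> S}"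
    using chart_domain(1)[OF assms(1,2)] openin_trans_full by blast
  moreover have "{p \<in> topspace (subtopology (mtop M) (fst c)). snd c p \<in> S} = {p \<in> fst c. snd c p \<in> S}"
    using chart_domain(2)[OF assms(1,2)] by auto
  ultimately show ?thesis by simp
qed

lemma chart_inv_chart:
  assumes "smooth_manifold M" "c \<in> atlas M" "p \<in> fst c"
  shows "chart_inv c (snd c p) = p"
  using chart_domain(3)[OF assms(1,2)] assms(3) by (rule inv_into_f_f)

definition chart_rep :: "('m, 'e) chart \<Rightarrow> ('n, 'f) chart \<Rightarrow> ('m \<Rightarrow> 'n) \<Rightarrow> 'e \<Rightarrow> 'f"
  where "chart_rep c d f = (\<lambda>y. snd d (f (chart_inv c y)))"

lemma chart_rep_chart:
  "smooth_manifold M \<Longrightarrow> c \<in> atlas M \<Longrightarrow> p \<in> fst c \<Longrightarrow> chart_rep c d f (snd c p) = snd d (f p)"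
  by (simp add: chart_rep_def chart_inv_chart)

text \<open>This is the clause for a single point in the definition of smooth maps.\<close>

definition smooth_near ::
    "('m, 'e::{topological_ab_group_add,t2_space}, 'k::base_ring) manifold \<Rightarrow>
     ('n, 'f::{topological_ab_group_add,t2_space}, 'k) manifold \<Rightarrow> ('m \<Rightarrow> 'n) \<Rightarrow> 'm \<Rightarrow> bool"
  where "smooth_near M N f p \<longleftrightarrow> p \<in> points M \<and> f p \<in> points N \<and>
    (\<forall>c\<in>atlas M. \<forall>d\<in>atlas N. p \<in> fst c \<and> f p \<in> fst d \<longrightarrow>
      (\<exists>W. openin (mtop M) W \<and> p \<in> W \<and> W \<subseteq> fst c \<and> f ` W \<subseteq> fst d \<and>
        smooth_on (mscale M) (mscale N) (snd c ` W) (chart_rep c d f)))"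

lemma smooth_map_iff_near:
  "smooth_map M N f \<longleftrightarrow> (\<forall>p\<in>points M. smooth_near M N f p)"
  unfolding smooth_map_def smooth_near_def chart_rep_def o_def by blast

lemma smooth_near_points: "smooth_near M N f p \<Longrightarrow> p \<in> points M \<and> f p \<in> points N"
  by (simp add: smooth_near_def)

lemma smooth_nearE:
  assumes "smooth_near M N f p" "c \<in> atlas M" "d \<in> atlas N" "p \<in> fst c" "f p \<in> fst d"
  obtains W where "openin (mtop M) W" "p \<in> W" "W \<subseteq> fst c" "f ` W \<subseteq> fst d"
    "smooth_at (mscale M) (mscale N) (chart_rep c d f) (snd c p)"
  using assms unfolding smooth_near_def by (blast intro: smooth_atI)

lemma smooth_near_smooth_at:
  assumes "smooth_near M N f p" "c \<in> atlas M" "d \<in> atlas N" "p \<in> fst c" "f p \<in> fst d"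
  shows "smooth_at (mscale M) (mscale N) (chart_rep c d f) (snd c p)"
  by (rule smooth_nearE[OF assms])

text \<open>Continuity is read off from the coordinate expression. Injectivity of the target chart turns
  membership of coordinates in the image of \<open>V\<close> into membership in \<open>V\<close>.\<close>

lemma chart_rep_continuous:
  assumes M: "smooth_manifold M" and N: "smooth_manifold N"
    and c: "c \<in> atlas M" "p \<in> fst c" and d: "d \<in> atlas N" "f p \<in> fst d"
    and W: "openin (mtop M) W" "p \<in> W" "W \<subseteq> fst c" "f ` W \<subseteq> fst d"
    and f: "smooth_at (mscale M) (mscale N) (chart_rep c d f) (snd c p)"
    and V: "openin (mtop N) V" "f p \<in> V"
  obtains W' where "openin (mtop M) W'" "p \<in> W'" "W' \<subseteq> W" "f ` W' \<subseteq> V"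
proof -
  note mM = smooth_manifold_module[OF M] and mN = smooth_manifold_module[OF N]
  from f obtain U where U: "open U" "snd c p \<in> U" "smooth_on (mscale M) (mscale N) U (chart_rep c d f)"
    by (rule smooth_atE)
  let ?V = "snd d ` (V \<inter> fst d)"
  have V': "open ?V"
    by (rule chart_image_open[OF N d(1) openin_Int[OF V(1) chart_domain(1)[OF N d(1)]]]) simp
  have T: "open (chart_rep c d f -` ?V \<inter> U)"
    using smooth_on_imp_continuous_on[OF mM mN U(3)] U(1) V' by (simp add: continuous_on_open_vimage)
  let ?W = "W \<inter> {q \<in> fst c. snd c q \<in> chart_rep c d f -` ?V \<inter> U}"
  show thesis
  proof
    show "openin (mtop M) ?W"
      by (rule openin_Int[OF W(1) chart_preimage_open[OF M c(1) T]])
    show "p \<in> ?W"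
      using W(2) c d V(2) U(2) by (auto simp: chart_rep_chart[OF M])
    show "f ` ?W \<subseteq> V"
    proof
      fix z assume "z \<in> f ` ?W"
      then obtain q where q: "q \<in> W" "q \<in> fst c" "chart_rep c d f (snd c q) \<in> ?V" and z: "z = f q"
        by auto
      then obtain r where r: "r \<in> V" "r \<in> fst d" "snd d (f q) = snd d r"
        by (auto simp: chart_rep_chart[OF M c(1)])
      have "f q \<in> fst d" using q(1) W(4) by blast
      with r show "z \<in> V"
        using inj_onD[OF chart_domain(3)[OF N d(1)]] z by metis
    qed
  qed simp
qed

lemma smooth_near_continuous:
  assumes M: "smooth_manifold M" and N: "smooth_manifold N" and f: "smooth_near M N f p"
    and V: "openin (mtop N) V" "f p \<in> V"
  obtains W where "openin (mtop M) W" "p \<in> W" "f ` W \<subseteq> V"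
proof -
  have p: "p \<in> points M" "f p \<in> points N" using smooth_near_points[OF f] by auto
  note c = smooth_manifold_chart_at[OF M p(1)] and d = smooth_manifold_chart_at[OF N p(2)]
  from f c(1) d(1) c(2) d(2) obtain W where
    W: "openin (mtop M) W" "p \<in> W" "W \<subseteq> fst (chart_at M p)" "f ` W \<subseteq> fst (chart_at N (f p))"
      "smooth_at (mscale M) (mscale N) (chart_rep (chart_at M p) (chart_at N (f p)) f) (snd (chart_at M p) p)"
    by (rule smooth_nearE)
  show thesis
    by (rule chart_rep_continuous[where f = f, OF M N c d W V]) (rule that)
qed

lemma smooth_at_transition:
  assumes M: "smooth_manifold M" and c: "c \<in> atlas M" "p \<in> fst c" and d: "d \<in> atlas M" "p \<in> fst d"
  shows "smooth_at (mscale M) (mscale M) (chart_rep c d (\<lambda>x. x)) (snd c p)"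
proof -
  have "smooth_on (mscale M) (mscale M) (snd c ` (fst c \<inter> fst d)) (snd d \<circ> chart_inv c)"
    using M c(1) d(1) unfolding smooth_manifold_def by blast
  then have "smooth_on (mscale M) (mscale M) (snd c ` (fst c \<inter> fst d)) (chart_rep c d (\<lambda>x. x))"
    by (simp add: chart_rep_def o_def)
  then show ?thesis
    by (rule smooth_atI) (use c d in auto)
qed

text \<open>Smoothness in one pair of charts suffices: the coordinate expression in another pair differs by
  transition functions on a neighbourhood of the point.\<close>

lemma smooth_nearI:
  assumes M: "smooth_manifold M" and N: "smooth_manifold N"
    and c: "c \<in> atlas M" "p \<in> fst c" and d: "d \<in> atlas N" "f p \<in> fst d"
    and W: "openin (mtop M) W" "p \<in> W" "W \<subseteq> fst c" "f ` W \<subseteq> fst d"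
    and f: "smooth_at (mscale M) (mscale N) (chart_rep c d f) (snd c p)"
  shows "smooth_near M N f p"
  unfolding smooth_near_def
proof (intro conjI ballI impI)
  show "p \<in> points M" "f p \<in> points N"
    using chart_domain(2)[OF M c(1)] chart_domain(2)[OF N d(1)] c d by auto
next
  note mM = smooth_manifold_module[OF M] and mN = smooth_manifold_module[OF N]
  fix c' d' assume c': "c' \<in> atlas M" and d': "d' \<in> atlas N" and p: "p \<in> fst c' \<and> f p \<in> fst d'"
  have "openin (mtop N) (fst d \<inter> fst d')"
    by (intro openin_Int chart_domain(1)[OF N] d d')
  then obtain V where V: "openin (mtop M) V" "p \<in> V" "V \<subseteq> W" "f ` V \<subseteq> fst d \<inter> fst d'"
    using p d by (auto intro: chart_rep_continuous[OF M N c d W f])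
  let ?V = "V \<inter> fst c'"
  have V': "openin (mtop M) ?V" "p \<in> ?V" "?V \<subseteq> fst c'" "?V \<subseteq> fst c"
    using V W p chart_domain(1)[OF M c'] by auto
  let ?g = "\<lambda>y. chart_rep d d' (\<lambda>x. x) (chart_rep c d f (chart_rep c' c (\<lambda>x. x) y))"
  have t: "smooth_at (mscale M) (mscale M) (chart_rep c' c (\<lambda>x. x)) (snd c' p)"
    using smooth_at_transition[OF M c' _ c] p by blast
  have f': "smooth_at (mscale M) (mscale N) (chart_rep c d f) (chart_rep c' c (\<lambda>x. x) (snd c' p))"
    using f p by (simp add: chart_rep_chart[OF M c'])
  have t': "smooth_at (mscale N) (mscale N) (chart_rep d d' (\<lambda>x. x))
      (chart_rep c d f (chart_rep c' c (\<lambda>x. x) (snd c' p)))"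
    using smooth_at_transition[OF N d d'] p
    by (simp add: chart_rep_chart[OF M c'] chart_rep_chart[OF M c(1)] c)
  have g: "smooth_at (mscale M) (mscale N) ?g (snd c' p)"
    by (rule smooth_at_compose[OF mM mN mN smooth_at_compose[OF mM mM mN t f'] t'])
  have eq: "?g y = chart_rep c' d' f y" if "y \<in> snd c' ` ?V" for y
  proof -
    from that obtain q where q: "q \<in> ?V" and y: "y = snd c' q" by (rule imageE)
    have "q \<in> fst c" "q \<in> fst c'" "f q \<in> fst d" using q V(4) V'(3,4) by blast+
    then show ?thesis
      unfolding y by (simp add: chart_rep_chart[OF M c'] chart_rep_chart[OF M c(1)]
          chart_rep_chart[OF N d(1)])
  qed
  have "smooth_at (mscale M) (mscale N) (chart_rep c' d' f) (snd c' p)"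
    by (rule smooth_at_transform[OF mM mN g chart_image_open[OF M c' V'(1,3)] _ eq]) (use V'(2) in auto)
  then obtain U where U: "open U" "snd c' p \<in> U" "smooth_on (mscale M) (mscale N) U (chart_rep c' d' f)"
    by (rule smooth_atE)
  let ?W = "?V \<inter> {q \<in> fst c'. snd c' q \<in> U}"
  have W: "openin (mtop M) ?W" "?W \<subseteq> fst c'"
    using V' chart_preimage_open[OF M c' U(1)] by auto
  then have "smooth_on (mscale M) (mscale N) (snd c' ` ?W) (chart_rep c' d' f)"
    by (intro smooth_on_subset[OF mM mN U(3)] chart_image_open[OF M c']) auto
  moreover have "p \<in> ?W" "f ` ?W \<subseteq> fst d'"
    using V' V U p by auto
  ultimately show "\<exists>W. openin (mtop M) W \<and> p \<in> W \<and> W \<subseteq> fst c' \<and> f ` W \<subseteq> fst d' \<and>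
      smooth_on (mscale M) (mscale N) (snd c' ` W) (chart_rep c' d' f)"
    using W by blast
qed

section \<open>Differentials in charts and tangent vectors\<close>

text \<open>Tangent vectors are handled through their coordinates in charts: \<open>chart_diff\<close> is the tangent map of
  \<open>f\<close> at \<open>p\<close> in the charts \<open>c\<close> and \<open>d\<close>, and for the identity it is the change of tangent coordinates from \<open>c\<close>
  to \<open>d\<close>.\<close>

definition chart_diff ::
    "('m, 'e::{topological_ab_group_add,t2_space}, 'k::base_ring) manifold \<Rightarrow>
     ('n, 'f::{topological_ab_group_add,t2_space}, 'k) manifold \<Rightarrow>
     ('m, 'e) chart \<Rightarrow> ('n, 'f) chart \<Rightarrow> ('m \<Rightarrow> 'n) \<Rightarrow> 'm \<Rightarrow> 'e \<Rightarrow> 'f"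
  where "chart_diff M N c d f p = differential (mscale M) (mscale N) (chart_rep c d f) (snd c p)"

lemma
  assumes M: "smooth_manifold M" and N: "smooth_manifold N" and f: "smooth_near M N f p"
    and cd: "c \<in> atlas M" "d \<in> atlas N" "p \<in> fst c" "f p \<in> fst d"
  shows chart_diff_add: "chart_diff M N c d f p (v + w) = chart_diff M N c d f p v + chart_diff M N c d f p w"
    and chart_diff_minus: "chart_diff M N c d f p (- v) = - chart_diff M N c d f p v"
    and chart_diff_scale: "chart_diff M N c d f p (mscale M r v) = mscale N r (chart_diff M N c d f p v)"
  using smooth_near_smooth_at[OF f cd] smooth_manifold_module[OF M] smooth_manifold_module[OF N]
  by (simp_all add: chart_diff_def differential_add_right differential_minus_right differential_scale_right)

lemma chart_diff_cong:
  assumes M: "smooth_manifold M" and N: "smooth_manifold N" and f: "smooth_near M N f p"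
    and W: "openin (mtop M) W" "p \<in> W" "\<And>q. q \<in> W \<Longrightarrow> f q = g q"
    and cd: "c \<in> atlas M" "d \<in> atlas N" "p \<in> fst c" "f p \<in> fst d"
  shows "chart_diff M N c d g p v = chart_diff M N c d f p v"
proof -
  note mM = smooth_manifold_module[OF M] and mN = smooth_manifold_module[OF N]
  have eq: "chart_rep c d f y = chart_rep c d g y" if "y \<in> snd c ` (W \<inter> fst c)" for y
    using that W(3) by (auto simp: chart_rep_chart[OF M cd(1)])
  have "open (snd c ` (W \<inter> fst c))"
    using chart_image_open[OF M cd(1) openin_Int[OF W(1) chart_domain(1)[OF M cd(1)]]] by simp
  then show ?thesis
    unfolding chart_diff_def
    by (rule differential_transform[OF mM mN smooth_near_smooth_at[OF f cd] _ _ eq])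
      (use W(2) cd(3) in auto)
qed

lemma
  assumes M: "smooth_manifold M" and N: "smooth_manifold N" and P: "smooth_manifold P"
    and f: "smooth_near M N f p" and g: "smooth_near N P g (f p)"
  shows smooth_near_compose: "smooth_near M P (\<lambda>x. g (f x)) p"
    and chart_diff_compose: "c \<in> atlas M \<Longrightarrow> d \<in> atlas N \<Longrightarrow> e \<in> atlas P \<Longrightarrow> p \<in> fst c \<Longrightarrow>
      f p \<in> fst d \<Longrightarrow> g (f p) \<in> fst e \<Longrightarrow>
      chart_diff M P c e (\<lambda>x. g (f x)) p v = chart_diff N P d e g (f p) (chart_diff M N c d f p v)"
proof -
  note mM = smooth_manifold_module[OF M] and mN = smooth_manifold_module[OF N]
    and mP = smooth_manifold_module[OF P]
  have *: "smooth_near M P (\<lambda>x. g (f x)) p \<and>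
      chart_diff M P c e (\<lambda>x. g (f x)) p v = chart_diff N P d e g (f p) (chart_diff M N c d f p v)"
    if c: "c \<in> atlas M" and d: "d \<in> atlas N" and e: "e \<in> atlas P"
      and p: "p \<in> fst c" "f p \<in> fst d" "g (f p) \<in> fst e" for c d e
  proof -
    from g d e p(2,3) obtain V where V: "openin (mtop N) V" "f p \<in> V" "V \<subseteq> fst d" "g ` V \<subseteq> fst e"
      and gs: "smooth_at (mscale N) (mscale P) (chart_rep d e g) (snd d (f p))"
      by (rule smooth_nearE)
    note fs = smooth_near_smooth_at[OF f c d p(1,2)]
    from smooth_near_continuous[OF M N f V(1,2)] obtain W0
      where W0: "openin (mtop M) W0" "p \<in> W0" "f ` W0 \<subseteq> V" .
    let ?W = "W0 \<inter> fst c"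
    have W: "openin (mtop M) ?W" "p \<in> ?W" "?W \<subseteq> fst c"
      using W0 chart_domain(1)[OF M c] p by auto
    have gs': "smooth_at (mscale N) (mscale P) (chart_rep d e g) (chart_rep c d f (snd c p))"
      using gs by (simp add: chart_rep_chart[OF M c p(1)])
    note comp = smooth_at_compose[OF mM mN mP fs gs']
    have eq: "chart_rep d e g (chart_rep c d f y) = chart_rep c e (\<lambda>x. g (f x)) y"
      if "y \<in> snd c ` ?W" for y
      using that V W0 by (auto simp: chart_rep_chart[OF M c] chart_rep_chart[OF N d] image_subset_iff subset_iff)
    have im: "open (snd c ` ?W)" "snd c p \<in> snd c ` ?W"
      using chart_image_open[OF M c W(1,3)] W(2) by auto
    have "smooth_at (mscale M) (mscale P) (chart_rep c e (\<lambda>x. g (f x))) (snd c p)"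
      by (rule smooth_at_transform[OF mM mP comp im eq])
    then have "smooth_near M P (\<lambda>x. g (f x)) p"
      by (intro smooth_nearI[where f = "\<lambda>x. g (f x)", OF M P c p(1) e p(3) W]) (use V(4) W0(3) in blast)
    moreover have "chart_diff M P c e (\<lambda>x. g (f x)) p v =
        chart_diff N P d e g (f p) (chart_diff M N c d f p v)"
      using differential_transform[OF mM mP comp im eq, of v] differential_compose[OF mM mN mP fs gs', of v]
      by (simp add: chart_diff_def chart_rep_chart[OF M c p(1)])
    ultimately show ?thesis ..
  qed
  have p: "p \<in> points M" "f p \<in> points N" "g (f p) \<in> points P"
    using smooth_near_points[OF f] smooth_near_points[OF g] by auto
  show "smooth_near M P (\<lambda>x. g (f x)) p"
    using * smooth_manifold_chart_at[OF M p(1)] smooth_manifold_chart_at[OF N p(2)]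
      smooth_manifold_chart_at[OF P p(3)] by blast
  show "chart_diff M P c e (\<lambda>x. g (f x)) p v = chart_diff N P d e g (f p) (chart_diff M N c d f p v)"
    if "c \<in> atlas M" "d \<in> atlas N" "e \<in> atlas P" "p \<in> fst c" "f p \<in> fst d" "g (f p) \<in> fst e" for c d e
    using *[OF that] by blast
qed

lemma smooth_near_ident:
  assumes M: "smooth_manifold M" and p: "p \<in> points M"
  shows "smooth_near M M (\<lambda>x. x) p"
proof -
  note c = smooth_manifold_chart_at[OF M p]
  show ?thesis
    by (rule smooth_nearI[OF M M c c chart_domain(1)[OF M c(1)] c(2) subset_refl _ smooth_at_transition[OF M c c]])
      simp
qed

lemma chart_diff_ident:
  assumes M: "smooth_manifold M" and c: "c \<in> atlas M" "p \<in> fst c"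
  shows "chart_diff M M c c (\<lambda>x. x) p v = v"
proof -
  note m = smooth_manifold_module[OF M]
  have "differential (mscale M) (mscale M) (chart_rep c c (\<lambda>x. x)) (snd c p) v =
      differential (mscale M) (mscale M) (\<lambda>y. y) (snd c p) v"
    by (rule differential_transform[OF m m smooth_at_ident[OF m] chart_domain(4)[OF M c(1)]])
      (use c in \<open>auto simp: chart_rep_chart[OF M]\<close>)
  then show ?thesis
    by (simp add: chart_diff_def differential_ident[OF m])
qed

lemma
  assumes M: "smooth_manifold M" and N: "smooth_manifold N" and p: "p \<in> points M" and q: "q \<in> points N"
  shows smooth_near_const: "smooth_near M N (\<lambda>_. q) p"
    and chart_diff_const: "chart_diff M N c d (\<lambda>_. q) p v = 0"
proof -
  note m = smooth_manifold_module[OF M] smooth_manifold_module[OF N]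
  note c = smooth_manifold_chart_at[OF M p] and d = smooth_manifold_chart_at[OF N q]
  show "smooth_near M N (\<lambda>_. q) p"
    by (rule smooth_nearI[OF M N c d chart_domain(1)[OF M c(1)] c(2) subset_refl])
      (use d in \<open>auto simp: chart_rep_def smooth_at_const[OF m]\<close>)
  show "chart_diff M N c d (\<lambda>_. q) p v = 0"
    by (simp add: chart_diff_def chart_rep_def differential_const[OF m])
qed

lemma tangent_vector_alt:
  "tangent_vector M c p v =
    (p, {(d, w). d \<in> atlas M \<and> p \<in> fst d \<and> w = chart_diff M M c d (\<lambda>x. x) p v})"
  by (simp add: tangent_vector_def chart_diff_def chart_rep_def o_def)

lemma fst_tangent_vector [simp]: "fst (tangent_vector M c p v) = p"
  by (simp add: tangent_vector_def)

lemma tcoord_tangent_vector: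
  assumes "d \<in> atlas M" "p \<in> fst d"
  shows "tcoord d (tangent_vector M c p v) = chart_diff M M c d (\<lambda>x. x) p v"
  using assms by (simp add: tcoord_def tangent_vector_alt)

lemma tcoord_tangent_vector_self:
  assumes "smooth_manifold M" "c \<in> atlas M" "p \<in> fst c"
  shows "tcoord c (tangent_vector M c p v) = v"
  using assms by (simp add: tcoord_tangent_vector chart_diff_ident)

lemma chart_points: "smooth_manifold M \<Longrightarrow> c \<in> atlas M \<Longrightarrow> p \<in> fst c \<Longrightarrow> p \<in> points M"
  using chart_domain(2) by blast

lemma tangent_vector_change:
  assumes M: "smooth_manifold M" and c: "c \<in> atlas M" "p \<in> fst c" and d: "d \<in> atlas M" "p \<in> fst d"
  shows "tangent_vector M d p (chart_diff M M c d (\<lambda>x. x) p v) = tangent_vector M c p v"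
proof -
  note i = smooth_near_ident[OF M chart_points[OF M c]]
  have "chart_diff M M d e (\<lambda>x. x) p (chart_diff M M c d (\<lambda>x. x) p v) = chart_diff M M c e (\<lambda>x. x) p v"
    if "e \<in> atlas M" "p \<in> fst e" for e
    using chart_diff_compose[OF M M M i i c(1) d(1) that(1) c(2) d(2) that(2)] by simp
  then show ?thesis
    by (auto simp: tangent_vector_alt)
qed

lemma tangent_vector_in_space:
  "c \<in> atlas M \<Longrightarrow> p \<in> fst c \<Longrightarrow> tangent_vector M c p v \<in> tangent_space M p"
  unfolding tangent_space_def by blast

lemma tangent_vector_tcoord:
  assumes M: "smooth_manifold M" and c: "c \<in> atlas M" "p \<in> fst c" and \<xi>: "\<xi> \<in> tangent_space M p"
  shows "tangent_vector M c p (tcoord c \<xi>) = \<xi>"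
proof -
  from \<xi> obtain d v where d: "d \<in> atlas M" "p \<in> fst d" and eq: "\<xi> = tangent_vector M d p v"
    unfolding tangent_space_def by blast
  show ?thesis
    unfolding eq tcoord_tangent_vector[OF c] by (rule tangent_vector_change[OF M d c])
qed

lemma fst_tangent_space: "\<xi> \<in> tangent_space M p \<Longrightarrow> fst \<xi> = p"
  by (auto simp: tangent_space_def)

text \<open>The tangent map is defined through charts chosen at \<open>p\<close> and \<open>f p\<close>; by the chain rule any other charts
  give the same tangent vector.\<close>

lemma tangent_map_tangent_vector:
  assumes M: "smooth_manifold M" and N: "smooth_manifold N" and f: "smooth_near M N f p"
    and c: "c \<in> atlas M" "p \<in> fst c" and d: "d \<in> atlas N" "f p \<in> fst d"
  shows "tangent_map M N f (tangent_vector M c p v) = tangent_vector N d (f p) (chart_diff M N c d f p v)"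
proof -
  have p: "p \<in> points M" "f p \<in> points N" using smooth_near_points[OF f] by auto
  note c' = smooth_manifold_chart_at[OF M p(1)] and d' = smooth_manifold_chart_at[OF N p(2)]
  let ?c = "chart_at M p" and ?d = "chart_at N (f p)"
  have "tangent_map M N f (tangent_vector M c p v) =
      tangent_vector N ?d (f p) (chart_diff M N ?c ?d f p (chart_diff M M c ?c (\<lambda>x. x) p v))"
    by (simp add: tangent_map_def Let_def tcoord_tangent_vector[OF c'] chart_diff_def chart_rep_def o_def)
  also have "\<dots> = tangent_vector N ?d (f p) (chart_diff M N c ?d f p v)"
    using chart_diff_compose[OF M M N smooth_near_ident[OF M p(1)] f c(1) c'(1) d'(1) c(2) c'(2) d'(2)]
    by simp
  also have "chart_diff M N c ?d f p v = chart_diff N N d ?d (\<lambda>x. x) (f p) (chart_diff M N c d f p v)"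
    using chart_diff_compose[OF M N N f smooth_near_ident[OF N p(2)] c(1) d(1) d'(1) c(2) d(2) d'(2)]
    by simp
  also have "tangent_vector N ?d (f p) \<dots> = tangent_vector N d (f p) (chart_diff M N c d f p v)"
    by (rule tangent_vector_change[OF N d d'])
  finally show ?thesis .
qed

lemma
  assumes M: "smooth_manifold M" and c: "c \<in> atlas M" "p \<in> fst c"
  shows tadd_tangent_vector: "tadd M (tangent_vector M c p v) (tangent_vector M c p w) = tangent_vector M c p (v + w)"
    and tscale_tangent_vector: "tscale M r (tangent_vector M c p v) = tangent_vector M c p (mscale M r v)"
    and tminus_tangent_vector: "tminus M (tangent_vector M c p v) = tangent_vector M c p (- v)"
proof -
  note p = chart_points[OF M c]
  note d = smooth_manifold_chart_at[OF M p] and i = smooth_near_ident[OF M p]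
  note lin = chart_diff_add[OF M M i c(1) d(1) c(2) d(2)] chart_diff_scale[OF M M i c(1) d(1) c(2) d(2)]
    chart_diff_minus[OF M M i c(1) d(1) c(2) d(2)]
  show "tadd M (tangent_vector M c p v) (tangent_vector M c p w) = tangent_vector M c p (v + w)"
    "tscale M r (tangent_vector M c p v) = tangent_vector M c p (mscale M r v)"
    "tminus M (tangent_vector M c p v) = tangent_vector M c p (- v)"
    by (simp_all add: tadd_def tscale_def tminus_def Let_def tcoord_tangent_vector[OF d]
        tangent_vector_change[OF M c d] flip: lin)
qed

section \<open>Products of manifolds\<close>

abbreviation prod_chart :: "('m, 'e) chart \<Rightarrow> ('n, 'f) chart \<Rightarrow> ('m \<times> 'n, 'e \<times> 'f) chart"
  where "prod_chart c d \<equiv> (fst c \<times> fst d, map_prod (snd c) (snd d))"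

lemma prod_manifold_simps [simp]:
  "mtop (prod_manifold M N) = prod_topology (mtop M) (mtop N)"
  "mscale (prod_manifold M N) = prod_scale (mscale M) (mscale N)"
  by (simp_all add: prod_manifold_def)

lemma atlas_prod_manifold:
  "atlas (prod_manifold M N) = {prod_chart c d | c d. c \<in> atlas M \<and> d \<in> atlas N}"
  by (simp add: prod_manifold_def)

lemma prod_chart_in_atlas: "c \<in> atlas M \<Longrightarrow> d \<in> atlas N \<Longrightarrow> prod_chart c d \<in> atlas (prod_manifold M N)"
  unfolding atlas_prod_manifold by blast

lemma prod_chart_inv:
  assumes "smooth_manifold M" "smooth_manifold N" "c \<in> atlas M" "d \<in> atlas N"
    and "p \<in> fst c" "q \<in> fst d"
  shows "chart_inv (prod_chart c d) (snd c p, snd d q) = (p, q)"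
proof -
  have "inj_on (map_prod (snd c) (snd d)) (fst c \<times> fst d)"
    by (rule map_prod_inj_on[OF chart_domain(3)[OF assms(1,3)] chart_domain(3)[OF assms(2,4)]])
  from inv_into_f_f[OF this, of "(p, q)"] assms(5,6) show ?thesis by simp
qed

text \<open>The tangent map of the multiplication is computed in a chart of \<open>M \<times> M\<close> that was chosen without
  reference to the charts of the factors. Independence of this choice comes from the fact that
  \<open>M \<times> M\<close> is itself a manifold.\<close>

lemma smooth_manifold_prod:
  assumes M: "smooth_manifold M" and N: "smooth_manifold N"
  shows "smooth_manifold (prod_manifold M N)"
proof -
  note mM = smooth_manifold_module[OF M] and mN = smooth_manifold_module[OF N]
  note mP = continuous_module_prod_scale[OF mM mN]
  let ?P = "prod_manifold M N" and ?s = "prod_scale (mscale M) (mscale N)"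
  have cover: "(\<Union>c\<in>atlas M. fst c) = points M" "(\<Union>c\<in>atlas N. fst c) = points N"
    using M N unfolding smooth_manifold_def by blast+
  have "topological_module ?s"
    using mP by (simp only: topological_module_iff)
  moreover have "(\<Union>c\<in>atlas ?P. fst c) = points ?P"
  proof -
    have "(\<Union>c\<in>atlas ?P. fst c) = (\<Union>c\<in>atlas M. fst c) \<times> (\<Union>c\<in>atlas N. fst c)"
      unfolding atlas_prod_manifold by (auto; blast)
    then show ?thesis by (simp only: cover prod_manifold_simps topspace_prod_topology)
  qed
  moreover have "openin (mtop ?P) (fst e)" "open (snd e ` fst e)"
    "homeomorphic_map (subtopology (mtop ?P) (fst e)) (top_of_set (snd e ` fst e)) (snd e)"
    if e: "e \<in> atlas ?P" for e
  proof -
    from e obtain c d where c: "c \<in> atlas M" and d: "d \<in> atlas N" and e: "e = prod_chart c d"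
      unfolding atlas_prod_manifold by blast
    show "openin (mtop ?P) (fst e)"
      by (simp add: e openin_prod_Times_iff chart_domain(1)[OF M c] chart_domain(1)[OF N d])
    have im: "snd e ` fst e = (snd c ` fst c) \<times> (snd d ` fst d)"
      by (simp add: e map_prod_image)
    show "open (snd e ` fst e)"
      unfolding im by (intro open_Times chart_domain(4)[OF M c] chart_domain(4)[OF N d])
    have "homeomorphic_map (subtopology (mtop M) (fst c)) (top_of_set (snd c ` fst c)) (snd c)"
      using M c unfolding smooth_manifold_def by blast
    then obtain g where g: "homeomorphic_maps (subtopology (mtop M) (fst c)) (top_of_set (snd c ` fst c)) (snd c) g"
      unfolding homeomorphic_map_maps by blast
    have "homeomorphic_map (subtopology (mtop N) (fst d)) (top_of_set (snd d ` fst d)) (snd d)"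
      using N d unfolding smooth_manifold_def by blast
    then obtain h where h: "homeomorphic_maps (subtopology (mtop N) (fst d)) (top_of_set (snd d ` fst d)) (snd d) h"
      unfolding homeomorphic_map_maps by blast
    have "map_prod (snd c) (snd d) = (\<lambda>(x, y). (snd c x, snd d y))"
      by (simp add: fun_eq_iff)
    then have "homeomorphic_map (prod_topology (subtopology (mtop M) (fst c)) (subtopology (mtop N) (fst d)))
        (prod_topology (top_of_set (snd c ` fst c)) (top_of_set (snd d ` fst d))) (map_prod (snd c) (snd d))"
      using homeomorphic_maps_prod[THEN iffD2, OF disjI2, OF conjI, OF g h]
      unfolding homeomorphic_map_maps by auto
    then show "homeomorphic_map (subtopology (mtop ?P) (fst e)) (top_of_set (snd e ` fst e)) (snd e)"
      unfolding im by (simp add: e subtopology_Times)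
  qed
  moreover have "smooth_on ?s ?s (snd e ` (fst e \<inter> fst e')) (snd e' \<circ> chart_inv e)"
    if e: "e \<in> atlas ?P" "e' \<in> atlas ?P" for e e'
  proof -
    from e obtain c d c' d' where c: "c \<in> atlas M" "c' \<in> atlas M" and d: "d \<in> atlas N" "d' \<in> atlas N"
      and e: "e = prod_chart c d" "e' = prod_chart c' d'"
      unfolding atlas_prod_manifold by blast
    let ?A = "snd c ` (fst c \<inter> fst c')" and ?B = "snd d ` (fst d \<inter> fst d')"
    have im: "snd e ` (fst e \<inter> fst e') = ?A \<times> ?B"
      by (simp add: e Times_Int_Times map_prod_image)
    have A: "smooth_on (mscale M) (mscale M) ?A (chart_rep c c' (\<lambda>x. x))"
      and B: "smooth_on (mscale N) (mscale N) ?B (chart_rep d d' (\<lambda>x. x))"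
      using M N c d unfolding smooth_manifold_def chart_rep_def o_def by blast+
    have o: "open (?A \<times> ?B)"
      by (intro open_Times smooth_on_open[OF A] smooth_on_open[OF B])
    have "smooth_on ?s (mscale M) (?A \<times> ?B) fst" "smooth_on ?s (mscale N) (?A \<times> ?B) snd"
      by (intro smooth_on_linear[OF mP _ o] mM mN continuous_on_fst continuous_on_snd continuous_on_id;
          simp add: prod_scale_def)+
    note fs = smooth_on_compose[OF mP mM mM this(1) A] smooth_on_compose[OF mP mN mN this(2) B]
    have "smooth_on ?s ?s (?A \<times> ?B) (\<lambda>z. (chart_rep c c' (\<lambda>x. x) (fst z), chart_rep d d' (\<lambda>x. x) (snd z)))"
      by (intro smooth_on_Pair[OF mP mM mN] fs) auto
    then show ?thesis
      unfolding im
    proof (rule smooth_on_cong[OF mP mP])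
      fix z assume "z \<in> ?A \<times> ?B"
      then obtain p q where pq: "p \<in> fst c" "q \<in> fst d" and z: "z = (snd c p, snd d q)" by auto
      then show "(chart_rep c c' (\<lambda>x. x) (fst z), chart_rep d d' (\<lambda>x. x) (snd z)) = (snd e' \<circ> chart_inv e) z"
        using prod_chart_inv[OF M N c(1) d(1) pq]
        by (simp add: e z chart_rep_chart[OF M c(1)] chart_rep_chart[OF N d(1)])
    qed
  qed
  ultimately show ?thesis
    unfolding smooth_manifold_def by simp
qed

lemma
  assumes P: "smooth_manifold P" and M: "smooth_manifold M" and N: "smooth_manifold N"
    and f: "smooth_near P M f p" and g: "smooth_near P N g p"
  shows smooth_near_Pair: "smooth_near P (prod_manifold M N) (\<lambda>z. (f z, g z)) p"
    and chart_diff_Pair: "a \<in> atlas P \<Longrightarrow> c \<in> atlas M \<Longrightarrow> d \<in> atlas N \<Longrightarrow> p \<in> fst a \<Longrightarrow>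
      f p \<in> fst c \<Longrightarrow> g p \<in> fst d \<Longrightarrow>
      chart_diff P (prod_manifold M N) a (prod_chart c d) (\<lambda>z. (f z, g z)) p v =
        (chart_diff P M a c f p v, chart_diff P N a d g p v)"
proof -
  note mP = smooth_manifold_module[OF P] and mM = smooth_manifold_module[OF M]
    and mN = smooth_manifold_module[OF N]
  have rep: "chart_rep a (prod_chart c d) (\<lambda>z. (f z, g z)) = (\<lambda>y. (chart_rep a c f y, chart_rep a d g y))"
    for a c d by (simp add: chart_rep_def)
  show "chart_diff P (prod_manifold M N) a (prod_chart c d) (\<lambda>z. (f z, g z)) p v =
        (chart_diff P M a c f p v, chart_diff P N a d g p v)"
    if a: "a \<in> atlas P" and c: "c \<in> atlas M" and d: "d \<in> atlas N"
      and p: "p \<in> fst a" "f p \<in> fst c" "g p \<in> fst d" for a c d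
    by (simp add: chart_diff_def rep differential_Pair[OF mP mM mN smooth_near_smooth_at[OF f a c p(1,2)]
        smooth_near_smooth_at[OF g a d p(1,3)]])
  have p: "p \<in> points P" "f p \<in> points M" "g p \<in> points N"
    using smooth_near_points[OF f] smooth_near_points[OF g] by auto
  note a = smooth_manifold_chart_at[OF P p(1)] and c = smooth_manifold_chart_at[OF M p(2)]
    and d = smooth_manifold_chart_at[OF N p(3)]
  let ?a = "chart_at P p" and ?c = "chart_at M (f p)" and ?d = "chart_at N (g p)"
  from f a(1) c(1) a(2) c(2) obtain V where V: "openin (mtop P) V" "p \<in> V" "V \<subseteq> fst ?a" "f ` V \<subseteq> fst ?c"
    "smooth_at (mscale P) (mscale M) (chart_rep ?a ?c f) (snd ?a p)" by (rule smooth_nearE)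
  from g a(1) d(1) a(2) d(2) obtain W where W: "openin (mtop P) W" "p \<in> W" "W \<subseteq> fst ?a" "g ` W \<subseteq> fst ?d"
    "smooth_at (mscale P) (mscale N) (chart_rep ?a ?d g) (snd ?a p)" by (rule smooth_nearE)
  show "smooth_near P (prod_manifold M N) (\<lambda>z. (f z, g z)) p"
  proof (rule smooth_nearI[OF P smooth_manifold_prod[OF M N] a prod_chart_in_atlas[OF c(1) d(1)] _ openin_Int[OF V(1) W(1)]])
    show "smooth_at (mscale P) (mscale (prod_manifold M N))
        (chart_rep ?a (prod_chart ?c ?d) (\<lambda>z. (f z, g z))) (snd ?a p)"
      unfolding rep by (simp add: smooth_at_Pair[OF mP mM mN V(5) W(5)])
  qed (use V W c d in auto)
qed

section \<open>Partial derivatives of the multiplication of a symmetric space\<close>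

locale symm_space =
  fixes M :: "('m, 'e::{topological_ab_group_add,t2_space}, 'k::base_ring) manifold"
    and m :: "'m \<times> 'm \<Rightarrow> 'm"
  assumes symm: "symmetric_space M m"
begin

lemma manifold: "smooth_manifold M"
  using symm by (simp add: symmetric_space_def)

lemma manifold2: "smooth_manifold (prod_manifold M M)"
  by (intro smooth_manifold_prod manifold)

lemma mult_closed: "x \<in> points M \<Longrightarrow> y \<in> points M \<Longrightarrow> m (x, y) \<in> points M"
  using symm by (auto simp: symmetric_space_def smooth_map_def image_subset_iff)

lemma mult_idem: "x \<in> points M \<Longrightarrow> m (x, x) = x"
  and mult_invol: "x \<in> points M \<Longrightarrow> y \<in> points M \<Longrightarrow> m (x, m (x, y)) = y"
  and mult_distrib: "x \<in> points M \<Longrightarrow> y \<in> points M \<Longrightarrow> z \<in> points M \<Longrightarrow>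
    m (x, m (y, z)) = m (m (x, y), m (x, z))"
  using symm unfolding symmetric_space_def by blast+

lemma mult_smooth:
  "x \<in> points M \<Longrightarrow> y \<in> points M \<Longrightarrow> smooth_near (prod_manifold M M) M m (x, y)"
  using symm unfolding symmetric_space_def smooth_map_iff_near by auto

abbreviation \<kappa> :: "'m \<Rightarrow> ('m, 'e) chart" where "\<kappa> \<equiv> chart_at M"

lemmas kappa = smooth_manifold_chart_at[OF manifold]

text \<open>In the charts chosen at each point, \<open>R y x\<close> and \<open>L x y\<close> are the differentials at \<open>x\<close> and at \<open>y\<close> of
  the two partial maps \<open>m(\<cdot>, y)\<close> and \<open>m(x, \<cdot>)\<close>.\<close>

definition R :: "'m \<Rightarrow> 'm \<Rightarrow> 'e \<Rightarrow> 'e"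
  where "R y x = chart_diff M M (\<kappa> x) (\<kappa> (m (x, y))) (\<lambda>z. m (z, y)) x"

definition L :: "'m \<Rightarrow> 'm \<Rightarrow> 'e \<Rightarrow> 'e"
  where "L x y = chart_diff M M (\<kappa> y) (\<kappa> (m (x, y))) (\<lambda>z. m (x, z)) y"

lemma
  assumes x: "x \<in> points M" and y: "y \<in> points M"
  shows smooth_near_mult_left: "smooth_near M M (\<lambda>z. m (z, y)) x"
    and smooth_near_mult_right: "smooth_near M M (\<lambda>z. m (x, z)) y"
proof -
  note i = smooth_near_ident[OF manifold] and k = smooth_near_const[OF manifold manifold]
  have px: "smooth_near M (prod_manifold M M) (\<lambda>z. (z, y)) x"
    and py: "smooth_near M (prod_manifold M M) (\<lambda>z. (x, z)) y"
    by (intro smooth_near_Pair manifold i k x y)+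
  show "smooth_near M M (\<lambda>z. m (z, y)) x" "smooth_near M M (\<lambda>z. m (x, z)) y"
    by (rule smooth_near_compose[OF manifold manifold2 manifold px mult_smooth[OF x y]]
        smooth_near_compose[OF manifold manifold2 manifold py mult_smooth[OF x y]])+
qed

text \<open>The differential of \<open>m\<close> is the sum of its partial derivatives, which are the derivatives of \<open>m\<close> along
  \<open>z \<mapsto> (z, y)\<close> and \<open>z \<mapsto> (x, z)\<close>.\<close>

lemma chart_diff_mult:
  assumes x: "x \<in> points M" and y: "y \<in> points M"
    and c: "c \<in> atlas M" "x \<in> fst c" and d: "d \<in> atlas M" "y \<in> fst d"
    and e: "e \<in> atlas M" "m (x, y) \<in> fst e"
  shows "chart_diff (prod_manifold M M) M (prod_chart c d) e m (x, y) (v, w) =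
    chart_diff M M c e (\<lambda>z. m (z, y)) x v + chart_diff M M d e (\<lambda>z. m (x, z)) y w"
proof -
  let ?cd = "prod_chart c d"
  have cd: "?cd \<in> atlas (prod_manifold M M)" "(x, y) \<in> fst ?cd"
    using prod_chart_in_atlas[OF c(1) d(1)] c d by auto
  note i = smooth_near_ident[OF manifold] and k = smooth_near_const[OF manifold manifold]
  note mxy = mult_smooth[OF x y]
  have px: "smooth_near M (prod_manifold M M) (\<lambda>z. (z, y)) x"
    and py: "smooth_near M (prod_manifold M M) (\<lambda>z. (x, z)) y"
    by (intro smooth_near_Pair manifold i k x y)+
  have "chart_diff M M c e (\<lambda>z. m (z, y)) x v =
      chart_diff (prod_manifold M M) M ?cd e m (x, y) (v, 0)"
    using chart_diff_compose[OF manifold manifold2 manifold px mxy c(1) cd(1) e(1) c(2) cd(2) e(2), of v]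
      chart_diff_Pair[OF manifold manifold manifold i[OF x] k[OF x y] c(1) c(1) d(1) c(2) c(2) d(2), of v]
    by (simp add: chart_diff_ident[OF manifold c] chart_diff_const[OF manifold manifold x y])
  moreover have "chart_diff M M d e (\<lambda>z. m (x, z)) y w =
      chart_diff (prod_manifold M M) M ?cd e m (x, y) (0, w)"
    using chart_diff_compose[OF manifold manifold2 manifold py mxy d(1) cd(1) e(1) d(2) cd(2) e(2), of w]
      chart_diff_Pair[OF manifold manifold manifold k[OF y x] i[OF y] d(1) c(1) d(1) d(2) c(2) d(2), of w]
    by (simp add: chart_diff_ident[OF manifold d] chart_diff_const[OF manifold manifold y x])
  ultimately show ?thesis
    using chart_diff_add[OF manifold2 manifold mxy cd(1) e(1) cd(2) e(2), of "(v, 0)" "(0, w)"] by simp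
qed

lemma
  assumes f: "smooth_near M M f p" and g: "smooth_near M M g p"
  shows smooth_near_mult: "smooth_near M M (\<lambda>z. m (f z, g z)) p"
    and chart_diff_mult_compose: "chart_diff M M (\<kappa> p) (\<kappa> (m (f p, g p))) (\<lambda>z. m (f z, g z)) p v =
      R (g p) (f p) (chart_diff M M (\<kappa> p) (\<kappa> (f p)) f p v) +
      L (f p) (g p) (chart_diff M M (\<kappa> p) (\<kappa> (g p)) g p v)"
proof -
  have p: "p \<in> points M" "f p \<in> points M" "g p \<in> points M"
    using smooth_near_points[OF f] smooth_near_points[OF g] by auto
  note P = smooth_near_Pair[OF manifold manifold manifold f g] and mm = mult_smooth[OF p(2,3)]
  show "smooth_near M M (\<lambda>z. m (f z, g z)) p"
    by (rule smooth_near_compose[OF manifold manifold2 manifold P mm])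
  note kp = kappa[OF p(1)] and kf = kappa[OF p(2)] and kg = kappa[OF p(3)]
    and km = kappa[OF mult_closed[OF p(2,3)]]
  have cd: "prod_chart (\<kappa> (f p)) (\<kappa> (g p)) \<in> atlas (prod_manifold M M)"
    "(f p, g p) \<in> fst (prod_chart (\<kappa> (f p)) (\<kappa> (g p)))"
    using prod_chart_in_atlas[OF kf(1) kg(1)] kf kg by auto
  show "chart_diff M M (\<kappa> p) (\<kappa> (m (f p, g p))) (\<lambda>z. m (f z, g z)) p v =
      R (g p) (f p) (chart_diff M M (\<kappa> p) (\<kappa> (f p)) f p v) +
      L (f p) (g p) (chart_diff M M (\<kappa> p) (\<kappa> (g p)) g p v)"
    using chart_diff_compose[OF manifold manifold2 manifold P mm kp(1) cd(1) km(1) kp(2) cd(2) km(2), of v]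
    by (simp add: chart_diff_Pair[OF manifold manifold manifold f g kp(1) kf(1) kg(1) kp(2) kf(2) kg(2)]
        chart_diff_mult[OF p(2,3) kf kg km] R_def L_def)
qed

lemma
  assumes x: "x \<in> points M" and y: "y \<in> points M"
  shows R_minus: "R y x (- v) = - R y x v"
    and R_scale: "R y x (mscale M r v) = mscale M r (R y x v)"
    and L_scale: "L x y (mscale M r v) = mscale M r (L x y v)"
proof -
  note kx = kappa[OF x] and ky = kappa[OF y] and kxy = kappa[OF mult_closed[OF x y]]
  note r = manifold manifold smooth_near_mult_left[OF x y] kx(1) kxy(1) kx(2) kxy(2)
    and l = manifold manifold smooth_near_mult_right[OF x y] ky(1) kxy(1) ky(2) kxy(2)
  show "R y x (- v) = - R y x v" "R y x (mscale M r v) = mscale M r (R y x v)"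
    unfolding R_def by (rule chart_diff_minus[OF r] chart_diff_scale[OF r])+
  show "L x y (mscale M r v) = mscale M r (L x y v)"
    unfolding L_def by (rule chart_diff_scale[OF l])
qed

lemma chart_diff_cong_points:
  assumes "smooth_near M M f p" "\<And>q. q \<in> points M \<Longrightarrow> f q = g q"
  shows "chart_diff M M (\<kappa> p) (\<kappa> (f p)) f p v = chart_diff M M (\<kappa> p) (\<kappa> (g p)) g p v"
proof -
  have p: "p \<in> points M" "f p \<in> points M" using smooth_near_points[OF assms(1)] by auto
  have "chart_diff M M (\<kappa> p) (\<kappa> (f p)) g p v = chart_diff M M (\<kappa> p) (\<kappa> (f p)) f p v"
    by (rule chart_diff_cong[OF manifold manifold assms(1) openin_topspace p(1) assms(2)
          kappa(1)[OF p(1)] kappa(1)[OF p(2)] kappa(2)[OF p(1)] kappa(2)[OF p(2)]])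
  then show ?thesis using assms(2)[OF p(1)] by simp
qed

text \<open>Self-distributivity \<open>m(x, m(y, z)) = m(m(x, y), m(x, z))\<close>, differentiated with respect to \<open>x\<close>, which
  occurs twice on the right-hand side.\<close>

lemma R_mult:
  assumes x: "x \<in> points M" and y: "y \<in> points M" and z: "z \<in> points M"
  shows "R (m (y, z)) x v =
    R (m (x, z)) (m (x, y)) (R y x v) + L (m (x, y)) (m (x, z)) (R z x v)"
proof -
  note s = smooth_near_mult_left[OF x y] smooth_near_mult_left[OF x z]
  have "R (m (y, z)) x v =
      chart_diff M M (\<kappa> x) (\<kappa> (m (m (x, y), m (x, z)))) (\<lambda>a. m (m (a, y), m (a, z))) x v"
    unfolding R_def
    by (rule chart_diff_cong_points[OF smooth_near_mult_left[OF x mult_closed[OF y z]]])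
      (rule mult_distrib[OF _ y z])
  then show ?thesis
    using chart_diff_mult_compose[OF s] by (simp add: R_def)
qed

text \<open>The same law differentiated with respect to \<open>y\<close>.\<close>

lemma L_R:
  assumes x: "x \<in> points M" and y: "y \<in> points M" and z: "z \<in> points M"
  shows "L x (m (y, z)) (R z y w) = R (m (x, z)) (m (x, y)) (L x y w)"
proof -
  note yz = mult_closed[OF y z] and xy = mult_closed[OF x y] and xz = mult_closed[OF x z]
  note s = smooth_near_mult_left[OF y z] smooth_near_mult_right[OF x yz]
    and t = smooth_near_mult_right[OF x y] smooth_near_mult_left[OF xy xz]
  have "L x (m (y, z)) (R z y w) =
      chart_diff M M (\<kappa> y) (\<kappa> (m (x, m (y, z)))) (\<lambda>a. m (x, m (a, z))) y w"
    unfolding L_def R_def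
    using chart_diff_compose[OF manifold manifold manifold s kappa(1)[OF y] kappa(1)[OF yz]
        kappa(1)[OF mult_closed[OF x yz]] kappa(2)[OF y] kappa(2)[OF yz] kappa(2)[OF mult_closed[OF x yz]]]
    by simp
  also have "\<dots> = chart_diff M M (\<kappa> y) (\<kappa> (m (m (x, y), m (x, z)))) (\<lambda>a. m (m (x, a), m (x, z))) y w"
    by (rule chart_diff_cong_points[OF smooth_near_compose[OF manifold manifold manifold s]])
      (rule mult_distrib[OF x _ z])
  also have "\<dots> = R (m (x, z)) (m (x, y)) (L x y w)"
    unfolding L_def R_def
    using chart_diff_compose[OF manifold manifold manifold t kappa(1)[OF y] kappa(1)[OF xy]
        kappa(1)[OF mult_closed[OF xy xz]] kappa(2)[OF y] kappa(2)[OF xy] kappa(2)[OF mult_closed[OF xy xz]]]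
    by simp
  finally show ?thesis .
qed

lemma L_self:
  assumes x: "x \<in> points M"
  shows "L x x v = - v"
proof -
  note k = kappa[OF x]
  have "tangent_map M M (\<lambda>y. m (x, y)) (tangent_vector M (\<kappa> x) x v) =
      tminus M (tangent_vector M (\<kappa> x) x v)"
    using symm x tangent_vector_in_space[OF k] unfolding symmetric_space_def by blast
  also have "tangent_map M M (\<lambda>y. m (x, y)) (tangent_vector M (\<kappa> x) x v) = tangent_vector M (\<kappa> x) x (L x x v)"
    using tangent_map_tangent_vector[OF manifold manifold smooth_near_mult_right[OF x x] k, of "\<kappa> (m (x, x))"]
    by (simp add: mult_idem[OF x] k L_def)
  finally have "tcoord (\<kappa> x) (tangent_vector M (\<kappa> x) x (L x x v)) = tcoord (\<kappa> x) (tangent_vector M (\<kappa> x) x (- v))"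
    by (simp add: tminus_tangent_vector[OF manifold k])
  then show ?thesis
    by (simp add: tcoord_tangent_vector_self[OF manifold k])
qed

text \<open>The derivative of \<open>m(x, x) = x\<close>.\<close>

lemma R_self:
  assumes x: "x \<in> points M"
  shows "R x x v = v + v"
proof -
  note i = smooth_near_ident[OF manifold x]
  have "R x x v + L x x v = chart_diff M M (\<kappa> x) (\<kappa> (m (x, x))) (\<lambda>z. m (z, z)) x v"
    using chart_diff_mult_compose[OF i i] by (simp add: chart_diff_ident[OF manifold kappa[OF x]])
  also have "\<dots> = chart_diff M M (\<kappa> x) (\<kappa> x) (\<lambda>z. z) x v"
    by (rule chart_diff_cong_points[OF smooth_near_mult[OF i i]]) (rule mult_idem)
  finally show ?thesis
    by (simp add: chart_diff_ident[OF manifold kappa[OF x]] L_self[OF x] algebra_simps)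
qed

lemma tangent_mult_tangent_vector:
  assumes x: "x \<in> points M" and y: "y \<in> points M"
  shows "tangent_mult M m (tangent_vector M (\<kappa> x) x v, tangent_vector M (\<kappa> y) y w) =
    tangent_vector M (\<kappa> (m (x, y))) (m (x, y)) (R y x v + L x y w)"
proof -
  note kx = kappa[OF x] and ky = kappa[OF y] and kxy = kappa[OF mult_closed[OF x y]]
  have cd: "prod_chart (\<kappa> x) (\<kappa> y) \<in> atlas (prod_manifold M M)"
    "(x, y) \<in> fst (prod_chart (\<kappa> x) (\<kappa> y))"
    using prod_chart_in_atlas[OF kx(1) ky(1)] kx ky by auto
  have "tpair M M (tangent_vector M (\<kappa> x) x v, tangent_vector M (\<kappa> y) y w) =
      tangent_vector (prod_manifold M M) (prod_chart (\<kappa> x) (\<kappa> y)) (x, y) (v, w)"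
    by (simp add: tpair_def Let_def tcoord_tangent_vector_self[OF manifold kx]
        tcoord_tangent_vector_self[OF manifold ky])
  then show ?thesis
    by (simp add: tangent_mult_def chart_diff_mult[OF x y kx ky kxy] R_def L_def
        tangent_map_tangent_vector[OF manifold2 manifold mult_smooth[OF x y] cd kxy])
qed

end

section \<open>Smooth vector fields and their brackets\<close>

definition field_rep :: "('m, 'e) chart \<Rightarrow> ('m \<Rightarrow> ('m, 'e) tvec) \<Rightarrow> 'e \<Rightarrow> 'e"
  where "field_rep c X = (\<lambda>y. tcoord c (X (chart_inv c y)))"

lemma field_rep_chart:
  "smooth_manifold M \<Longrightarrow> c \<in> atlas M \<Longrightarrow> p \<in> fst c \<Longrightarrow> field_rep c X (snd c p) = tcoord c (X p)"
  by (simp add: field_rep_def chart_inv_chart)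

definition smooth_field ::
    "('m, 'e::{topological_ab_group_add,t2_space}, 'k::base_ring) manifold \<Rightarrow> ('m \<Rightarrow> ('m, 'e) tvec) \<Rightarrow> bool"
  where "smooth_field M X \<longleftrightarrow> (\<forall>p\<in>points M. X p \<in> tangent_space M p) \<and>
    (\<forall>c\<in>atlas M. \<forall>p\<in>fst c. smooth_at (mscale M) (mscale M) (field_rep c X) (snd c p))"

definition field_related ::
    "('m, 'e::{topological_ab_group_add,t2_space}, 'k::base_ring) manifold \<Rightarrow>
     ('n, 'f::{topological_ab_group_add,t2_space}, 'k) manifold \<Rightarrow> ('m \<Rightarrow> 'n) \<Rightarrow>
     ('m \<Rightarrow> ('m, 'e) tvec) \<Rightarrow> ('n \<Rightarrow> ('n, 'f) tvec) \<Rightarrow> bool"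
  where "field_related M N f X X' \<longleftrightarrow> (\<forall>p\<in>points M. tangent_map M N f (X p) = X' (f p))"

lemma smooth_field_space: "smooth_field M X \<Longrightarrow> p \<in> points M \<Longrightarrow> X p \<in> tangent_space M p"
  and smooth_field_rep: "smooth_field M X \<Longrightarrow> c \<in> atlas M \<Longrightarrow> p \<in> fst c \<Longrightarrow>
    smooth_at (mscale M) (mscale M) (field_rep c X) (snd c p)"
  unfolding smooth_field_def by blast+

lemma lie_bracket_alt:
  "lie_bracket M X Y p = tangent_vector M (chart_at M p) p
    (vbracket (mscale M) (field_rep (chart_at M p) X) (field_rep (chart_at M p) Y) (snd (chart_at M p) p))"
  by (simp add: lie_bracket_def Let_def vbracket_def field_rep_def)

text \<open>In coordinates, relatedness of fields is the hypothesis of \<open>vbracket_related\<close> for the coordinate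
  expression of \<open>f\<close>.\<close>

lemma vbracket_field_rep_related:
  assumes M: "smooth_manifold M" and N: "smooth_manifold N" and f: "smooth_map M N f"
    and X: "smooth_field M X" and Y: "smooth_field M Y"
    and X': "smooth_field N X'" and Y': "smooth_field N Y'"
    and XX': "field_related M N f X X'" and YY': "field_related M N f Y Y'"
    and c: "c \<in> atlas M" "p \<in> fst c" and d: "d \<in> atlas N" "f p \<in> fst d"
  shows "vbracket (mscale N) (field_rep d X') (field_rep d Y') (snd d (f p)) =
    chart_diff M N c d f p (vbracket (mscale M) (field_rep c X) (field_rep c Y) (snd c p))"
proof -
  note mM = smooth_manifold_module[OF M] and mN = smooth_manifold_module[OF N]
  have near: "smooth_near M N f q" if "q \<in> points M" for q
    using f that unfolding smooth_map_iff_near by blast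
  note fp = near[OF chart_points[OF M c]]
  from fp c(1) d(1) c(2) d(2) obtain W where W: "openin (mtop M) W" "p \<in> W" "W \<subseteq> fst c" "f ` W \<subseteq> fst d"
    "smooth_at (mscale M) (mscale N) (chart_rep c d f) (snd c p)" by (rule smooth_nearE)
  have rel: "field_rep d Z' (chart_rep c d f y) =
      differential (mscale M) (mscale N) (chart_rep c d f) y (field_rep c Z y)"
    if Z: "smooth_field M Z" and ZZ': "field_related M N f Z Z'" and y: "y \<in> snd c ` W" for Z Z' y
  proof -
    from y obtain q where q: "q \<in> W" and y: "y = snd c q" by (rule imageE)
    have qc: "q \<in> fst c" "f q \<in> fst d" using q W(3,4) by auto
    note qM = chart_points[OF M c(1) qc(1)]
    have "Z' (f q) = tangent_map M N f (tangent_vector M c q (tcoord c (Z q)))"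
      using ZZ' qM tangent_vector_tcoord[OF M c(1) qc(1) smooth_field_space[OF Z qM]]
      by (simp add: field_related_def)
    also have "\<dots> = tangent_vector N d (f q) (chart_diff M N c d f q (tcoord c (Z q)))"
      by (rule tangent_map_tangent_vector[OF M N near[OF qM] c(1) qc(1) d(1) qc(2)])
    finally show ?thesis
      by (simp add: y chart_rep_chart[OF M c(1) qc(1)] field_rep_chart[OF N d(1) qc(2)]
          field_rep_chart[OF M c(1) qc(1)] tcoord_tangent_vector_self[OF N d(1) qc(2)] chart_diff_def)
  qed
  have "smooth_at (mscale N) (mscale N) (field_rep d Z') (chart_rep c d f (snd c p))"
    if "smooth_field N Z'" for Z'
    using smooth_field_rep[OF that d] by (simp add: chart_rep_chart[OF M c])
  note Z' = this
  have im: "open (snd c ` W)" "snd c p \<in> snd c ` W"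
    using chart_image_open[OF M c(1) W(1,3)] W(2) by auto
  have "vbracket (mscale N) (field_rep d X') (field_rep d Y') (chart_rep c d f (snd c p)) =
      differential (mscale M) (mscale N) (chart_rep c d f) (snd c p)
        (vbracket (mscale M) (field_rep c X) (field_rep c Y) (snd c p))"
    by (rule vbracket_related[OF mM mN W(5) smooth_field_rep[OF X c] smooth_field_rep[OF Y c]
          Z'[OF X'] Z'[OF Y'] im rel[OF X XX'] rel[OF Y YY']])
  then show ?thesis
    by (simp add: chart_rep_chart[OF M c] chart_diff_def)
qed

text \<open>Transition functions relate the two coordinate expressions of a field, so the bracket may be
  computed in any chart.\<close>

lemma tcoord_lie_bracket:
  assumes M: "smooth_manifold M" and X: "smooth_field M X" and Y: "smooth_field M Y"
    and c: "c \<in> atlas M" "p \<in> fst c"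
  shows "tcoord c (lie_bracket M X Y p) =
    vbracket (mscale M) (field_rep c X) (field_rep c Y) (snd c p)"
proof -
  have i: "smooth_map M M (\<lambda>x. x)"
    unfolding smooth_map_iff_near using smooth_near_ident[OF M] by blast
  have rel: "field_related M M (\<lambda>x. x) Z Z" if Z: "smooth_field M Z" for Z
    unfolding field_related_def
  proof
    fix q assume q: "q \<in> points M"
    note k = smooth_manifold_chart_at[OF M q]
    have "tangent_map M M (\<lambda>x. x) (tangent_vector M (chart_at M q) q (tcoord (chart_at M q) (Z q))) =
        tangent_vector M (chart_at M q) q (tcoord (chart_at M q) (Z q))"
      by (simp add: tangent_map_tangent_vector[OF M M smooth_near_ident[OF M q] k k] chart_diff_ident[OF M k])
    then show "tangent_map M M (\<lambda>x. x) (Z q) = Z q"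
      by (simp add: tangent_vector_tcoord[OF M k smooth_field_space[OF Z q]])
  qed
  note k = smooth_manifold_chart_at[OF M chart_points[OF M c]]
  show ?thesis
    using vbracket_field_rep_related[OF M M i X Y X Y rel[OF X] rel[OF Y] k c]
    by (simp add: lie_bracket_alt tcoord_tangent_vector[OF c])
qed

lemma smooth_at_vbracket:
  assumes s: "continuous_module s" and X: "smooth_at s s X x" and Y: "smooth_at s s Y x"
  shows "smooth_at s s (vbracket s X Y) x"
proof -
  note ss = continuous_module_prod_scale[OF s s]
  have "smooth_at s s (\<lambda>y. differential s s A y (B y)) x"
    if A: "smooth_at s s A x" and B: "smooth_at s s B x" for A B
    using smooth_at_compose[OF s ss s smooth_at_Pair[OF s s s smooth_at_ident[OF s] B]
        smooth_at_differential[OF s s A]] by simp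
  from smooth_at_diff[OF s s this[OF Y X] this[OF X Y]]
  show ?thesis by (simp add: vbracket_def[abs_def])
qed

lemma lie_bracket_in_space:
  assumes "smooth_manifold M" "p \<in> points M"
  shows "lie_bracket M X Y p \<in> tangent_space M p"
  unfolding lie_bracket_alt by (rule tangent_vector_in_space[OF smooth_manifold_chart_at[OF assms]])

lemma smooth_field_lie_bracket:
  assumes M: "smooth_manifold M" and X: "smooth_field M X" and Y: "smooth_field M Y"
  shows "smooth_field M (lie_bracket M X Y)"
  unfolding smooth_field_def
proof (intro conjI ballI)
  fix c p assume c: "c \<in> atlas M" "p \<in> fst c"
  note m = smooth_manifold_module[OF M]
  have "smooth_at (mscale M) (mscale M) (vbracket (mscale M) (field_rep c X) (field_rep c Y)) (snd c p)"
    by (rule smooth_at_vbracket[OF m smooth_field_rep[OF X c] smooth_field_rep[OF Y c]])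
  then show "smooth_at (mscale M) (mscale M) (field_rep c (lie_bracket M X Y)) (snd c p)"
  proof (rule smooth_at_transform[OF m m _ chart_domain(4)[OF M c(1)]])
    fix y assume "y \<in> snd c ` fst c"
    then obtain q where q: "q \<in> fst c" and y: "y = snd c q" by blast
    show "vbracket (mscale M) (field_rep c X) (field_rep c Y) y = field_rep c (lie_bracket M X Y) y"
      by (simp add: y field_rep_chart[OF M c(1) q] tcoord_lie_bracket[OF M X Y c(1) q])
  qed (use c in simp)
qed (rule lie_bracket_in_space[OF M])

lemma field_related_lie_bracket:
  assumes M: "smooth_manifold M" and N: "smooth_manifold N" and f: "smooth_map M N f"
    and X: "smooth_field M X" and Y: "smooth_field M Y"
    and X': "smooth_field N X'" and Y': "smooth_field N Y'"
    and XX': "field_related M N f X X'" and YY': "field_related M N f Y Y'"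
  shows "field_related M N f (lie_bracket M X Y) (lie_bracket N X' Y')"
  unfolding field_related_def
proof
  fix p assume p: "p \<in> points M"
  then have near: "smooth_near M N f p"
    using f unfolding smooth_map_iff_near by blast
  then have fp: "f p \<in> points N" by (rule smooth_near_points[THEN conjunct2])
  note c = smooth_manifold_chart_at[OF M p] and d = smooth_manifold_chart_at[OF N fp]
  show "tangent_map M N f (lie_bracket M X Y p) = lie_bracket N X' Y' (f p)"
    by (simp add: lie_bracket_alt tangent_map_tangent_vector[OF M N near c d]
        vbracket_field_rep_related[OF M N f X Y X' Y' XX' YY' c d])
qed

text \<open>In the chart of the tangent bundle over \<open>e\<close> the coordinates of \<open>X q\<close> are those of \<open>q\<close> together with the
  coordinate expression of \<open>X\<close>.\<close>

lemma smooth_map_tangent_bundle: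
  assumes M: "smooth_manifold M" and X: "smooth_field M X"
  shows "smooth_map M (tangent_bundle M) X"
proof -
  note m = smooth_manifold_module[OF M]
  note mm = continuous_module_prod_scale[OF m m]
  have inT: "X q \<in> fst (tangent_chart M c)" if "c \<in> atlas M" "q \<in> fst c" for c q
    using that smooth_field_space[OF X chart_points[OF M that]] by (auto simp: tangent_chart_def)
  have fX: "fst (X q) = q" if "q \<in> points M" for q
    by (rule fst_tangent_space[OF smooth_field_space[OF X that]])
  have top: "X q \<in> points (tangent_bundle M)" if q: "q \<in> points M" for q
  proof -
    note k = smooth_manifold_chart_at[OF M q]
    have "{\<xi> \<in> fst (tangent_chart M (chart_at M q)). snd (tangent_chart M (chart_at M q)) \<xi> \<in> UNIV} \<in>
        {{\<xi> \<in> fst (tangent_chart M c). snd (tangent_chart M c) \<xi> \<in> S} | c S. c \<in> atlas M \<and> open S}"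
      using k(1) open_UNIV by blast
    then show ?thesis
      using inT[OF k] by (simp add: tangent_bundle_def) blast
  qed
  have "\<exists>W. openin (mtop M) W \<and> p \<in> W \<and> W \<subseteq> fst c \<and> X ` W \<subseteq> fst d \<and>
      smooth_on (mscale M) (mscale (tangent_bundle M)) (snd c ` W) (snd d \<circ> X \<circ> chart_inv c)"
    if p: "p \<in> points M" and c: "c \<in> atlas M" "p \<in> fst c"
      and d: "d \<in> atlas (tangent_bundle M)" "X p \<in> fst d" for p c d
  proof -
    from d(1) obtain e where e: "e \<in> atlas M" and de: "d = tangent_chart M e"
      by (auto simp: tangent_bundle_def)
    obtain q where "q \<in> fst e" "X p \<in> tangent_space M q"
      using d(2) by (auto simp: de tangent_chart_def)
    then have pe: "p \<in> fst e"
      using fst_tangent_space[of "X p" M q] fX[OF p] by simp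
    let ?W = "fst c \<inter> fst e"
    have W: "openin (mtop M) ?W" "?W \<subseteq> fst c"
      using chart_domain(1)[OF M c(1)] chart_domain(1)[OF M e] by auto
    let ?t = "chart_rep c e (\<lambda>x. x)"
    have t: "smooth_at (mscale M) (mscale M) ?t (snd c p)"
      by (rule smooth_at_transition[OF M c e pe])
    have "smooth_at (mscale M) (mscale M) (field_rep e X) (?t (snd c p))"
      using smooth_field_rep[OF X e pe] by (simp add: chart_rep_chart[OF M c])
    from smooth_at_Pair[OF m m m t smooth_at_compose[OF m m m t this]]
    obtain U where U: "open U" "snd c p \<in> U"
      "smooth_on (mscale M) (prod_scale (mscale M) (mscale M)) U (\<lambda>y. (?t y, field_rep e X (?t y)))"
      by (rule smooth_atE)
    let ?V = "?W \<inter> {q \<in> fst c. snd c q \<in> U}"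
    have V: "openin (mtop M) ?V" "p \<in> ?V" "?V \<subseteq> fst c"
      using openin_Int[OF W(1) chart_preimage_open[OF M c(1) U(1)]] c pe U(2) by auto
    have "smooth_on (mscale M) (prod_scale (mscale M) (mscale M)) (snd c ` ?V)
        (\<lambda>y. (?t y, field_rep e X (?t y)))"
      by (rule smooth_on_subset[OF m mm U(3) chart_image_open[OF M c(1) V(1,3)]]) auto
    then have "smooth_on (mscale M) (prod_scale (mscale M) (mscale M)) (snd c ` ?V) (snd d \<circ> X \<circ> chart_inv c)"
    proof (rule smooth_on_cong[OF m mm])
      fix y assume "y \<in> snd c ` ?V"
      then obtain q where q: "q \<in> ?V" and y: "y = snd c q" by (rule imageE)
      then have qc: "q \<in> fst c" "q \<in> fst e" by auto
      show "(?t y, field_rep e X (?t y)) = (snd d \<circ> X \<circ> chart_inv c) y"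
        by (simp add: y de tangent_chart_def chart_rep_chart[OF M c(1) qc(1)] chart_inv_chart[OF M c(1) qc(1)]
            field_rep_chart[OF M e qc(2)] fX[OF chart_points[OF M e qc(2)]])
    qed
    moreover have "X ` ?V \<subseteq> fst d"
      using inT[OF e] by (auto simp: de)
    ultimately show ?thesis
      using V by (auto simp: tangent_bundle_def)
  qed
  with top show ?thesis
    unfolding smooth_map_def by blast
qed

section \<open>The derivation with a given value at the base point\<close>

definition half :: "'k::base_ring"
  where "half = (SOME h. h + h = 1)"

lemma half_plus_half: "half + half = (1 :: 'k::base_ring)"
proof -
  have "(2 :: 'k) dvd 1" by (rule two_unit)
  then obtain h :: 'k where h: "1 = 2 * h" by (rule dvdE)
  have "h + h = 1" unfolding h by (rule mult_2 [symmetric])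
  then show ?thesis unfolding half_def by (rule someI)
qed

lemma (in continuous_module) half_scale_double: "scale half (x + x) = x"
  using scale_left_distrib[of half half x] by (simp add: scale_right_distrib half_plus_half)

lemma chart_diff_zero:
  assumes M: "smooth_manifold M" and N: "smooth_manifold N" and f: "smooth_near M N f p"
    and cd: "c \<in> atlas M" "d \<in> atlas N" "p \<in> fst c" "f p \<in> fst d"
  shows "chart_diff M N c d f p 0 = 0"
  using chart_diff_add[OF assms, of 0 0] by simp

context symm_space
begin

text \<open>This is \<open>p \<mapsto> 1/2 Tm(v, Tm(0\<^sub>b, 0\<^sub>p))\<close>: the inner vector is the zero vector at \<open>m(b, p)\<close>, and \<open>Tm(v, 0)\<close> is the
  partial derivative \<open>R\<close>. The result has its foot at \<open>m(b, m(b, p)) = p\<close>. Outside the manifold the value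
  is \<open>undefined\<close>, as in the definition of \<open>tilde\<close>.\<close>

definition tfield :: "'m \<Rightarrow> 'e \<Rightarrow> 'm \<Rightarrow> ('m, 'e) tvec"
  where "tfield b v = (\<lambda>p\<in>points M. tangent_vector M (\<kappa> p) p (mscale M half (R (m (b, p)) b v)))"

lemma tfield_in_space:
  "p \<in> points M \<Longrightarrow> tfield b v p \<in> tangent_space M p"
  by (simp add: tfield_def tangent_vector_in_space[OF kappa])

text \<open>In an arbitrary chart \<open>c\<close> at \<open>p\<close> and a fixed chart \<open>e\<close> near \<open>m(b, p)\<close> the coordinates are a value of the
  differential of the coordinate expression of \<open>m\<close>. The charts chosen separately at each \<open>p\<close>, which need
  not vary smoothly with \<open>p\<close>, have disappeared.\<close>

lemma tcoord_tfield:
  assumes b: "b \<in> points M" and c: "c \<in> atlas M" "p \<in> fst c" and e: "e \<in> atlas M" "m (b, p) \<in> fst e"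
  shows "tcoord c (tfield b v p) = mscale M half
    (differential (prod_scale (mscale M) (mscale M)) (mscale M) (chart_rep (prod_chart (\<kappa> b) e) c m)
      (snd (\<kappa> b) b, snd e (m (b, p))) (v, 0))"
proof -
  note p = chart_points[OF manifold c]
  note bp = mult_closed[OF b p] and kp = kappa[OF p] and kb = kappa[OF b]
  note inv = mult_invol[OF b p]
  note l = smooth_near_mult_left[OF b bp] and i = smooth_near_ident[OF manifold p]
  have i': "smooth_near M M (\<lambda>x. x) (m (b, m (b, p)))" using i by (simp add: inv)
  have c': "m (b, m (b, p)) \<in> fst c" "m (b, m (b, p)) \<in> fst (\<kappa> p)"
    using c kp by (simp_all add: inv)
  have "tcoord c (tfield b v p) =
      chart_diff M M (\<kappa> p) c (\<lambda>x. x) p (mscale M half (R (m (b, p)) b v))"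
    using p by (simp add: tfield_def tcoord_tangent_vector[OF c])
  also have "\<dots> = mscale M half (chart_diff M M (\<kappa> p) c (\<lambda>x. x) p (R (m (b, p)) b v))"
    by (rule chart_diff_scale[OF manifold manifold i kp(1) c(1) kp(2) c(2)])
  also have "chart_diff M M (\<kappa> p) c (\<lambda>x. x) p (R (m (b, p)) b v) =
      chart_diff M M (\<kappa> b) c (\<lambda>z. m (z, m (b, p))) b v"
    using chart_diff_compose[OF manifold manifold manifold l i' kb(1) kp(1) c(1) kb(2) c'(2) c'(1), of v]
    by (simp add: R_def inv)
  also have "\<dots> = chart_diff (prod_manifold M M) M (prod_chart (\<kappa> b) e) c m (b, m (b, p)) (v, 0)"
    using chart_diff_mult[OF b bp kb e c(1) c'(1), of v 0]
      chart_diff_zero[OF manifold manifold smooth_near_mult_right[OF b bp] e(1) c(1) e(2) c'(1)]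
    by simp
  finally show ?thesis by (simp add: chart_diff_def)
qed

text \<open>The right-hand side of \<open>tcoord_tfield\<close> is smooth in \<open>p\<close> and \<open>v\<close> together, because the differential of
  \<open>m\<close> is smooth in the point and the direction.\<close>

lemma smooth_at_tfield:
  assumes b: "b \<in> points M" and c: "c \<in> atlas M" "p \<in> fst c"
  shows "smooth_at (prod_scale (mscale M) (mscale M)) (mscale M)
    (\<lambda>z. field_rep c (tfield b (snd z)) (fst z)) (snd c p, v)"
proof -
  note s = smooth_manifold_module[OF manifold]
  note ss = continuous_module_prod_scale[OF s s]
  note s4 = continuous_module_prod_scale[OF ss ss]
  note p = chart_points[OF manifold c]
  note bp = mult_closed[OF b p] and kb = kappa[OF b]
  let ?s = "mscale M"
  let ?e = "\<kappa> (m (b, p))"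
  note e = kappa[OF bp]
  let ?F = "chart_rep (prod_chart (\<kappa> b) ?e) c m" and ?r = "chart_rep c ?e (\<lambda>q. m (b, q))"
  have r: "smooth_at ?s ?s ?r (snd c p)"
    by (rule smooth_near_smooth_at[OF smooth_near_mult_right[OF b p] c(1) e(1) c(2) e(2)])
  have rp: "?r (snd c p) = snd ?e (m (b, p))"
    by (rule chart_rep_chart[OF manifold c])
  have be: "prod_chart (\<kappa> b) ?e \<in> atlas (prod_manifold M M)"
    "(b, m (b, p)) \<in> fst (prod_chart (\<kappa> b) ?e)"
    using prod_chart_in_atlas[OF kb(1) e(1)] kb e by auto
  have F: "smooth_at (prod_scale ?s ?s) ?s ?F (snd (\<kappa> b) b, ?r (snd c p))"
    using smooth_near_smooth_at[OF mult_smooth[OF b bp] be(1) c(1) be(2)] c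
    by (simp add: mult_invol[OF b p] rp)
  let ?H = "\<lambda>z. ((snd (\<kappa> b) b, ?r (fst z)), (snd z, 0))"
  have r1: "smooth_at (prod_scale ?s ?s) ?s (\<lambda>z. ?r (fst z)) (snd c p, v)"
    by (rule smooth_at_compose[OF ss s s smooth_at_fst[OF s s]]) (simp add: r)
  have H: "smooth_at (prod_scale ?s ?s) (prod_scale (prod_scale ?s ?s) (prod_scale ?s ?s)) ?H (snd c p, v)"
    by (intro smooth_at_Pair[OF ss ss ss] smooth_at_Pair[OF ss s s] smooth_at_const[OF ss s]
        smooth_at_snd[OF s s] r1)
  have "smooth_at (prod_scale (prod_scale ?s ?s) (prod_scale ?s ?s)) ?s
      (\<lambda>w. differential (prod_scale ?s ?s) ?s ?F (fst w) (snd w)) (?H (snd c p, v))"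
    by (simp add: smooth_at_differential[OF ss s F])
  from smooth_at_scale[OF ss s smooth_at_compose[OF ss s4 s H this], of half]
  have sm: "smooth_at (prod_scale ?s ?s) ?s
      (\<lambda>z. ?s half (differential (prod_scale ?s ?s) ?s ?F (snd (\<kappa> b) b, ?r (fst z)) (snd z, 0))) (snd c p, v)"
    by simp
  from smooth_near_mult_right[OF b p] chart_domain(1)[OF manifold e(1)] e(2)
  obtain W where W: "openin (mtop M) W" "p \<in> W" "(\<lambda>q. m (b, q)) ` W \<subseteq> fst ?e"
    by (rule smooth_near_continuous[OF manifold manifold])
  let ?W = "W \<inter> fst c"
  have "open (snd c ` ?W)"
    using chart_image_open[OF manifold c(1) openin_Int[OF W(1) chart_domain(1)[OF manifold c(1)]]] by simp
  then have o: "open (snd c ` ?W \<times> (UNIV :: 'e set))" "(snd c p, v) \<in> snd c ` ?W \<times> UNIV"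
    using W(2) c by (auto intro!: open_Times)
  show ?thesis
  proof (rule smooth_at_transform[OF ss s sm o])
    fix z assume "z \<in> snd c ` ?W \<times> (UNIV :: 'e set)"
    then obtain q w where q: "q \<in> W" "q \<in> fst c" and z: "z = (snd c q, w)" by auto
    have "m (b, q) \<in> fst ?e" using q W(3) by auto
    from tcoord_tfield[OF b c(1) q(2) e(1) this, of w]
    show "?s half (differential (prod_scale ?s ?s) ?s ?F (snd (\<kappa> b) b, ?r (fst z)) (snd z, 0)) =
        field_rep c (tfield b (snd z)) (fst z)"
      by (simp add: z field_rep_chart[OF manifold c(1) q(2)] chart_rep_chart[OF manifold c(1) q(2)])
  qed
qed

lemma smooth_field_tfield:
  assumes b: "b \<in> points M"
  shows "smooth_field M (tfield b v)"
  unfolding smooth_field_def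
proof (intro conjI ballI)
  fix c p assume c: "c \<in> atlas M" "p \<in> fst c"
  note s = smooth_manifold_module[OF manifold]
  note ss = continuous_module_prod_scale[OF s s]
  have "smooth_at (mscale M) (prod_scale (mscale M) (mscale M)) (\<lambda>y. (y, v)) (snd c p)"
    by (rule smooth_at_Pair[OF s s s smooth_at_ident[OF s] smooth_at_const[OF s s]])
  from smooth_at_compose[OF s ss s this smooth_at_tfield[OF b c]]
  show "smooth_at (mscale M) (mscale M) (field_rep c (tfield b v)) (snd c p)" by simp
qed (rule tfield_in_space)

text \<open>With \<open>x = m(b, x')\<close> and \<open>y = m(b, y')\<close> this is \<open>R_mult\<close> at \<open>b\<close>, \<open>x'\<close>, \<open>y'\<close>.\<close>

lemma tfield_mult:
  assumes b: "b \<in> points M" and x: "x \<in> points M" and y: "y \<in> points M"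
  shows "tfield b v (m (x, y)) = tangent_mult M m (tfield b v x, tfield b v y)"
proof -
  interpret continuous_module "mscale M" by (rule smooth_manifold_module[OF manifold])
  let ?x = "m (b, x)" and ?y = "m (b, y)"
  note x' = mult_closed[OF b x] and y' = mult_closed[OF b y]
  have "R (m (b, m (x, y))) b v = R (m (?x, ?y)) b v"
    by (simp add: mult_distrib[OF b x y])
  also have "\<dots> = R y x (R ?x b v) + L x y (R ?y b v)"
    using R_mult[OF b x' y'] by (simp add: mult_invol[OF b x] mult_invol[OF b y])
  finally show ?thesis
    by (simp add: tfield_def x y mult_closed[OF x y] tangent_mult_tangent_vector[OF x y]
        R_scale[OF x y] L_scale[OF x y] scale_right_distrib)
qed

lemma derivation_tfield:
  assumes "b \<in> points M"
  shows "derivation M m (tfield b v)"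
  unfolding derivation_def symmetric_hom_def
  using assms tfield_in_space tfield_mult
    smooth_map_tangent_bundle[OF manifold smooth_field_tfield[OF assms]] by blast

text \<open>The factor \<open>1/2\<close> in \<open>tfield\<close> compensates \<open>R = 2\<close> at the diagonal.\<close>

lemma tfield_base:
  assumes b: "b \<in> points M"
  shows "tfield b v b = tangent_vector M (\<kappa> b) b v"
proof -
  interpret continuous_module "mscale M" by (rule smooth_manifold_module[OF manifold])
  show ?thesis
    by (simp add: tfield_def b mult_idem[OF b] R_self[OF b] half_scale_double)
qed

lemma tangent_map_symmetry:
  assumes b: "b \<in> points M" and p: "p \<in> points M"
  shows "tangent_map M M (\<lambda>y. m (b, y)) (tangent_vector M (\<kappa> (m (b, p))) (m (b, p)) v) =
    tangent_vector M (\<kappa> p) p (L b (m (b, p)) v)"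
proof -
  note bp = mult_closed[OF b p]
  have "m (b, m (b, p)) \<in> fst (\<kappa> p)"
    using kappa(2)[OF p] by (simp add: mult_invol[OF b p])
  from tangent_map_tangent_vector[OF manifold manifold smooth_near_mult_right[OF b bp] kappa[OF bp] kappa(1)[OF p] this]
  show ?thesis by (simp add: L_def mult_invol[OF b p])
qed

text \<open>By \<open>L_R\<close>, the symmetry at \<open>b\<close> carries \<open>R p b v\<close> to \<open>R (m (b, p)) b\<close> applied to the image of \<open>v\<close> under the
  symmetry, which is \<open>- v\<close>.\<close>

lemma tfield_symmetry:
  assumes b: "b \<in> points M" and p: "p \<in> points M"
  shows "tangent_map M M (\<lambda>y. m (b, y)) (tfield b v (m (b, p))) = tminus M (tfield b v p)"
proof -
  interpret continuous_module "mscale M" by (rule smooth_manifold_module[OF manifold])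
  note bp = mult_closed[OF b p]
  have "tfield b v (m (b, p)) = tangent_vector M (\<kappa> (m (b, p))) (m (b, p)) (mscale M half (R p b v))"
    by (simp add: tfield_def bp mult_invol[OF b p])
  then have "tangent_map M M (\<lambda>y. m (b, y)) (tfield b v (m (b, p))) =
      tangent_vector M (\<kappa> p) p (mscale M half (L b (m (b, p)) (R p b v)))"
    by (simp add: tangent_map_symmetry[OF b p] L_scale[OF b bp])
  also have "L b (m (b, p)) (R p b v) = - R (m (b, p)) b v"
    using L_R[OF b b p] by (simp add: mult_idem[OF b] L_self[OF b] R_minus[OF b bp])
  finally show ?thesis
    by (simp add: tfield_def p tminus_tangent_vector[OF manifold kappa[OF p]])
qed

text \<open>A derivation \<open>X\<close> satisfies \<open>X p = Tm(X b, X p')\<close> with \<open>p' = m(b, p)\<close>, the sum of the derivative of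
  \<open>x \<mapsto> m(x, p')\<close> in the direction \<open>X b\<close> and of \<open>T\<sigma>\<^sub>b (X p') = - X p\<close>. Hence \<open>2 X p\<close> is determined by
  \<open>X b\<close>.\<close>

lemma derivation_unique:
  assumes b: "b \<in> points M" and X: "X \<in> extensional (points M)" and D: "derivation M m X"
    and sym: "\<And>p. p \<in> points M \<Longrightarrow> tangent_map M M (\<lambda>y. m (b, y)) (X (m (b, p))) = tminus M (X p)"
    and Xb: "X b = tangent_vector M (\<kappa> b) b v"
  shows "X = tfield b v"
proof (rule extensionalityI[OF X])
  show "tfield b v \<in> extensional (points M)" by (simp add: tfield_def)
next
  interpret continuous_module "mscale M" by (rule smooth_manifold_module[OF manifold])
  fix p assume p: "p \<in> points M"
  let ?p = "m (b, p)"
  note bp = mult_closed[OF b p] and kp = kappa[OF p]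
  have T: "X q \<in> tangent_space M q" if "q \<in> points M" for q
    using D that by (simp add: derivation_def)
  define a where "a = tcoord (\<kappa> p) (X p)"
  define a' where "a' = tcoord (\<kappa> ?p) (X ?p)"
  have a: "X p = tangent_vector M (\<kappa> p) p a" and a': "X ?p = tangent_vector M (\<kappa> ?p) ?p a'"
    unfolding a_def a'_def
    using tangent_vector_tcoord[OF manifold kp T[OF p]] tangent_vector_tcoord[OF manifold kappa[OF bp] T[OF bp]]
    by simp_all
  have "X (m (b, ?p)) = tangent_mult M m (X b, X ?p)"
    using D b bp by (simp add: derivation_def symmetric_hom_def)
  then have "tangent_vector M (\<kappa> p) p a = tangent_vector M (\<kappa> p) p (R ?p b v + L b ?p a')"
    using a by (simp add: mult_invol[OF b p] Xb a' tangent_mult_tangent_vector[OF b bp])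
  then have 1: "a = R ?p b v + L b ?p a'"
    by (metis tcoord_tangent_vector_self[OF manifold kp])
  have "tangent_vector M (\<kappa> p) p (L b ?p a') = tangent_vector M (\<kappa> p) p (- a)"
    using sym[OF p] by (simp add: a a' tangent_map_symmetry[OF b p] tminus_tangent_vector[OF manifold kp])
  then have 2: "L b ?p a' = - a"
    by (metis tcoord_tangent_vector_self[OF manifold kp])
  have "a + a = R ?p b v" using 1 2 by (simp add: algebra_simps)
  then have "a = mscale M half (R ?p b v)"
    using half_scale_double[of a] by simp
  then show "X p = tfield b v p"
    by (simp add: a tfield_def p)
qed

lemma tilde_eq_tfield:
  assumes b: "b \<in> points M"
  shows "tilde M m b (tangent_vector M (\<kappa> b) b v) = tfield b v"
  unfolding tilde_def
proof (rule the_equality)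
  show "tfield b v \<in> extensional (points M) \<and> derivation M m (tfield b v) \<and>
      (\<forall>p\<in>points M. tangent_map M M (\<lambda>y. m (b, y)) (tfield b v (m (b, p))) = tminus M (tfield b v p)) \<and>
      tfield b v b = tangent_vector M (\<kappa> b) b v"
    using derivation_tfield[OF b] tfield_symmetry[OF b] tfield_base[OF b] by (auto simp: tfield_def)
qed (use derivation_unique[OF b] in blast)

end

section \<open>The tangent space at a point as a topological space\<close>

text \<open>The coordinates in any one chart identify the tangent space with the model space, topology
  included. A chart of the tangent bundle over a domain that does not contain \<open>p\<close> meets no tangent
  vector at \<open>p\<close>; over a domain that contains \<open>p\<close> it is a continuous linear change of coordinates.\<close>

lemma
  assumes M: "smooth_manifold M" and c: "c \<in> atlas M" "p \<in> fst c"
  defines "T \<equiv> subtopology (mtop (tangent_bundle M)) (tangent_space M p)"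
  shows continuous_map_tcoord: "continuous_map T euclidean (tcoord c)"
    and continuous_map_tangent_vector: "continuous_map euclidean T (tangent_vector M c p)"
    and topspace_tangent_space: "topspace T = tangent_space M p"
proof -
  let ?gen = "\<lambda>c S. {\<xi> \<in> fst (tangent_chart M c). snd (tangent_chart M c) \<xi> \<in> S}"
  let ?G = "{?gen c S | c S. c \<in> atlas M \<and> open S}"
  have top: "mtop (tangent_bundle M) = topology_generated_by ?G"
    by (simp add: tangent_bundle_def)
  have in_chart: "\<xi> \<in> fst (tangent_chart M d)" if "\<xi> \<in> tangent_space M p" "p \<in> fst d" for \<xi> d
    using that by (auto simp: tangent_chart_def)
  have chart_val: "snd (tangent_chart M d) \<xi> = (snd d p, tcoord d \<xi>)" if "\<xi> \<in> tangent_space M p" for \<xi> d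
    by (simp add: tangent_chart_def fst_tangent_space[OF that])
  have gen_open: "openin (mtop (tangent_bundle M)) (?gen c S)" if "open S" for S
    unfolding top using that c(1) by (intro topology_generated_by_Basis) blast
  have sub: "tangent_space M p \<subseteq> points (tangent_bundle M)"
    using in_chart[OF _ c(2)] openin_subset[OF gen_open[OF open_UNIV]] by auto
  then show T: "topspace T = tangent_space M p"
    by (auto simp: T_def)
  show "continuous_map T euclidean (tcoord c)"
    unfolding continuous_map_def
  proof (intro conjI allI impI)
    fix S :: "'b set" assume "openin euclidean S"
    then have "open (UNIV \<times> S :: ('b \<times> 'b) set)" by (simp add: open_Times)
    from gen_open[OF this] have "openin T (?gen c (UNIV \<times> S) \<inter> tangent_space M p)"
      unfolding T_def openin_subtopology by blast
    also have "?gen c (UNIV \<times> S) \<inter> tangent_space M p = {\<xi> \<in> topspace T. tcoord c \<xi> \<in> S}"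
      using in_chart[OF _ c(2)] chart_val[of _ c] by (auto simp: T)
    finally show "openin T {\<xi> \<in> topspace T. tcoord c \<xi> \<in> S}" .
  qed simp
  have tv: "tangent_vector M c p v \<in> tangent_space M p" for v
    by (rule tangent_vector_in_space[OF c])
  show "continuous_map euclidean T (tangent_vector M c p)"
    unfolding T_def continuous_map_in_subtopology top continuous_on_generated_topo_iff
  proof (intro conjI allI impI)
    fix U assume "U \<in> ?G"
    then obtain d S where d: "d \<in> atlas M" and S: "open S" and U: "U = ?gen d S" by blast
    show "openin euclidean (tangent_vector M c p -` U \<inter> topspace euclidean)"
    proof (cases "p \<in> fst d")
      case True
      have "tangent_vector M c p -` U \<inter> topspace euclidean = (\<lambda>v. (snd d p, chart_diff M M c d (\<lambda>x. x) p v)) -` S"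
        using in_chart[OF tv True] chart_val[OF tv] by (auto simp: U tcoord_tangent_vector[OF d True])
      moreover have "continuous_on UNIV (\<lambda>v. chart_diff M M c d (\<lambda>x. x) p v)"
        unfolding chart_diff_def
        by (rule continuous_on_differential[OF smooth_manifold_module[OF M] smooth_manifold_module[OF M]
              smooth_at_transition[OF M c d True]])
      ultimately show ?thesis
        using S by (simp add: open_vimage continuous_on_Pair)
    next
      case False
      have "tangent_vector M c p v \<notin> U" for v
      proof
        assume "tangent_vector M c p v \<in> U"
        then obtain q where "q \<in> fst d" "tangent_vector M c p v \<in> tangent_space M q"
          by (auto simp: U tangent_chart_def)
        then show False using False fst_tangent_space[of "tangent_vector M c p v" M q] by simp
      qed
      then have "tangent_vector M c p -` U \<inter> topspace euclidean = {}" by blast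
      then show ?thesis by simp
    qed
  next
    show "tangent_vector M c p ` topspace euclidean \<subseteq> \<Union> ?G"
      using tv sub unfolding top topology_generated_by_topspace by blast
  qed (use tv in auto)
qed

section \<open>Continuity of the triple bracket\<close>

context symm_space
begin

text \<open>In the chart at \<open>b\<close> the field with value \<open>v\<close> at \<open>b\<close> is \<open>y \<mapsto> A (y, v)\<close>, where \<open>A\<close> is smooth in both
  variables together. Both brackets are differential expressions in \<open>A\<close>, so their values depend
  smoothly on the vectors.\<close>

lemma triple_bracket_continuous:
  assumes b: "b \<in> points M"
  obtains H :: "'e \<times> 'e \<times> 'e \<Rightarrow> 'e" where "continuous_on UNIV H"
    "\<And>u v w. lie_bracket M (lie_bracket M (tfield b u) (tfield b v)) (tfield b w) b =
      tangent_vector M (\<kappa> b) b (H (u, v, w))"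
proof -
  note s = smooth_manifold_module[OF manifold]
  note ss = continuous_module_prod_scale[OF s s]
  note s3 = continuous_module_prod_scale[OF s ss]
  note s4 = continuous_module_prod_scale[OF ss ss]
  note s6 = continuous_module_prod_scale[OF s3 s3]
  let ?s = "mscale M"
  let ?ss = "prod_scale ?s ?s" and ?s3 = "prod_scale ?s (prod_scale ?s ?s)"
  let ?c = "\<kappa> b" and ?x = "snd (\<kappa> b) b"
  note c = kappa[OF b]
  note fld = smooth_field_tfield[OF b]
  define A where "A z = field_rep ?c (tfield b (snd z)) (fst z)" for z
  \<comment> \<open>\<open>G (y, u, v)\<close> is the coordinate expression at \<open>y\<close> of the bracket of the fields of \<open>u\<close> and \<open>v\<close>; \<open>H\<close> is
    the bracket of \<open>G (\<cdot>, u, v)\<close> with \<open>A (\<cdot>, w)\<close> at the base point. Only the derivatives of \<open>A\<close> and \<open>G\<close> in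
    the direction of the point occur, whence the zeros.\<close>
  define DA where "DA z = differential ?ss ?s A (fst z) (snd z)" for z
  define G where "G z = DA ((fst z, snd (snd z)), (A (fst z, fst (snd z)), 0)) -
      DA ((fst z, fst (snd z)), (A (fst z, snd (snd z)), 0))" for z
  define DG where "DG z = differential ?s3 ?s G (fst z) (snd z)" for z
  define H where "H z = DA ((?x, snd (snd z)), (G (?x, (fst z, fst (snd z))), 0)) -
      DG ((?x, (fst z, fst (snd z))), (A (?x, snd (snd z)), 0))" for z

  have A: "smooth_at ?ss ?s A (snd ?c q, v)" if "q \<in> fst ?c" for q v
    using smooth_at_tfield[OF b c(1) that] by (simp add: A_def[abs_def])
  have DA: "smooth_at (prod_scale ?ss ?ss) ?s DA ((snd ?c q, v), w)" if "q \<in> fst ?c" for q v w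
    unfolding DA_def[abs_def] by (rule smooth_at_differential[OF ss s A[OF that]])
  have dA: "differential ?s ?s (field_rep ?c (tfield b v)) (snd ?c q) w = DA ((snd ?c q, v), (w, 0))"
    if "q \<in> fst ?c" for q v w
    using differential_partial_left[OF s s s A[OF that], of v w] by (simp add: A_def DA_def)

  \<comment> \<open>Both terms of \<open>G\<close> have this form, with projections for \<open>i\<close> and \<open>j\<close>.\<close>
  have DA_along: "smooth_at ?s3 ?s (\<lambda>z. DA ((fst z, j (snd z)), (A (fst z, i (snd z)), 0))) (snd ?c q, uv)"
    if q: "q \<in> fst ?c" and i: "smooth_at ?ss ?s i uv" and j: "smooth_at ?ss ?s j uv" for q i j uv
  proof -
    have p: "smooth_at ?s3 ?ss (\<lambda>z. (fst z, h (snd z))) (snd ?c q, uv)"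
      if h: "smooth_at ?ss ?s h uv" for h
    proof -
      have "smooth_at ?ss ?s h (snd (snd ?c q, uv))" using h by simp
      from smooth_at_Pair[OF s3 s s smooth_at_fst[OF s ss] smooth_at_compose[OF s3 ss s smooth_at_snd[OF s ss] this]]
      show ?thesis .
    qed
    have "smooth_at ?ss ?s A ((\<lambda>z. (fst z, i (snd z))) (snd ?c q, uv))"
      using A[OF q] by simp
    note smooth_at_compose[OF s3 ss s p[OF i] this]
    note smooth_at_Pair[OF s3 ss ss p[OF j] smooth_at_Pair[OF s3 s s this smooth_at_const[OF s3 s, of 0]]]
    moreover have "smooth_at (prod_scale ?ss ?ss) ?s DA
        ((\<lambda>z. ((fst z, j (snd z)), (A (fst z, i (snd z)), 0))) (snd ?c q, uv))"
      using DA[OF q] by simp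
    ultimately show ?thesis
      by (rule smooth_at_compose[OF s3 s4 s])
  qed
  have G: "smooth_at ?s3 ?s G (snd ?c q, uv)" if "q \<in> fst ?c" for q uv
    unfolding G_def[abs_def]
    by (intro smooth_at_diff[OF s3 s] DA_along[OF that] smooth_at_fst[OF s s] smooth_at_snd[OF s s])
  have DG: "smooth_at (prod_scale ?s3 ?s3) ?s DG ((snd ?c q, uv), w)" if "q \<in> fst ?c" for q uv w
    unfolding DG_def[abs_def] by (rule smooth_at_differential[OF s3 s G[OF that]])

  have brG: "field_rep ?c (lie_bracket M (tfield b u) (tfield b v)) (snd ?c q) = G (snd ?c q, (u, v))"
    if q: "q \<in> fst ?c" for q u v
    by (simp add: field_rep_chart[OF manifold c(1) q] tcoord_lie_bracket[OF manifold fld fld c(1) q]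
        vbracket_def dA[OF q]) (simp add: G_def A_def field_rep_chart[OF manifold c(1) q])
  have dG: "differential ?s ?s (field_rep ?c (lie_bracket M (tfield b u) (tfield b v))) ?x w =
      DG ((?x, (u, v)), (w, 0))" for u v w
  proof -
    have P: "smooth_at ?s ?s3 (\<lambda>y. (y, (u, v))) ?x"
      by (rule smooth_at_Pair[OF s s ss smooth_at_ident[OF s] smooth_at_const[OF s ss]])
    have "smooth_at ?s ?s (\<lambda>y. G (y, (u, v))) ?x"
      by (rule smooth_at_compose[OF s s3 s P]) (rule G[OF c(2)])
    then have "differential ?s ?s (field_rep ?c (lie_bracket M (tfield b u) (tfield b v))) ?x w =
        differential ?s ?s (\<lambda>y. G (y, (u, v))) ?x w"
    proof (rule differential_transform[OF s s _ chart_domain(4)[OF manifold c(1)]])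
      fix y assume "y \<in> snd ?c ` fst ?c"
      then obtain q where "q \<in> fst ?c" and y: "y = snd ?c q" by (rule imageE)
      then show "G (y, (u, v)) = field_rep ?c (lie_bracket M (tfield b u) (tfield b v)) y"
        using brG by simp
    qed (use c in simp)
    then show ?thesis
      using differential_partial_left[OF s ss s G[OF c(2)], of "(u, v)" w] by (simp add: DG_def)
  qed

  have "smooth_at ?s3 ?s H z" for z
  proof -
    have uv: "smooth_at ?s3 ?ss (\<lambda>z. (fst z, fst (snd z))) z"
      by (intro smooth_at_linear[OF s3 ss])
        (auto intro!: continuous_intros simp: prod_scale_def)
    have w: "smooth_at ?s3 ?s (\<lambda>z. snd (snd z)) z"
      by (intro smooth_at_linear[OF s3 s]) (auto intro!: continuous_intros simp: prod_scale_def)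
    have k: "smooth_at ?s3 ?s (\<lambda>z. a) z" for a
      by (rule smooth_at_const[OF s3 s])
    have xuv: "smooth_at ?s3 ?s3 (\<lambda>z. (?x, (fst z, fst (snd z)))) z"
      by (rule smooth_at_Pair[OF s3 s ss k uv])
    have xw: "smooth_at ?s3 ?ss (\<lambda>z. (?x, snd (snd z))) z"
      by (rule smooth_at_Pair[OF s3 s s k w])
    have "smooth_at ?s3 ?s (\<lambda>z. G (?x, (fst z, fst (snd z)))) z"
      by (rule smooth_at_compose[OF s3 s3 s xuv G[OF c(2)]])
    note smooth_at_Pair[OF s3 ss ss xw smooth_at_Pair[OF s3 s s this k]]
    from smooth_at_compose[OF s3 s4 s this DA[OF c(2)]]
    have 1: "smooth_at ?s3 ?s (\<lambda>z. DA ((?x, snd (snd z)), (G (?x, (fst z, fst (snd z))), 0))) z" .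
    have "smooth_at ?s3 ?s (\<lambda>z. A (?x, snd (snd z))) z"
      by (rule smooth_at_compose[OF s3 ss s xw A[OF c(2)]])
    note smooth_at_Pair[OF s3 s3 s3 xuv smooth_at_Pair[OF s3 s ss this smooth_at_const[OF s3 ss, of 0]]]
    from smooth_at_compose[OF s3 s6 s this DG[OF c(2)]]
    have 2: "smooth_at ?s3 ?s (\<lambda>z. DG ((?x, (fst z, fst (snd z))), (A (?x, snd (snd z)), 0))) z" .
    show ?thesis
      unfolding H_def[abs_def] by (rule smooth_at_diff[OF s3 s 1 2])
  qed
  then have "continuous_on UNIV H"
    by (rule continuous_on_UNIV_if_smooth_at[OF s3 s])
  moreover have "lie_bracket M (lie_bracket M (tfield b u) (tfield b v)) (tfield b w) b =
      tangent_vector M (\<kappa> b) b (H (u, v, w))" for u v w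
    by (simp add: lie_bracket_alt[of M "lie_bracket M (tfield b u) (tfield b v)"] vbracket_def
        dA[OF c(2)] dG brG[OF c(2)]) (simp add: H_def A_def)
  ultimately show thesis by (rule that)
qed

lemma assoc_lts_bracket:
  assumes b: "b \<in> points M"
    and "u \<in> tangent_space M b" "v \<in> tangent_space M b" "w \<in> tangent_space M b"
  shows "lbracket (assoc_lts M m b) u v w =
    lie_bracket M (lie_bracket M (tfield b (tcoord (\<kappa> b) u)) (tfield b (tcoord (\<kappa> b) v)))
      (tfield b (tcoord (\<kappa> b) w)) b"
proof -
  have "tilde M m b \<xi> = tfield b (tcoord (\<kappa> b) \<xi>)" if "\<xi> \<in> tangent_space M b" for \<xi>
    using tilde_eq_tfield[OF b, of "tcoord (\<kappa> b) \<xi>"] tangent_vector_tcoord[OF manifold kappa[OF b] that]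
    by simp
  with assms show ?thesis by (simp add: assoc_lts_def)
qed

lemma continuous_map_assoc_lts_bracket:
  assumes b: "b \<in> points M"
  defines "T \<equiv> subtopology (mtop (tangent_bundle M)) (tangent_space M b)"
  shows "continuous_map (prod_topology T (prod_topology T T)) T
    (\<lambda>(u, v, w). lbracket (assoc_lts M m b) u v w)"
proof -
  let ?T3 = "prod_topology T (prod_topology T T)" and ?t = "tcoord (\<kappa> b)"
  note c = kappa[OF b]
  obtain H :: "'e \<times> 'e \<times> 'e \<Rightarrow> 'e" where H: "continuous_on UNIV H"
    and br: "\<And>u v w. lie_bracket M (lie_bracket M (tfield b u) (tfield b v)) (tfield b w) b =
      tangent_vector M (\<kappa> b) b (H (u, v, w))"
    by (rule triple_bracket_continuous[OF b]) (rule that)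
  have t: "continuous_map T euclidean ?t"
    unfolding T_def by (rule continuous_map_tcoord[OF manifold c])
  note comp = continuous_map_compose[OF _ t, unfolded o_def]
  have "continuous_map ?T3 (prod_topology euclidean (prod_topology euclidean euclidean))
      (\<lambda>z. (?t (fst z), (?t (fst (snd z)), ?t (snd (snd z)))))"
    by (intro continuous_map_pairedI comp continuous_map_fst continuous_map_fst_of[unfolded o_def]
        continuous_map_snd_of[unfolded o_def] continuous_map_fst continuous_map_snd
        continuous_map_compose[OF continuous_map_snd continuous_map_fst, unfolded o_def]
        continuous_map_compose[OF continuous_map_snd continuous_map_snd, unfolded o_def])
  then have 1: "continuous_map ?T3 euclidean (\<lambda>z. (?t (fst z), (?t (fst (snd z)), ?t (snd (snd z)))))"
    by simp
  have 2: "continuous_map euclidean euclidean H" using H by simp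
  have 3: "continuous_map euclidean T (tangent_vector M (\<kappa> b) b)"
    unfolding T_def by (rule continuous_map_tangent_vector[OF manifold c])
  have top: "topspace T = tangent_space M b"
    unfolding T_def by (rule topspace_tangent_space[OF manifold c])
  show ?thesis
    by (rule continuous_map_eq[OF continuous_map_compose[OF continuous_map_compose[OF 1 2] 3]])
      (auto simp: top assoc_lts_bracket[OF b] br)
qed

end

section \<open>Homomorphisms\<close>

locale symm_space_hom = dom: symm_space M m + cod: symm_space N n
  for M :: "('m, 'e::{topological_ab_group_add,t2_space}, 'k::base_ring) manifold" and m
    and N :: "('n, 'f::{topological_ab_group_add,t2_space}, 'k) manifold" and n +
  fixes f :: "'m \<Rightarrow> 'n"
  assumes hom: "symmetric_hom M m N n f"
begin

lemma smooth: "smooth_map M N f"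
  and mult: "x \<in> points M \<Longrightarrow> y \<in> points M \<Longrightarrow> f (m (x, y)) = n (f x, f y)"
  using hom by (auto simp: symmetric_hom_def)

lemma near: "x \<in> points M \<Longrightarrow> smooth_near M N f x"
  using smooth by (simp add: smooth_map_iff_near)

lemma closed: "x \<in> points M \<Longrightarrow> f x \<in> points N"
  by (rule smooth_near_points[OF near, THEN conjunct2])

definition D :: "'m \<Rightarrow> 'e \<Rightarrow> 'f"
  where "D x = chart_diff M N (dom.\<kappa> x) (cod.\<kappa> (f x)) f x"

lemma
  assumes x: "x \<in> points M"
  shows D_add: "D x (v + w) = D x v + D x w" and D_scale: "D x (mscale M r v) = mscale N r (D x v)"
    and tangent_map_D: "tangent_map M N f (tangent_vector M (dom.\<kappa> x) x v) =
      tangent_vector N (cod.\<kappa> (f x)) (f x) (D x v)"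
proof -
  note k = dom.kappa[OF x] and k' = cod.kappa[OF closed[OF x]]
  note * = dom.manifold cod.manifold near[OF x] k(1) k'(1) k(2) k'(2)
  show "D x (v + w) = D x v + D x w" "D x (mscale M r v) = mscale N r (D x v)"
    unfolding D_def by (rule chart_diff_add[OF *] chart_diff_scale[OF *])+
  show "tangent_map M N f (tangent_vector M (dom.\<kappa> x) x v) = tangent_vector N (cod.\<kappa> (f x)) (f x) (D x v)"
    unfolding D_def by (rule tangent_map_tangent_vector[OF dom.manifold cod.manifold near[OF x] k k'])
qed

text \<open>The derivative of \<open>f (m (x, y)) = n (f x, f y)\<close> with respect to \<open>x\<close>.\<close>

lemma D_R:
  assumes x: "x \<in> points M" and y: "y \<in> points M"
  shows "D (m (x, y)) (dom.R y x v) = cod.R (f y) (f x) (D x v)"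
proof -
  note xy = dom.mult_closed[OF x y]
  note k = dom.kappa[OF x] dom.kappa[OF xy] and k' = cod.kappa[OF closed[OF x]] cod.kappa[OF closed[OF xy]]
  note l = dom.smooth_near_mult_left[OF x y] and l' = cod.smooth_near_mult_left[OF closed[OF x] closed[OF y]]
  note fxy = mult[OF x y]
  have e: "n (f x, f y) \<in> fst (cod.\<kappa> (n (f x, f y)))" "cod.\<kappa> (n (f x, f y)) \<in> atlas N"
    using k'(3,4) by (simp_all add: fxy)
  have "D (m (x, y)) (dom.R y x v) =
      chart_diff M N (dom.\<kappa> x) (cod.\<kappa> (f (m (x, y)))) (\<lambda>z. f (m (z, y))) x v"
    unfolding D_def dom.R_def
    using chart_diff_compose[OF dom.manifold dom.manifold cod.manifold l near[OF xy]
        k(1) k(3) k'(3) k(2) k(4) k'(4)] by simp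
  also have "\<dots> = chart_diff M N (dom.\<kappa> x) (cod.\<kappa> (f (m (x, y)))) (\<lambda>z. n (f z, f y)) x v"
    by (rule chart_diff_cong[OF dom.manifold cod.manifold
          smooth_near_compose[OF dom.manifold dom.manifold cod.manifold l near[OF xy]]
          openin_topspace x _ k(1) k'(3) k(2) k'(4), symmetric]) (rule mult[OF _ y])
  also have "\<dots> = cod.R (f y) (f x) (D x v)"
    unfolding D_def cod.R_def fxy
    using chart_diff_compose[OF dom.manifold cod.manifold cod.manifold near[OF x] l'
        k(1) k'(1) e(2) k(2) k'(2) e(1)] by simp
  finally show ?thesis .
qed

text \<open>By \<open>D_R\<close> with \<open>y = m(b, p)\<close>, since the field at \<open>p\<close> is half of the derivative \<open>R\<close> there.\<close>

lemma tfield_related: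
  assumes b: "b \<in> points M"
  shows "field_related M N f (dom.tfield b v) (cod.tfield (f b) (D b v))"
  unfolding field_related_def
proof
  fix p assume p: "p \<in> points M"
  note bp = dom.mult_closed[OF b p]
  have "D p (dom.R (m (b, p)) b v) = cod.R (n (f b, f p)) (f b) (D b v)"
    using D_R[OF b bp, of v] by (simp add: dom.mult_invol[OF b p] mult[OF b p])
  then show "tangent_map M N f (dom.tfield b v p) = cod.tfield (f b) (D b v) (f p)"
    by (simp add: dom.tfield_def cod.tfield_def p closed[OF p] tangent_map_D[OF p] D_scale[OF p])
qed

lemma lts_hom_tangent_map:
  assumes b: "b \<in> points M"
  shows "lts_hom (assoc_lts M m b) (assoc_lts N n (f b)) (tangent_map M N f)"
proof -
  note k = dom.kappa[OF b] and k' = cod.kappa[OF closed[OF b]]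
  let ?c = "dom.\<kappa> b" and ?d = "cod.\<kappa> (f b)"
  have tv: "\<exists>v. \<xi> = tangent_vector M ?c b v" if "\<xi> \<in> tangent_space M b" for \<xi>
    using tangent_vector_tcoord[OF dom.manifold k that] by metis
  have sp: "tangent_vector N ?d (f b) v \<in> tangent_space N (f b)" for v
    by (rule tangent_vector_in_space[OF k'])
  have "tangent_map M N f (lbracket (assoc_lts M m b) \<xi> \<eta> \<zeta>) =
      lbracket (assoc_lts N n (f b)) (tangent_map M N f \<xi>) (tangent_map M N f \<eta>) (tangent_map M N f \<zeta>)"
    if \<xi>: "\<xi> \<in> tangent_space M b" and \<eta>: "\<eta> \<in> tangent_space M b" and \<zeta>: "\<zeta> \<in> tangent_space M b" for \<xi> \<eta> \<zeta>
  proof -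
    obtain u v w where tvs: "\<xi> = tangent_vector M ?c b u" "\<eta> = tangent_vector M ?c b v" "\<zeta> = tangent_vector M ?c b w"
      using tv \<xi> \<eta> \<zeta> by blast
    note F = dom.smooth_field_tfield[OF b] and F' = cod.smooth_field_tfield[OF closed[OF b]]
    note rel = tfield_related[OF b]
    let ?B = "lie_bracket M (dom.tfield b u) (dom.tfield b v)"
    let ?B' = "lie_bracket N (cod.tfield (f b) (D b u)) (cod.tfield (f b) (D b v))"
    have "field_related M N f ?B ?B'"
      by (rule field_related_lie_bracket[OF dom.manifold cod.manifold smooth F F F' F' rel rel])
    then have "field_related M N f (lie_bracket M ?B (dom.tfield b w))
        (lie_bracket N ?B' (cod.tfield (f b) (D b w)))"
      by (rule field_related_lie_bracket[OF dom.manifold cod.manifold smooth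
            smooth_field_lie_bracket[OF dom.manifold F F] F
            smooth_field_lie_bracket[OF cod.manifold F' F'] F' _ rel])
    then have "tangent_map M N f (lie_bracket M ?B (dom.tfield b w) b) =
        lie_bracket N ?B' (cod.tfield (f b) (D b w)) (f b)"
      using b by (simp add: field_related_def)
    then show ?thesis
      using \<xi> \<eta> \<zeta> sp
      by (simp add: tvs tangent_map_D[OF b] dom.assoc_lts_bracket[OF b] cod.assoc_lts_bracket[OF closed[OF b]]
          tcoord_tangent_vector_self[OF dom.manifold k] tcoord_tangent_vector_self[OF cod.manifold k'])
  qed
  moreover have "tangent_map M N f ` tangent_space M b \<subseteq> tangent_space N (f b)"
    using tv sp tangent_map_D[OF b] by fastforce
  moreover have "tangent_map M N f (tadd M \<xi> \<eta>) = tadd N (tangent_map M N f \<xi>) (tangent_map M N f \<eta>)"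
    if "\<xi> \<in> tangent_space M b" "\<eta> \<in> tangent_space M b" for \<xi> \<eta>
    using tv[OF that(1)] tv[OF that(2)]
    by (auto simp: tadd_tangent_vector[OF dom.manifold k] tadd_tangent_vector[OF cod.manifold k']
        tangent_map_D[OF b] D_add[OF b])
  moreover have "tangent_map M N f (tscale M r \<xi>) = tscale N r (tangent_map M N f \<xi>)"
    if "\<xi> \<in> tangent_space M b" for r \<xi>
    using tv[OF that]
    by (auto simp: tscale_tangent_vector[OF dom.manifold k] tscale_tangent_vector[OF cod.manifold k']
        tangent_map_D[OF b] D_scale[OF b])
  ultimately show ?thesis
    unfolding lts_hom_def by (simp add: assoc_lts_def)
qed

end

section \<open>The triple bracket is continuous and natural\<close>

theorem theorem2p10:
  fixes M :: "('m, 'e::{topological_ab_group_add,t2_space}, 'k::base_ring) manifold"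
    and m :: "'m \<times> 'm \<Rightarrow> 'm" and b :: 'm
  assumes "symmetric_space M m" and "b \<in> points M"
  shows "(let T = subtopology (mtop (tangent_bundle M)) (tangent_space M b) in
      continuous_map (prod_topology T (prod_topology T T)) T
        (\<lambda>(u, v, w). lbracket (assoc_lts M m b) u v w)) \<and>
    (\<forall>(M' :: ('n, 'f::{topological_ab_group_add,t2_space}, 'k) manifold) m' b' \<phi>.
      symmetric_space M' m' \<and> b' \<in> points M' \<and> symmetric_hom M m M' m' \<phi> \<and> \<phi> b = b' \<longrightarrow>
      lts_hom (assoc_lts M m b) (assoc_lts M' m' b') (tangent_map M M' \<phi>))"
proof -
  interpret symm_space M m by (rule symm_space.intro[OF assms(1)])
  have "lts_hom (assoc_lts M m b) (assoc_lts M' m' (\<phi> b)) (tangent_map M M' \<phi>)"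
    if "symmetric_space M' m'" "symmetric_hom M m M' m' \<phi>"
    for M' :: "('n, 'f, 'k) manifold" and m' \<phi>
  proof -
    interpret symm_space_hom M m M' m' \<phi>
      by (intro symm_space_hom.intro symm_space.intro symm_space_hom_axioms.intro assms(1) that)
    show ?thesis by (rule lts_hom_tangent_map[OF assms(2)])
  qed
  then show ?thesis
    using continuous_map_assoc_lts_bracket[OF assms(2)] by (auto simp: Let_def)
qed

end
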